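(* For every triangle-free, tree-free, outerplanar graph $G$, we have $\vec{\chi}(G)\leq 4$.
   Context: All graphs are finite, without loops or multiple edges. An orientation of a graph $G$ is a digraph obtained from $G$ by replacing each edge by exactly one of the two possible arcs with the same end-vertices. For an orientation $D$ and vertex $v$, $d^-_D(v)$ denotes the in-degree of $v$ in $D$. An orientation $D$ of $G$ is proper if $d^-_D(u)\neq d^-_D(v)$ for every edge $uv$ of $G$. The proper orientation number $\vec{\chi}(G)$ is the minimum integer $k$ such that $G$ has a proper orientation with maximum in-degree at most $k$. A graph is outerplanar if it has a planar embedding in which all vertices lie on the boundary of a single face. A bridge is an edge whose deletion increases the number of connected components. A graph is tree-free if, after removing all its bridges, every remaining connected (2-edge-connected) component has at least $3$ vertices. *)

theory Defs
  imports "HOL-Analysis.Analysis" "Graph_Theory.Graph_Theory"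
begin

text \<open>
  A finite simple graph is a \<open>pair_graph\<close>: an edge \<open>uv\<close> is represented by the two pairs
  \<open>(u,v)\<close> and \<open>(v,u)\<close>. In such symmetric digraphs the strongly connected components
  (\<open>sccs\<close>) are exactly the connected components of the graph. Arbitrary digraphs on the
  same vertices, such as orientations, are also elements of \<open>'a pair_pre_digraph\<close>.
\<close>

definition triangle_free :: "'a pair_pre_digraph \<Rightarrow> bool" where
  "triangle_free G \<longleftrightarrow>
     \<not> (\<exists>u v w. (u, v) \<in> parcs G \<and> (v, w) \<in> parcs G \<and> (w, u) \<in> parcs G)"


definition orientation :: "'a pair_pre_digraph \<Rightarrow> 'a pair_pre_digraph \<Rightarrow> bool" where
  "orientation G D \<longleftrightarrow>
     pverts D = pverts G \<and> parcs D \<subseteq> parcs G \<and>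
     (\<forall>(u, v) \<in> parcs G. ((u, v) \<in> parcs D) \<noteq> ((v, u) \<in> parcs D))"

definition proper_orientation :: "'a pair_pre_digraph \<Rightarrow> 'a pair_pre_digraph \<Rightarrow> bool" where
  "proper_orientation G D \<longleftrightarrow>
     orientation G D \<and>
     (\<forall>(u, v) \<in> parcs G. in_degree (with_proj D) u \<noteq> in_degree (with_proj D) v)"

text \<open>
  Every finite simple graph has a proper orientation (repeatedly orient all remaining edges at
  a vertex of maximum remaining degree towards it, and delete that vertex), so the minimum
  below ranges over a nonempty set.
\<close>

definition proper_orientation_number :: "'a pair_pre_digraph \<Rightarrow> nat" where
  "proper_orientation_number G =
     (LEAST k. \<exists>D. proper_orientation G D \<and>
        (\<forall>v \<in> pverts G. in_degree (with_proj D) v \<le> k))"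


definition del_edges :: "'a pair_pre_digraph \<Rightarrow> ('a \<times> 'a) set \<Rightarrow> 'a pair_pre_digraph" where
  "del_edges G F = \<lparr> pverts = pverts G, parcs = parcs G - F \<rparr>"

definition graph_components :: "'a pair_pre_digraph \<Rightarrow> ('a, 'a \<times> 'a) pre_digraph set" where
  "graph_components G = pre_digraph.sccs (with_proj G)"

text \<open>The set of bridges, each one given by both of its pairs.\<close>

definition bridges :: "'a pair_pre_digraph \<Rightarrow> ('a \<times> 'a) set" where
  "bridges G = {(u, v) \<in> parcs G.
     card (graph_components (del_edges G {(u, v), (v, u)})) > card (graph_components G)}"

definition tree_free :: "'a pair_pre_digraph \<Rightarrow> bool" where
  "tree_free G \<longleftrightarrow> (\<forall>H \<in> graph_components (del_edges G (bridges G)). card (verts H) \<ge> 3)"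


text \<open>
  Planar embeddings live in the plane \<open>complex\<close>, the type for which the library states the
  Jordan curve theorem. The two pairs of an edge are drawn as one simple arc, traversed in
  opposite directions. An arc meets the set of vertices in its two ends only, and two different
  edges meet in vertices only, hence only in common ends.
\<close>

definition planar_embedding ::
  "'a pair_pre_digraph \<Rightarrow> ('a \<Rightarrow> complex) \<Rightarrow> ('a \<times> 'a \<Rightarrow> real \<Rightarrow> complex) \<Rightarrow> bool" where
  "planar_embedding G p \<gamma> \<longleftrightarrow>
     inj_on p (pverts G) \<and>
     (\<forall>(u, v) \<in> parcs G.
        arc (\<gamma> (u, v)) \<and> pathstart (\<gamma> (u, v)) = p u \<and> pathfinish (\<gamma> (u, v)) = p v \<and>
        \<gamma> (v, u) = reversepath (\<gamma> (u, v)) \<and>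
        path_image (\<gamma> (u, v)) \<inter> p ` pverts G = {p u, p v}) \<and>
     (\<forall>e \<in> parcs G. \<forall>f \<in> parcs G. f \<noteq> e \<and> f \<noteq> prod.swap e \<longrightarrow>
        path_image (\<gamma> e) \<inter> path_image (\<gamma> f) \<subseteq> p ` pverts G)"

definition faces ::
  "'a pair_pre_digraph \<Rightarrow> ('a \<Rightarrow> complex) \<Rightarrow> ('a \<times> 'a \<Rightarrow> real \<Rightarrow> complex) \<Rightarrow> complex set set" where
  "faces G p \<gamma> = components (- (p ` pverts G \<union> (\<Union>e \<in> parcs G. path_image (\<gamma> e))))"

definition outerplanar :: "'a pair_pre_digraph \<Rightarrow> bool" where
  "outerplanar G \<longleftrightarrow>
     (\<exists>p \<gamma>. planar_embedding G p \<gamma> \<and> (\<exists>F \<in> faces G p \<gamma>. p ` pverts G \<subseteq> frontier F))"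

end

theory Submission
  imports Defs
begin

text \<open>
  In an outerplanar graph no three disjoint connected sets of vertices are all adjacent to the same
  two further vertices: three arcs through them would form a theta curve, and the frontier of any
  region in its complement misses the interior of one of the three arcs.

  Consequently, let \<open>C\<close> be a connected set of vertices that is attached to the rest of the graph only
  at the ends of an edge \<open>uv\<close>, or only at a vertex \<open>u = v\<close> with two neighbours in \<open>C\<close>. A shortest path
  \<open>x\<^sub>1, \<dots>, x\<^sub>k\<close> through \<open>C\<close> from \<open>u\<close> to \<open>v\<close> closes up to an induced cycle of length at
  least 4, and every component of the rest of \<open>C\<close> is attached to one vertex or to one edge of that
  cycle. By induction one knows which in-degrees at their attachments such components can
  produce. The cycle is oriented so that the in-degrees along \<open>x\<^sub>1, \<dots>, x\<^sub>k\<close> alternate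
  between 0 and 2, apart from single 1s near the ends where parity demands them; a vertex of in-degree
  2 that conflicts with what hangs at it is raised to 3 or 4 by letting a component send
  an arc into it. A bridge is always oriented away from the root, and its lower end receives in-degree
  1 or 3, the latter by means of a cycle through that end, which exists in a tree-free graph.
\<close>

text \<open>Properness at an attachment concerns its final in-degree, which also counts arcs still
  undecided elsewhere. The induction hypothesis therefore prescribes the final in-degrees of the
  attachments in advance and lists how many arcs the piece hanging there can send into them; pieces
  at the same place are combined by adding these numbers. The lists must be weak enough to be
  re-established for every larger piece and strong enough to colour an ear, which fixes the form of
  \<open>edge_ok\<close> and \<open>vert_ok\<close>.

  A vertex of in-degree 0 conflicts with no piece and receives nothing, so it separates the two
  sides of the ear, and the alternating pattern extends by two vertices at no cost. Only the ends of
  an ear and the parity of its length remain to be treated. A blocked 2 that has become a 3 is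
  accepted by all other pieces, so objections never accumulate. The in-degree 4 is needed only
  beside an end of in-degree 3, where 3 itself is taken; a piece then sends two arcs.
  Triangle-freeness supplies the lengths that these patterns require: at least 2 inner vertices for
  an open ear and 3 for a closed one.\<close>

section \<open>Colouring along an ear\<close>

text \<open>
  \<open>P c c' a b\<close> stands for: what hangs at an edge whose ends have final in-degrees \<open>c\<close> and \<open>c'\<close> can be
  oriented properly so that it sends \<open>a\<close> arcs into the first end and \<open>b\<close> into the second. Only the
  in-degrees 1 and 2 can force it to send an arc, which then raises the 2 to a 3. Likewise for
  \<open>Q c q\<close> and a vertex, where only the in-degree 2 is critical.
\<close>

definition edge_ok :: "(nat \<Rightarrow> nat \<Rightarrow> nat \<Rightarrow> nat \<Rightarrow> bool) \<Rightarrow> bool" where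
  "edge_ok P \<longleftrightarrow>
     (\<forall>c c'. c \<noteq> c' \<and> {c, c'} \<noteq> {1, 2} \<longrightarrow> P c c' 0 0) \<and>
     (P 1 2 0 0 \<and> P 2 1 0 0 \<or> P 3 1 1 0 \<and> P 1 3 0 1) \<and>
     (P 1 2 0 0 \<or> P 3 2 1 0) \<and> (P 2 1 0 0 \<or> P 2 3 0 1)"

definition vert_ok :: "(nat \<Rightarrow> nat \<Rightarrow> bool) \<Rightarrow> bool" where
  "vert_ok Q \<longleftrightarrow> (\<forall>c. c \<noteq> 2 \<longrightarrow> Q c 0) \<and> (Q 2 0 \<or> Q 3 1 \<and> Q 4 2)"

text \<open>
  \<open>reach P Q cu \<alpha> i c s\<close>: the part of an ear before its \<open>i\<close>-th vertex can be oriented so that it sends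
  \<open>\<alpha>\<close> arcs into the starting point, of in-degree \<open>cu\<close>, and \<open>s\<close> arcs into the \<open>i\<close>-th vertex, whose
  final in-degree is \<open>c\<close>. Here \<open>t = 1\<close> iff the edge of the ear is directed forwards.
\<close>

inductive reach ::
  "(nat \<Rightarrow> nat \<Rightarrow> nat \<Rightarrow> nat \<Rightarrow> nat \<Rightarrow> bool) \<Rightarrow> (nat \<Rightarrow> nat \<Rightarrow> nat \<Rightarrow> bool) \<Rightarrow>
   nat \<Rightarrow> nat \<Rightarrow> nat \<Rightarrow> nat \<Rightarrow> nat \<Rightarrow> bool"
  for P Q cu \<alpha> where
  first: "P 0 cu c 0 b \<Longrightarrow> cu \<noteq> c \<Longrightarrow> \<alpha> + t = 1 \<Longrightarrow> reach P Q cu \<alpha> (Suc 0) c (t + b)"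
| step: "reach P Q cu \<alpha> i c s \<Longrightarrow> Q i c q \<Longrightarrow> P i c c' a b \<Longrightarrow> c \<noteq> c' \<Longrightarrow> t \<le> 1 \<Longrightarrow>
    c \<le> 4 \<Longrightarrow> c = s + q + a + (1 - t) \<Longrightarrow> reach P Q cu \<alpha> (Suc i) c' (t + b)"

text \<open>An ear with inner vertices 1 to \<open>k\<close> has edges 0 to \<open>k\<close>, edge
  \<open>i\<close> joining the vertices \<open>i\<close> and \<open>i + 1\<close>. Reversal thus
  sends edge \<open>i\<close> to \<open>k - i\<close> but vertex \<open>i\<close> to
  \<open>k + 1 - i\<close>; at the two end points there is no vertex piece to compare.\<close>

definition mirror where
  "mirror k P Q P' Q' \<longleftrightarrow>
     (\<forall>i\<le>k. \<forall>c c' a b. P' i c c' a b = P (k - i) c' c b a) \<and>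
     (\<forall>i. 1 \<le> i \<and> i \<le> k \<longrightarrow> Q' i = Q (Suc k - i))"

text \<open>\<open>P'\<close> and \<open>Q'\<close> describe the same ear read from its other end; the two readings meet at vertex \<open>i\<close>.\<close>

definition sol where
  "sol k P Q P' Q' cu cv \<alpha> \<beta> \<longleftrightarrow>
     (\<exists>i j c s q s'. i + j = Suc k \<and> 1 \<le> i \<and> 1 \<le> j \<and> reach P Q cu \<alpha> i c s \<and>
        reach P' Q' cv \<beta> j c s' \<and> Q i c q \<and> c = s + q + s' \<and> c \<le> 4)"

lemma solI:
  "reach P Q cu \<alpha> i c s \<Longrightarrow> reach P' Q' cv \<beta> j c s' \<Longrightarrow> Q i c q \<Longrightarrow> c = s + q + s' \<Longrightarrow> c \<le> 4 \<Longrightarrow>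
   i + j = Suc k \<Longrightarrow> 1 \<le> i \<Longrightarrow> 1 \<le> j \<Longrightarrow> sol k P Q P' Q' cu cv \<alpha> \<beta>"
  unfolding sol_def by blast

lemma mirror_sym: "mirror k P Q P' Q' \<Longrightarrow> mirror k P' Q' P Q"
  unfolding mirror_def
  by (auto simp: Suc_diff_le)

lemma sol_sym:
  assumes "mirror k P Q P' Q'" "sol k P' Q' P Q cv cu \<beta> \<alpha>"
  shows "sol k P Q P' Q' cu cv \<alpha> \<beta>"
proof -
  obtain i j c s q s' where *: "i + j = Suc k" "1 \<le> i" "1 \<le> j" "reach P' Q' cv \<beta> i c s"
    "reach P Q cu \<alpha> j c s'" "Q' i c q" "c = s + q + s'" "c \<le> 4"
    using assms(2) unfolding sol_def by blast
  have "i \<le> k" "Suc k - i = j" using * by auto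
  then have "Q' i = Q j" using assms(1) * unfolding mirror_def by metis
  then have "Q j c q" using * by simp
  moreover have "j + i = Suc k" "c = s' + q + s" using * by auto
  ultimately show ?thesis unfolding sol_def using * by blast
qed

locale admissible =
  fixes P :: "nat \<Rightarrow> nat \<Rightarrow> nat \<Rightarrow> nat \<Rightarrow> nat \<Rightarrow> bool" and Q :: "nat \<Rightarrow> nat \<Rightarrow> nat \<Rightarrow> bool"
  assumes eok: "\<And>i. edge_ok (P i)" and vok: "\<And>i. vert_ok (Q i)"
begin

lemma P00: "c \<noteq> c' \<Longrightarrow> \<not> (c = 1 \<and> c' = 2) \<Longrightarrow> \<not> (c = 2 \<and> c' = 1) \<Longrightarrow> P i c c' 0 0"
  using eok[of i] unfolding edge_ok_def by (auto simp: doubleton_eq_iff)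

lemma P12: "P i 1 2 0 0 \<or> P i 1 3 0 1"
  using eok[of i] unfolding edge_ok_def by blast

lemma P21: "P i 2 1 0 0 \<or> P i 3 1 1 0"
  using eok[of i] unfolding edge_ok_def by blast

lemma Q0: "c \<noteq> 2 \<Longrightarrow> Q i c 0"
  using vok[of i] unfolding vert_ok_def by blast

lemma Q2: "Q i 2 0 \<or> Q i 3 1 \<and> Q i 4 2"
  using vok[of i] unfolding vert_ok_def by blast

lemma first0: "P 0 cu c 0 b \<Longrightarrow> cu \<noteq> c \<Longrightarrow> reach P Q cu 0 (Suc 0) c (Suc b)"
  using first[where \<alpha>=0 and t=1] by force

lemma first1: "P 0 cu c 0 b \<Longrightarrow> cu \<noteq> c \<Longrightarrow> reach P Q cu 1 (Suc 0) c b"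
  using first[where \<alpha>=1 and t=0] by force

lemma step_forward: "reach P Q cu \<alpha> i c s \<Longrightarrow> Q i c q \<Longrightarrow> P i c c' a b \<Longrightarrow> c \<noteq> c' \<Longrightarrow>
    c \<le> 4 \<Longrightarrow> c = s + q + a \<Longrightarrow> reach P Q cu \<alpha> (Suc i) c' (Suc b)"
  using step[where t=1] by force

lemma step_backward: "reach P Q cu \<alpha> i c s \<Longrightarrow> Q i c q \<Longrightarrow> P i c c' a b \<Longrightarrow> c \<noteq> c' \<Longrightarrow>
    c \<le> 4 \<Longrightarrow> c = Suc (s + q + a) \<Longrightarrow> reach P Q cu \<alpha> (Suc i) c' b"
  using step[where t=0] by force

text \<open>A vertex of in-degree 0 gives away its next edge. The following vertex takes both of its
  ear edges, so it is 2, or 3 if the piece at it objects, and nothing is left for the vertex after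
  that. No edge piece objects to a pair containing 0.\<close>

lemma zero_step:
  assumes "reach P Q cu \<alpha> i 0 0"
  shows "reach P Q cu \<alpha> (Suc (Suc i)) 0 0"
proof -
  have *: "reach P Q cu \<alpha> (Suc i) c (Suc 0)" if "c \<noteq> 0" for c
    using step_forward[OF assms Q0 P00[where c'=c]] that by auto
  show ?thesis
  proof (cases "Q (Suc i) 2 0")
    case True
    then show ?thesis using step_backward[OF *[of 2] True P00[of 2 0]] by (auto simp: numeral_eq_Suc)
  next
    case False
    then have "Q (Suc i) 3 1" using Q2 by blast
    then show ?thesis using step_backward[OF *[of 3] _ P00[of 3 0], of 1] by (auto simp: numeral_eq_Suc)
  qed
qed

lemma zero_iter: "reach P Q cu \<alpha> i 0 0 \<Longrightarrow> reach P Q cu \<alpha> (i + 2 * m) 0 0"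
  by (induction m) (auto dest: zero_step)

text \<open>The digits in the names are the in-degrees before the first 0, prior to raising any 2.\<close>

lemma start_2:
  assumes "cu = 2 \<longrightarrow> P 0 2 3 0 1"
  shows "reach P Q cu 0 2 0 0"
proof -
  have A: ?thesis if "reach P Q cu 0 (Suc 0) c s" "Q (Suc 0) c q" "c = Suc (s + q)" "c \<le> 4" for c s q
    using step_backward[OF that(1,2) P00[of c 0]] that(3,4) by (auto simp: numeral_2_eq_2)
  consider "cu = 2" | "cu = 1" "\<not> P 0 1 2 0 0" | "cu = 3" | "cu \<noteq> 2" "cu \<noteq> 3" "cu = 1 \<longrightarrow> P 0 1 2 0 0"
    by blast
  then show ?thesis
  proof cases
    case 1
    \<comment> \<open>The first vertex cannot equal \<open>cu = 2\<close>; the hypothesis lets the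
      piece on the first edge raise it to 3.\<close>
    then show ?thesis using A[OF first0[of cu 3 1], of 0] assms Q0 by (auto simp: numeral_eq_Suc)
  next
    case 2
    then show ?thesis using A[OF first0[of cu 3 1], of 0] P12[of 0] Q0 by (auto simp: numeral_eq_Suc)
  next
    case 3
    show ?thesis
    proof (cases "Q (Suc 0) 2 0")
      case True
      then show ?thesis using A[OF first0[of cu 2 0], of 0] P00[of cu 2 0] 3 by (auto simp: numeral_eq_Suc)
    next
      case False
      \<comment> \<open>Raising to 3 would collide with \<open>cu = 3\<close>, so the piece at the
        vertex has to send two arcs. This situation is what forces the value 4.\<close>
      then have "Q (Suc 0) 4 2" using Q2 by blast
      then show ?thesis using A[OF first0[of cu 4 0], of 2] P00[of cu 4 0] 3 by (auto simp: numeral_eq_Suc)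
    qed
  next
    case 4
    then have "P 0 cu 2 0 0" using P00[of cu 2 0] by (auto simp: numeral_eq_Suc)
    show ?thesis
    proof (cases "Q (Suc 0) 2 0")
      case True
      then show ?thesis using A[OF first0[of cu 2 0], of 0] \<open>P 0 cu 2 0 0\<close> 4 by (auto simp: numeral_eq_Suc)
    next
      case False
      then have "Q (Suc 0) 3 1" using Q2 by blast
      then show ?thesis using A[OF first0[of cu 3 0], of 1] P00[of cu 3 0] 4 by (auto simp: numeral_eq_Suc)
    qed
  qed
qed

text \<open>Both ear edges at the first vertex run forwards, which leaves it with in-degree exactly
  1 and passes one arc on.\<close>

lemma after_1:
  assumes "cu \<noteq> 1" "cu = 2 \<longrightarrow> P 0 2 1 0 0"
    and "P (Suc 0) 1 c 0 b" "c \<noteq> 1"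
  shows "reach P Q cu 0 2 c (Suc b)"
proof -
  have "P 0 cu 1 0 0" using assms P00[of cu 1 0] by (cases "cu = 2") auto
  then show ?thesis
    using step_forward[OF first0[of cu 1 0] Q0 assms(3)] assms by (auto simp: numeral_2_eq_2)
qed

text \<open>The extra 1 makes the initial segment one vertex longer than in \<open>start_2\<close>
  and thereby switches its parity.\<close>

lemma start_12:
  assumes "cu \<noteq> 1" "cu = 2 \<longrightarrow> P 0 2 1 0 0"
  shows "reach P Q cu 0 3 0 0"
proof -
  have A: ?thesis if "P (Suc 0) 1 c 0 b" "Q 2 c q" "c = Suc (Suc b + q)" "c \<le> 4" for c b q
    using step_backward[OF after_1[OF assms that(1)] that(2) P00[of c 0]] that(3,4)
    by (auto simp: numeral_eq_Suc)
  show ?thesis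
  proof (cases "P (Suc 0) 1 2 0 0")
    case False
    then show ?thesis using A[of 3 1 0] P12[of "Suc 0"] Q0 by (auto simp: numeral_eq_Suc)
  next
    case True
    show ?thesis
    proof (cases "Q 2 2 0")
      case True
      then show ?thesis using A[of 2 0 0] \<open>P (Suc 0) 1 2 0 0\<close> by (auto simp: numeral_eq_Suc)
    next
      case False
      then have "Q 2 3 1" using Q2 by blast
      then show ?thesis using A[of 3 0 1] P00[of 1 3 "Suc 0"] by (auto simp: numeral_eq_Suc)
    qed
  qed
qed

text \<open>Replaces \<open>start_12\<close> for \<open>cu = 1\<close>, where the first vertex must
  not be 1. That vertex may be blocked by three pieces, those on its two ear edges and the one at
  the vertex itself; one arc from any of them makes it 3, and the other two then send
  nothing.\<close>

lemma start_21: "reach P Q 1 0 3 0 0"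
proof -
  have A: ?thesis if "reach P Q 1 0 (Suc 0) c s" "Q (Suc 0) c q" "P (Suc 0) c 1 a 0"
    "c = Suc (s + q + a)" "c \<le> 4" "c \<noteq> 1" for c s q a
  proof -
    have "reach P Q 1 0 2 1 0"
      using step_backward[OF that(1,2,3)] that(4,5,6) by (auto simp: numeral_2_eq_2)
    then show ?thesis
      using step_backward[OF _ Q0 P00[of 1 0], of 1 0 2 0] by (auto simp: numeral_eq_Suc)
  qed
  show ?thesis
  proof (cases "P 0 1 2 0 0")
    case False
    then have "P 0 1 3 0 1" using P12 by blast
    then show ?thesis using A[OF first0[of 1 3 1] Q0 P00[of 3 1]] by (auto simp: numeral_eq_Suc)
  next
    case P0: True
    show ?thesis
    proof (cases "P (Suc 0) 2 1 0 0")
      case False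
      then have "P (Suc 0) 3 1 1 0" using P21 by blast
      then show ?thesis using A[OF first0[of 1 3 0] Q0, of 1] P00[of 1 3] by (auto simp: numeral_eq_Suc)
    next
      case P1: True
      show ?thesis
      proof (cases "Q (Suc 0) 2 0")
        case True
        then show ?thesis using A[OF first0[of 1 2 0], of 0 0] P0 P1 by (auto simp: numeral_eq_Suc)
      next
        case False
        then have "Q (Suc 0) 3 1" using Q2 by blast
        then show ?thesis using A[OF first0[of 1 3 0], of 1 0] P00[of 1 3] P00[of 3 1] by (auto simp: numeral_eq_Suc)
      qed
    qed
  qed
qed

text \<open>Here and in \<open>start_1\<close> the first edge is spent on the starting point
  (\<alpha> = 1). The two versions again differ in parity.\<close>

lemma start_0: "cu \<noteq> 0 \<Longrightarrow> reach P Q cu 1 1 0 0"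
  using first1[of cu 0 0] P00[of cu 0 0] by (auto simp: numeral_eq_Suc)

lemma start_1: "cu \<noteq> 1 \<Longrightarrow> cu \<noteq> 2 \<Longrightarrow> reach P Q cu 1 2 0 0"
  using step_backward[OF first1[of cu 1 0] Q0 P00[of 1 0]] P00[of cu 1 0] by (auto simp: numeral_2_eq_2)

end

section \<open>Joining the starts at the two ends of an ear\<close>

locale mirrored = admissible P Q for P Q +
  fixes k P' Q'
  assumes mir: "mirror k P Q P' Q'"
    and admissible': "admissible P' Q'"
begin

sublocale R: admissible P' Q' by (rule admissible')

lemma zero_join:
  assumes "reach P Q cu \<alpha> i 0 0" "reach P' Q' cv \<beta> j 0 0" "i + j \<le> Suc k" "even (Suc k - (i + j))"
    "1 \<le> i" "1 \<le> j"
  shows "sol k P Q P' Q' cu cv \<alpha> \<beta>"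
proof -
  obtain m where m: "Suc k - (i + j) = 2 * m" using assms(4) by blast
  then have "(i + 2 * m) + j = Suc k" "1 \<le> i + 2 * m" using assms(3,5) by auto
  moreover have "reach P Q cu \<alpha> (i + 2 * m) 0 0" using zero_iter[OF assms(1)] .
  moreover have "Q (i + 2 * m) 0 0" "(0::nat) = 0 + 0 + 0" "(0::nat) \<le> 4" using Q0 by auto
  ultimately show ?thesis unfolding sol_def using assms(2,6) by blast
qed

text \<open>The raise from 2 to 3 that an ear offers. With \<open>cv = 1\<close> it serves the
  coupled clause of \<open>edge_ok\<close>; with \<open>cv = 3\<close>, when both ends are the same
  vertex, it serves \<open>vert_ok\<close>.\<close>

lemma sol_31:
  assumes "2 \<le> k" "cv \<noteq> 2"
  shows "sol k P Q P' Q' 3 cv 1 0"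
proof (cases "even k")
  case True
  then show ?thesis using assms zero_join[OF start_0 R.start_2, of 3 cv] by auto
next
  case False
  then have "3 \<le> k" using assms by presburger
  then show ?thesis using assms False zero_join[OF start_1 R.start_2, of 3 cv] by auto
qed

text \<open>Both end edges are directed outwards, so a closed ear sends two arcs into its
  vertex.\<close>

lemma sol_11:
  assumes "2 \<le> k" "3 \<le> c"
  shows "sol k P Q P' Q' c c 1 1"
proof (cases "even k")
  case True
  then show ?thesis using assms zero_join[OF start_1 R.start_0, of c c] by auto
next
  case False
  then show ?thesis using assms zero_join[OF start_0 R.start_0, of c c] by auto
qed

lemma sol_closed:
  assumes "3 \<le> k" "c \<noteq> 2"
  shows "sol k P Q P' Q' c c 0 0"
proof (cases "even k")
  case False
  then show ?thesis using zero_join[OF start_2 R.start_2, of c c] assms by auto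
next
  case True
  then have "4 \<le> k" using assms by presburger
  \<comment> \<open>Two starts of type 2 have the wrong parity for even \<open>k\<close>, so one of
    them takes an additional 1; beside an end of in-degree 1 that 1 has to come second.\<close>
  show ?thesis
  proof (cases "c = 1")
    case True
    then show ?thesis using zero_join[OF start_21 R.start_2, of 1] \<open>4 \<le> k\<close> \<open>even k\<close> by auto
  next
    case False
    then show ?thesis using zero_join[OF start_12 R.start_2, of c c] assms \<open>4 \<le> k\<close> \<open>even k\<close> by auto
  qed
qed

text \<open>There is no room for a 0: the second vertex gets 1 from the far end and the first
  collects both its edges. If \<open>cu = 3\<close>, the first vertex must become 2 or 4, so the
  middle piece must accept a 2; if \<open>cu = 2\<close>, one of the two edge pieces at the first
  vertex has to raise it to 3.\<close>

lemma sol_2: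
  assumes "k = 2" "cv \<noteq> 1" "cv = 2 \<longrightarrow> P' 0 2 1 0 0" "cu = 3 \<longrightarrow> P' 1 1 2 0 0"
    "cu = 2 \<longrightarrow> P 0 2 3 0 1 \<or> P' 1 1 3 0 1"
  shows "sol k P Q P' Q' cu cv 0 0"
proof -
  have A: ?thesis if "P 0 cu c 0 a" "Q (Suc 0) c q" "P' (Suc 0) 1 c 0 b" "c = Suc a + q + Suc b"
    "c \<le> 4" "c \<noteq> cu" for c q a b
    using solI[OF first0[OF that(1)] R.after_1[OF assms(2,3) that(3)] that(2), of k] that assms(1)
    by simp
  have P1: "P' 1 1 2 0 0 \<or> P' 1 1 3 0 1" and P0: "P 0 1 2 0 0 \<or> P 0 1 3 0 1"
    using P12[of 0] R.P12[of 1] by auto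
  consider "cu = 2" | "cu = 3" | "cu \<noteq> 2" "cu \<noteq> 3" "P' 1 1 3 0 1"
    | "cu = 1" "P 0 1 3 0 1" | "cu \<noteq> 2" "cu \<noteq> 3" "cu = 1 \<longrightarrow> P 0 1 2 0 0" "P' 1 1 2 0 0"
    using P0 P1 by blast
  then show ?thesis
  proof cases
    case 1
    then consider "P 0 2 3 0 1" | "P' 1 1 3 0 1" using assms(5) by blast
    then show ?thesis
    proof cases
      case a: 1
      then show ?thesis using A[of 3 1 0 0] 1 Q0[of 3] R.P00[of 1 3] by (auto simp: numeral_eq_Suc)
    next
      case b: 2
      then show ?thesis using A[of 3 0 0 1] 1 Q0[of 3] P00[of 2 3] by (auto simp: numeral_eq_Suc)
    qed
  next
    case 2
    then show ?thesis
      using A[of 2 0 0 0] A[of 4 0 2 0] Q2[of "Suc 0"] assms(4) P00[of 3 2] P00[of 3 4] R.P00[of 1 4]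
      by (auto simp: numeral_eq_Suc)
  next
    case 3
    then show ?thesis using A[of 3 0 0 1] Q0[of 3] P00[of cu 3] by (auto simp: numeral_eq_Suc)
  next
    case 4
    then show ?thesis using A[of 3 1 0 0] Q0[of 3] R.P00[of 1 3] by (auto simp: numeral_eq_Suc)
  next
    case 5
    then have "P 0 cu 2 0 0" using P00[of cu 2] by (cases "cu = 1") auto
    then show ?thesis
      using A[of 2 0 0 0] A[of 3 0 1 0] Q2[of "Suc 0"] 5 P00[of cu 3] R.P00[of 1 3] by (auto simp: numeral_eq_Suc)
  qed
qed

text \<open>Substitute for a pair of \<open>start_12\<close>, which needs \<open>k >= 5\<close>. The
  pattern is 1, 2, 1, where one arc from a single piece resolves any objection at the middle
  vertex.\<close>

lemma sol_3:
  assumes "k = 3" "cu \<noteq> 1" "cu = 2 \<longrightarrow> P 0 2 1 0 0" "cv \<noteq> 1" "cv = 2 \<longrightarrow> P' 0 2 1 0 0"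
  shows "sol k P Q P' Q' cu cv 0 0"
proof -
  have A: ?thesis if "P (Suc 0) 1 c 0 a" "Q 2 c q" "P' (Suc 0) 1 c 0 b" "c = Suc a + q + Suc b"
    "c \<le> 4" "c \<noteq> 1" for c q a b
    using solI[OF after_1[OF assms(2,3) that(1)] R.after_1[OF assms(4,5) that(3)] that(2), of k] that assms(1)
    by simp
  have P1: "P' 1 1 2 0 0 \<or> P' 1 1 3 0 1" and P0: "P 1 1 2 0 0 \<or> P 1 1 3 0 1"
    using P12[of 1] R.P12[of 1] by auto
  then consider "P 1 1 3 0 1" | "P' 1 1 3 0 1" | "P 1 1 2 0 0" "P' 1 1 2 0 0"
    by blast
  then show ?thesis
  proof cases
    case 1
    then show ?thesis using A[of 3 1 0 0] Q0[of 3] R.P00[of 1 3] by (auto simp: numeral_eq_Suc)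
  next
    case 2
    then show ?thesis using A[of 3 0 0 1] Q0[of 3] P00[of 1 3] by (auto simp: numeral_eq_Suc)
  next
    case 3
    then show ?thesis
      using A[of 2 0 0 0] A[of 3 0 1 0] Q2[of 2] P00[of 1 3] R.P00[of 1 3] by (auto simp: numeral_eq_Suc)
  qed
qed

end

lemma mirrored_sym: "mirrored P Q k P' Q' \<Longrightarrow> mirrored P' Q' k P Q"
  unfolding mirrored_def mirrored_axioms_def using mirror_sym by blast

context mirrored
begin

interpretation M: mirrored P' Q' k P Q
  by (rule mirrored_sym) unfold_locales

lemma start_cases: "P i 2 1 0 0 \<or> P i 2 3 0 1"
  using eok[of i] unfolding edge_ok_def by blast

lemma start_cases': "P' i 2 1 0 0 \<or> P' i 2 3 0 1"
  using R.eok[of i] unfolding edge_ok_def by blast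

lemma sol_open_0:
  assumes "2 \<le> k" "cu \<noteq> cv" "{cu, cv} \<noteq> {1, 2}"
  shows "sol k P Q P' Q' cu cv 0 0"
proof (cases "k = 2")
  case True
  have 1: "sol k P Q P' Q' cu cv 0 0" if "cv \<noteq> 1" "cv = 2 \<longrightarrow> P' 0 2 1 0 0"
    "cu = 3 \<longrightarrow> P' 1 1 2 0 0" "cu = 2 \<longrightarrow> P 0 2 3 0 1 \<or> P' 1 1 3 0 1"
    using sol_2[OF True] that by blast
  have 2: "sol k P Q P' Q' cu cv 0 0" if "cu \<noteq> 1" "cu = 2 \<longrightarrow> P 0 2 1 0 0"
    "cv = 3 \<longrightarrow> P 1 1 2 0 0" "cv = 2 \<longrightarrow> P' 0 2 3 0 1 \<or> P 1 1 3 0 1"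
    using sol_sym[OF mir] M.sol_2[OF True] that by blast
  have "P 1 2 1 0 0 = P' 1 1 2 0 0" "P 1 3 1 1 0 = P' 1 1 3 0 1"
    using mir True unfolding mirror_def by simp_all
  moreover have "P 1 1 2 0 0 \<and> P 1 2 1 0 0 \<or> P 1 3 1 1 0 \<and> P 1 1 3 0 1"
    using eok[of 1] unfolding edge_ok_def by blast
  \<comment> \<open>On the middle edge the orders (1, 2) and (2, 1) are both accepted or can both be
    raised. This is why \<open>edge_ok\<close> couples them in one disjunction: where the pattern of
    \<open>sol_2\<close> fails in one reading, it works in the other.\<close>
  ultimately have H: "P 1 1 2 0 0 \<and> P' 1 1 2 0 0 \<or> P 1 1 3 0 1 \<and> P' 1 1 3 0 1"
    by blast
  show ?thesis
  proof (cases "cv \<noteq> 1 \<and> (cv = 2 \<longrightarrow> P' 0 2 1 0 0) \<and> (cu = 3 \<longrightarrow> P' 1 1 2 0 0) \<and>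
      (cu = 2 \<longrightarrow> P 0 2 3 0 1 \<or> P' 1 1 3 0 1)")
    case True
    then show ?thesis using 1 by blast
  next
    case F: False
    then have "cu \<noteq> 1" "cu = 2 \<longrightarrow> P 0 2 1 0 0" "cv = 3 \<longrightarrow> P 1 1 2 0 0"
      "cv = 2 \<longrightarrow> P' 0 2 3 0 1 \<or> P 1 1 3 0 1"
      using H start_cases[of 0] start_cases'[of 0] assms(2,3) by (auto simp: doubleton_eq_iff)
    then show ?thesis using 2 by blast
  qed
next
  case False
  show ?thesis
  proof (cases "even k")
    case even: True
    then have k: "4 \<le> k" using False assms(1) by presburger
    \<comment> \<open>For even \<open>k\<close> exactly one end must start with type 12. An end 1
      excludes that type, and an end 2 leaves the choice to the piece on its edge; since
      \<open>cu\<close> and \<open>cv\<close> differ and are not \<open>{1, 2}\<close>, at most one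
      end is restricted.\<close>
    show ?thesis
    proof (cases "(cu = 2 \<longrightarrow> P 0 2 3 0 1) \<and> cv \<noteq> 1 \<and> (cv = 2 \<longrightarrow> P' 0 2 1 0 0)")
      case True
      then show ?thesis using zero_join[OF start_2 R.start_12, of cu cv] k even by auto
    next
      case F: False
      then have "cu \<noteq> 1 \<and> (cu = 2 \<longrightarrow> P 0 2 1 0 0) \<and> (cv = 2 \<longrightarrow> P' 0 2 3 0 1)"
        using start_cases[of 0] start_cases'[of 0] assms(2,3) by (auto simp: doubleton_eq_iff)
      then show ?thesis using zero_join[OF start_12 R.start_2, of cu cv] k even by auto
    qed
  next
    case odd: False
    then have k: "3 \<le> k" using False assms(1) by presburger
    show ?thesis
    proof (cases "(cu = 2 \<longrightarrow> P 0 2 3 0 1) \<and> (cv = 2 \<longrightarrow> P' 0 2 3 0 1)")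
      case True
      then show ?thesis using zero_join[OF start_2 R.start_2, of cu cv] k odd by auto
    next
      case F: False
      then have H: "cu \<noteq> 1" "cu = 2 \<longrightarrow> P 0 2 1 0 0" "cv \<noteq> 1" "cv = 2 \<longrightarrow> P' 0 2 1 0 0"
        using start_cases[of 0] start_cases'[of 0] assms(2,3) by (auto simp: doubleton_eq_iff)
      show ?thesis
      proof (cases "k = 3")
        case True
        then show ?thesis using sol_3 H by blast
      next
        case False
        then have "5 \<le> k" using k odd by presburger
        then show ?thesis using zero_join[OF start_12 R.start_12, of cu cv] H odd by auto
      qed
    qed
  qed
qed

text \<open>The type of the start at the end 2 is dictated by the piece on the last edge, so the
  other end must compensate the parity. A long ear does this with \<open>start_2\<close> or
  \<open>start_21\<close>; a short one may have to send an arc into that end, hence the alternative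
  with 3.\<close>

lemma sol_open_12:
  assumes "2 \<le> k"
  shows "sol k P Q P' Q' 1 2 0 0 \<or> sol k P Q P' Q' 3 2 1 0"
proof -
  have "k = 2 \<or> k = 3 \<or> even k \<and> 4 \<le> k \<or> odd k \<and> 5 \<le> k"
    using assms by presburger
  then consider "k = 2" | "k = 3" | "even k" "4 \<le> k" | "odd k" "5 \<le> k"
    by blast
  then show ?thesis
  proof cases
    case 1
    then show ?thesis
      using zero_join[OF start_0 R.start_2, of 3 2] sol_2[of 2 1] start_cases'[of 0] by auto
  next
    case 2
    then show ?thesis
      using zero_join[OF start_0 R.start_12, of 3 2] zero_join[OF start_1 R.start_2, of 3 2]
        start_cases'[of 0] by auto
  next
    case 3
    then show ?thesis
      using zero_join[OF start_2 R.start_12, of 1 2] zero_join[OF start_21 R.start_2, of 2]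
        start_cases'[of 0] by auto
  next
    case 4
    then show ?thesis
      using zero_join[OF start_2 R.start_2, of 1 2] zero_join[OF start_21 R.start_12, of 2]
        start_cases'[of 0] by auto
  qed
qed

end

text \<open>The numerical half of the induction step for open ears: an ear with admissible pieces is
  again an admissible piece.\<close>

lemma edge_ok_sol:
  assumes "mirrored P Q k P' Q'" "2 \<le> k"
  shows "edge_ok (sol k P Q P' Q')"
proof -
  interpret mirrored P Q k P' Q' by fact
  interpret M: mirrored P' Q' k P Q by (rule mirrored_sym) fact
  have A: "\<forall>c c'. c \<noteq> c' \<and> {c, c'} \<noteq> {1, 2} \<longrightarrow> sol k P Q P' Q' c c' 0 0"
    using sol_open_0 assms(2) by blast
  have B: "sol k P Q P' Q' 3 1 1 0 \<and> sol k P Q P' Q' 1 3 0 1"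
    using sol_31[of 1] sol_sym[OF mir M.sol_31] assms(2) by simp
  have C: "sol k P Q P' Q' 2 1 0 0 \<or> sol k P Q P' Q' 2 3 0 1"
    using M.sol_open_12[OF assms(2)]
      sol_sym[OF mir, where cu=2 and cv=1 and \<alpha>=0 and \<beta>=0]
      sol_sym[OF mir, where cu=2 and cv=3 and \<alpha>=0 and \<beta>=1] by argo
  show ?thesis
    unfolding edge_ok_def by (intro conjI A disjI2[OF B] C sol_open_12[OF assms(2)])
qed

section \<open>Partial orientations\<close>

definition touch :: "('a \<times> 'a) set \<Rightarrow> 'a set \<Rightarrow> ('a \<times> 'a) set" where
  "touch E C = {(x, y) \<in> E. x \<in> C \<or> y \<in> C}"

definition orients :: "('a \<times> 'a) set \<Rightarrow> ('a \<times> 'a) set \<Rightarrow> bool" where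
  "orients A F \<longleftrightarrow> A \<subseteq> F \<and> (\<forall>(x, y) \<in> F. ((x, y) \<in> A) \<noteq> ((y, x) \<in> A))"

definition indeg :: "('a \<times> 'a) set \<Rightarrow> 'a \<Rightarrow> nat" where
  "indeg A x = card {y. (y, x) \<in> A}"

text \<open>
  A partial solution on the edge set \<open>F\<close>: the in-degrees of the vertices in \<open>C\<close> are completely
  determined by \<open>F\<close>, those outside have prescribed final values \<open>c\<close>, to which \<open>F\<close> contributes \<open>d\<close>.
\<close>

definition feasible ::
  "('a \<times> 'a) set \<Rightarrow> 'a set \<Rightarrow> ('a \<Rightarrow> nat) \<Rightarrow> ('a \<Rightarrow> nat) \<Rightarrow> bool" where
  "feasible F C c d \<longleftrightarrow> (\<exists>A f. orients A F \<and> (\<forall>x. x \<notin> C \<longrightarrow> indeg A x = d x \<and> f x = c x) \<and>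
     (\<forall>x\<in>C. indeg A x \<le> 4 \<and> f x = indeg A x) \<and> (\<forall>(x, y)\<in>F. f x \<noteq> f y))"

lemma feasible_empty: "feasible {} {} c (\<lambda>_. 0)"
  unfolding feasible_def by (intro exI[of _ "{}"] exI[of _ c]) (auto simp: orients_def indeg_def)

text \<open>Inside \<open>C\<close> the functions \<open>c\<close> and \<open>d\<close> are ignored.
  Hence the colour of an ear vertex can be forgotten once the vertex has been absorbed.\<close>

lemma feasible_cong:
  assumes "feasible F C c d" "\<And>x. x \<notin> C \<Longrightarrow> d x = d' x"
    and "\<And>x. x \<in> Field F \<Longrightarrow> x \<notin> C \<Longrightarrow> c x = c' x"
  shows "feasible F C c' d'"
proof -
  obtain A f where *: "orients A F" "\<forall>x. x \<notin> C \<longrightarrow> indeg A x = d x \<and> f x = c x"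
     "\<forall>x\<in>C. indeg A x \<le> 4 \<and> f x = indeg A x" "\<forall>(x, y)\<in>F. f x \<noteq> f y"
    using assms(1) unfolding feasible_def by blast
  define g where "g x = (if x \<in> C then f x else c' x)" for x
  have "g x = f x" if "x \<in> Field F" for x
    using that assms(3) *(2) unfolding g_def by auto
  then have "\<forall>(x, y)\<in>F. g x \<noteq> g y" using *(4)
    by (auto simp: FieldI1 FieldI2)
  then show ?thesis unfolding feasible_def
    using * assms(2) by (intro exI[of _ A] exI[of _ g]) (auto simp: g_def)
qed

lemma indeg_Un:
  assumes "finite A" "finite B" "A \<inter> B = {}"
  shows "indeg (A \<union> B) x = indeg A x + indeg B x"
proof -
  have fin: "finite {y. (y, x) \<in> A}" if "finite A" for A :: "('a \<times> 'a) set"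
  proof (rule finite_subset)
    show "{y. (y, x) \<in> A} \<subseteq> fst ` A" by force
  qed (use that in simp)
  have "{y. (y, x) \<in> A \<union> B} = {y. (y, x) \<in> A} \<union> {y. (y, x) \<in> B}" by auto
  then show ?thesis unfolding indeg_def using assms fin by (subst card_Un_disjoint[symmetric]) auto
qed

lemma indeg_not_Field: "x \<notin> Field A \<Longrightarrow> indeg A x = 0"
  unfolding indeg_def by (metis (mono_tags, lifting) Collect_empty_eq FieldI2 card.empty)

text \<open>No part may touch a vertex whose in-degree the other has settled. On shared vertices
  outside \<open>C1\<close> and \<open>C2\<close> the contributions add, and the two colourings
  agree there because both follow \<open>c\<close>.\<close>

lemma feasible_Un:
  assumes "feasible F1 C1 c d1" "feasible F2 C2 c d2" "finite F1" "finite F2" "sym F1" "sym F2"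
    "F1 \<inter> F2 = {}" "C1 \<inter> C2 = {}" "Field F1 \<inter> C2 = {}" "Field F2 \<inter> C1 = {}"
  shows "feasible (F1 \<union> F2) (C1 \<union> C2) c (\<lambda>x. d1 x + d2 x)"
proof -
  obtain A f where A: "orients A F1" "\<forall>x. x \<notin> C1 \<longrightarrow> indeg A x = d1 x \<and> f x = c x"
     "\<forall>x\<in>C1. indeg A x \<le> 4 \<and> f x = indeg A x" "\<forall>(x, y)\<in>F1. f x \<noteq> f y"
    using assms(1) unfolding feasible_def by blast
  obtain B g where B: "orients B F2" "\<forall>x. x \<notin> C2 \<longrightarrow> indeg B x = d2 x \<and> g x = c x"
     "\<forall>x\<in>C2. indeg B x \<le> 4 \<and> g x = indeg B x" "\<forall>(x, y)\<in>F2. g x \<noteq> g y"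
    using assms(2) unfolding feasible_def by blast
  have sub: "A \<subseteq> F1" "B \<subseteq> F2" using A B unfolding orients_def by auto
  have ind: "indeg (A \<union> B) x = indeg A x + indeg B x" for x
    using sub assms by (intro indeg_Un) (auto intro: finite_subset)
  have z1: "indeg B x = 0" if "x \<in> C1" for x
    using that assms(10) sub mono_Field[of B F2] by (intro indeg_not_Field) auto
  have z2: "indeg A x = 0" if "x \<in> C2" for x
    using that assms(9) sub mono_Field[of A F1] by (intro indeg_not_Field) auto
  define h where "h x = (if x \<in> C1 then f x else if x \<in> C2 then g x else c x)" for x
  have hf: "h x = f x" if "x \<in> Field F1" for x using that assms(9) A(2) unfolding h_def by auto
  have hg: "h x = g x" if "x \<in> Field F2" for x using that assms(10) B(2) unfolding h_def by auto
  have "\<forall>(x, y)\<in>F1 \<union> F2. h x \<noteq> h y"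
    using A(4) B(4) hf hg by (auto simp: FieldI1 FieldI2)
  moreover have "orients (A \<union> B) (F1 \<union> F2)"
    using A(1) B(1) assms(5,6,7) unfolding orients_def sym_def by blast
  ultimately show ?thesis
    unfolding feasible_def using A B ind z1 z2 assms(8)
    by (intro exI[of _ "A \<union> B"] exI[of _ h]) (auto simp: h_def)
qed

text \<open>The step in which a prescribed in-degree is checked against the arcs that actually
  arrive.\<close>

lemma feasible_absorb:
  assumes "feasible F C c d" "x \<notin> C" "c x = d x" "d x \<le> 4"
  shows "feasible F (insert x C) c d"
proof -
  obtain A f where A: "orients A F" "\<forall>x. x \<notin> C \<longrightarrow> indeg A x = d x \<and> f x = c x"
     "\<forall>x\<in>C. indeg A x \<le> 4 \<and> f x = indeg A x" "\<forall>(x, y)\<in>F. f x \<noteq> f y"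
    using assms(1) unfolding feasible_def by blast
  then show ?thesis unfolding feasible_def
    using assms by (intro exI[of _ A] exI[of _ f]) auto
qed

lemma feasible_edge:
  assumes "u \<noteq> v" "c u \<noteq> c v" "s + t = 1"
  shows "feasible {(u, v), (v, u)} {} c (\<lambda>x. (if x = u then s else 0) + (if x = v then t else 0))"
proof -
  have e: "feasible {(u, v), (v, u)} {} c (\<lambda>x. if x = v then 1 else 0)" if "u \<noteq> v" "c u \<noteq> c v" for u v
  proof -
    have "{y. y = u \<and> x = v} = (if x = v then {u} else {})" for x by auto
    then show ?thesis
      unfolding feasible_def using that
      by (intro exI[of _ "{(u, v)}"] exI[of _ c]) (auto simp: orients_def indeg_def)
  qed
  consider "s = 0" "t = 1" | "s = 1" "t = 0" using assms(3) by linarith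
  then show ?thesis
  proof cases
    case 1
    then have "(\<lambda>x. (if x = u then s else 0) + (if x = v then t else 0)) = (\<lambda>x. if x = v then 1 else 0)"
      by auto
    then show ?thesis using e[of u v] assms by simp
  next
    case 2
    then have "(\<lambda>x. (if x = u then s else 0) + (if x = v then t else 0)) = (\<lambda>x. if x = u then 1 else 0)"
      by auto
    then show ?thesis using e[of v u] assms by (simp add: insert_commute)
  qed
qed

section \<open>Assembling the gadgets of an ear into one orientation\<close>

text \<open>Gadget \<open>2 * i\<close> joins \<open>y i\<close> to \<open>y (i + 1)\<close>, gadget \<open>2 * i - 1\<close> hangs at \<open>y i\<close>; both
  indices of a gadget's attachments are then given by one formula.\<close>

definition chain ::
  "nat \<Rightarrow> (nat \<Rightarrow> 'a) \<Rightarrow> (nat \<Rightarrow> ('a \<times> 'a) set) \<Rightarrow> (nat \<Rightarrow> 'a set) \<Rightarrow> bool" where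
  "chain k y F C \<longleftrightarrow> inj_on y {1..k} \<and> y 0 \<notin> y ` {1..k} \<and> y (Suc k) \<notin> y ` {1..k} \<and>
     (\<forall>n\<le>2*k. Field (F n) \<subseteq> C n \<union> {y ((n + 1) div 2), y ((n + 2) div 2)}) \<and>
     (\<forall>n\<le>2*k. \<forall>m\<le>2*k. n \<noteq> m \<longrightarrow> F n \<inter> F m = {} \<and> C n \<inter> C m = {}) \<and>
     (\<forall>n\<le>2*k. \<forall>i\<le>Suc k. y i \<notin> C n) \<and> (\<forall>n\<le>2*k. finite (F n) \<and> sym (F n))"

text \<open>The two ends are added, so that for \<open>u = v\<close>, as with a closed ear or a
  vertex gadget, all \<open>s + t\<close> arcs enter one vertex.\<close>

definition contr :: "'a \<Rightarrow> nat \<Rightarrow> 'a \<Rightarrow> nat \<Rightarrow> 'a \<Rightarrow> nat" where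
  "contr u s v t x = (if x = u then s else 0) + (if x = v then t else 0)"

text \<open>\<open>P\<close> counts only the arcs of the hanging piece, whereas
  \<open>F (2*i)\<close> also contains the ear edge, whose direction is recorded by
  \<open>s + t = 1\<close>.\<close>

definition edge_fits where
  "edge_fits k y F C P \<longleftrightarrow> (\<forall>i\<le>k. \<forall>c c' a b s t col. P i c c' a b \<longrightarrow> c \<noteq> c' \<longrightarrow> s + t = 1 \<longrightarrow>
     col (y i) = c \<longrightarrow> col (y (Suc i)) = c' \<longrightarrow>
     feasible (F (2*i)) (C (2*i)) col (contr (y i) (s + a) (y (Suc i)) (t + b)))"

definition vert_fits where
  "vert_fits k y F C Q \<longleftrightarrow> (\<forall>i\<in>{1..k}. \<forall>c q col. Q i c q \<longrightarrow> col (y i) = c \<longrightarrow>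
     feasible (F (2*i - 1)) (C (2*i - 1)) col (contr (y i) q (y i) 0))"

lemma chain_Field: "chain k y F C \<Longrightarrow> n \<le> 2*k \<Longrightarrow>
    Field (F n) \<subseteq> C n \<union> {y ((n + 1) div 2), y ((n + 2) div 2)}"
  unfolding chain_def by blast

lemma chain_F: "chain k y F C \<Longrightarrow> n \<le> 2*k \<Longrightarrow> m \<le> 2*k \<Longrightarrow> n \<noteq> m \<Longrightarrow> F n \<inter> F m = {}"
  unfolding chain_def by blast

lemma chain_C: "chain k y F C \<Longrightarrow> n \<le> 2*k \<Longrightarrow> m \<le> 2*k \<Longrightarrow> n \<noteq> m \<Longrightarrow> C n \<inter> C m = {}"
  unfolding chain_def by blast

lemma chain_y: "chain k y F C \<Longrightarrow> n \<le> 2*k \<Longrightarrow> i \<le> Suc k \<Longrightarrow> y i \<notin> C n"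
  unfolding chain_def by blast

lemma chain_FC:
  assumes "chain k y F C" "n \<le> 2*k" "m \<le> 2*k" "n \<noteq> m"
  shows "Field (F n) \<inter> C m = {}"
proof -
  have "(n + 1) div 2 \<le> Suc k" "(n + 2) div 2 \<le> Suc k" using assms(2) by auto
  then have "y ((n + 1) div 2) \<notin> C m" "y ((n + 2) div 2) \<notin> C m"
    using chain_y[OF assms(1,3)] by blast+
  then show ?thesis
    using chain_Field[OF assms(1,2)] chain_C[OF assms] by auto
qed

lemma chain_y_eq:
  assumes "chain k y F C" "i \<in> {1..k}" "j \<le> Suc k" "y i = y j"
  shows "i = j"
proof -
  have inj: "inj_on y {1..k}" and "y 0 \<notin> y ` {1..k}" "y (Suc k) \<notin> y ` {1..k}"
    using assms(1) unfolding chain_def by argo+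
  then have "y i \<noteq> y 0" "y i \<noteq> y (Suc k)" using assms(2) by (metis imageI)+
  then have "j \<noteq> 0" "j \<noteq> Suc k" using assms(4) by metis+
  then have "j \<in> {1..k}" using assms(3) by auto
  then show ?thesis using inj_onD[OF inj assms(4,2)] by simp
qed

lemma chain_fin: "chain k y F C \<Longrightarrow> n \<le> 2*k \<Longrightarrow> finite (F n) \<and> sym (F n)"
  unfolding chain_def by blast

lemma chain_Field_y:
  assumes ch: "chain k y F C" and n: "n \<le> 2*k" and i: "i \<in> {1..k}"
    "i \<noteq> (n + 1) div 2" "i \<noteq> (n + 2) div 2"
  shows "y i \<notin> Field (F n)"
proof
  assume "y i \<in> Field (F n)"
  moreover have "i \<le> Suc k" using i(1) by simp
  ultimately have "y i = y ((n + 1) div 2) \<or> y i = y ((n + 2) div 2)"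
    using chain_Field[OF ch n] chain_y[OF ch n, of i] by auto
  moreover have "(n + 1) div 2 \<le> Suc k" "(n + 2) div 2 \<le> Suc k" using n by auto
  ultimately show False using chain_y_eq[OF ch i(1)] i(2,3) by blast
qed

definition GF :: "(nat \<Rightarrow> ('a \<times> 'a) set) \<Rightarrow> nat set \<Rightarrow> ('a \<times> 'a) set" where
  "GF F N = (\<Union>n\<in>N. F n)"

text \<open>\<open>N\<close> holds the gadgets assembled so far and \<open>I\<close> the indices of
  the ear vertices already absorbed.\<close>

definition GC :: "(nat \<Rightarrow> 'a) \<Rightarrow> (nat \<Rightarrow> 'a set) \<Rightarrow> nat set \<Rightarrow> nat set \<Rightarrow> 'a set" where
  "GC y C N I = (\<Union>n\<in>N. C n) \<union> y ` I"

lemma chain_Field_GC: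
  assumes ch: "chain k y F C" and N: "N \<subseteq> {..2*k}" "M \<subseteq> {..2*k}" "N \<inter> M = {}"
    and I: "I \<subseteq> {1..k}" "\<And>i n. i \<in> I \<Longrightarrow> n \<in> N \<Longrightarrow> i \<noteq> (n + 1) div 2 \<and> i \<noteq> (n + 2) div 2"
  shows "Field (GF F N) \<inter> GC y C M I = {}"
proof -
  have "x \<notin> C m" if "n \<in> N" "m \<in> M" "x \<in> Field (F n)" for n m x
    using chain_FC[OF ch, of n m] that N by blast
  moreover have "y i \<notin> Field (F n)" if "n \<in> N" "i \<in> I" for i n
    by (rule chain_Field_y[OF ch]) (use that N I in auto)
  moreover have "Field (GF F N) = (\<Union>n\<in>N. Field (F n))" unfolding Field_def GF_def by auto
  ultimately show ?thesis unfolding GC_def by blast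
qed

lemma chain_GC_disj:
  assumes ch: "chain k y F C" and N: "N \<subseteq> {..2*k}" "M \<subseteq> {..2*k}" "N \<inter> M = {}"
    and I: "I \<subseteq> {1..k}" "J \<subseteq> {1..k}" "I \<inter> J = {}"
  shows "GC y C N I \<inter> GC y C M J = {}"
proof -
  have "x \<notin> C m" if "n \<in> N" "m \<in> M" "x \<in> C n" for n m x
    using chain_C[OF ch, of n m] that N by blast
  moreover have "y i \<notin> C n" if "n \<in> N \<or> n \<in> M" "i \<in> I \<or> i \<in> J" for i n
    by (rule chain_y[OF ch]) (use that N I in auto)
  moreover have "y i \<noteq> y j" if "i \<in> I" "j \<in> J" for i j
  proof
    assume "y i = y j"
    moreover have "i \<in> {1..k}" "j \<le> Suc k" using that I(1,2) by auto
    ultimately have "i = j" by (intro chain_y_eq[OF ch])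
    then show False using that I(3) by blast
  qed
  ultimately show ?thesis unfolding GC_def by blast
qed

text \<open>The conditions \<open>IN\<close> forbid attaching a gadget to an ear vertex that the
  other side has absorbed.\<close>

lemma feasible_chain_Un:
  assumes ch: "chain k y F C"
    and f: "feasible (GF F N) (GC y C N I) col d1" "feasible (GF F M) (GC y C M J) col d2"
    and N: "N \<subseteq> {..2*k}" "M \<subseteq> {..2*k}" "N \<inter> M = {}"
    and I: "I \<subseteq> {1..k}" "J \<subseteq> {1..k}" "I \<inter> J = {}"
    and IN: "\<And>i n. i \<in> I \<Longrightarrow> n \<in> M \<Longrightarrow> i \<noteq> (n + 1) div 2 \<and> i \<noteq> (n + 2) div 2"
      "\<And>i n. i \<in> J \<Longrightarrow> n \<in> N \<Longrightarrow> i \<noteq> (n + 1) div 2 \<and> i \<noteq> (n + 2) div 2"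
  shows "feasible (GF F (N \<union> M)) (GC y C (N \<union> M) (I \<union> J)) col (\<lambda>x. d1 x + d2 x)"
proof -
  have fin: "finite (F n)" "sym (F n)" if "n \<in> N \<or> n \<in> M" for n
    using chain_fin[OF ch, of n] that N by blast+
  have "feasible (GF F N \<union> GF F M) (GC y C N I \<union> GC y C M J) col (\<lambda>x. d1 x + d2 x)"
  proof (rule feasible_Un[OF f])
    have "finite N" "finite M" using N finite_subset by blast+
    then show "finite (GF F N)" "finite (GF F M)" unfolding GF_def using fin by blast+
    show "sym (GF F N)" "sym (GF F M)" unfolding GF_def using fin unfolding sym_def by blast+
    have "F n \<inter> F m = {}" if "n \<in> N" "m \<in> M" for n m
      by (rule chain_F[OF ch]) (use that N in auto)
    then show "GF F N \<inter> GF F M = {}" unfolding GF_def by blast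
    show "GC y C N I \<inter> GC y C M J = {}" by (rule chain_GC_disj[OF ch N I])
    show "Field (GF F N) \<inter> GC y C M J = {}"
      by (rule chain_Field_GC[OF ch N I(2) IN(2)])
    show "Field (GF F M) \<inter> GC y C N I = {}"
      using chain_Field_GC[OF ch N(2,1) _ I(1) IN(1)] N(3) by blast
  qed
  moreover have "GF F N \<union> GF F M = GF F (N \<union> M)"
    "GC y C N I \<union> GC y C M J = GC y C (N \<union> M) (I \<union> J)"
    unfolding GF_def GC_def by auto
  ultimately show ?thesis by simp
qed

lemma feasible_chain_single: "feasible (F m) (C m) col d \<Longrightarrow> feasible (GF F {m}) (GC y C {m} {}) col d"
  unfolding GF_def GC_def by simp

lemma feasible_chain_absorb:
  assumes ch: "chain k y F C" and f: "feasible (GF F N) (GC y C N I) col d"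
    and N: "N \<subseteq> {..2*k}" and I: "I \<subseteq> {1..k}" and i: "i \<in> {1..k}" "i \<notin> I"
    and d: "col (y i) = d (y i)" "d (y i) \<le> 4"
  shows "feasible (GF F N) (GC y C N (insert i I)) col d"
proof -
  have "y i \<notin> C n" if "n \<in> N" for n by (rule chain_y[OF ch]) (use that N i in auto)
  moreover have "y i \<notin> y ` I"
  proof
    assume "y i \<in> y ` I"
    then obtain j where "j \<in> I" "y i = y j" by blast
    then show False using chain_y_eq[OF ch i(1), of j] I i(2) by auto
  qed
  ultimately have "y i \<notin> GC y C N I" unfolding GC_def by blast
  from feasible_absorb[OF f this d] show ?thesis unfolding GC_def by simp
qed

text \<open>On arrival at \<open>y i\<close> the gadgets 0 to \<open>2*i - 2\<close> are in place:
  the one on the edge ending at \<open>y i\<close> is included, the one hanging at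
  \<open>y i\<close> is not, and \<open>y i\<close> still awaits absorption.\<close>

lemma reach_feas:
  assumes ch: "chain k y F C" and E: "edge_fits k y F C P" and V: "vert_fits k y F C Q"
    and r: "reach P Q cu \<alpha> i c s"
  shows "1 \<le> i \<and> (i \<le> k \<longrightarrow> col (y 0) = cu \<longrightarrow> col (y i) = c \<longrightarrow>
    feasible (GF F {..<2*i-1}) (GC y C {..<2*i-1} {1..<i}) col (contr (y 0) \<alpha> (y i) s))"
  using r
proof (induction arbitrary: col)
  case (first c b t)
  show ?case
  proof (intro conjI impI)
    assume "Suc 0 \<le> k" "col (y 0) = cu" "col (y (Suc 0)) = c"
    then have "feasible (F (2*0)) (C (2*0)) col (contr (y 0) (\<alpha> + 0) (y (Suc 0)) (t + b))"
      using E first unfolding edge_fits_def by blast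
    then show "feasible (GF F {..<2 * Suc 0 - 1}) (GC y C {..<2 * Suc 0 - 1} {1..<Suc 0}) col
        (contr (y 0) \<alpha> (y (Suc 0)) (t + b))"
      by (simp add: GF_def GC_def lessThan_Suc)
  qed simp
next
  case (step i c s q c' a b t)
  show ?case
  proof (intro conjI impI)
    assume i: "Suc i \<le> k" and col: "col (y 0) = cu" "col (y (Suc i)) = c'"
    have i1: "1 \<le> i" "i \<in> {1..k}" "i \<le> k" using step.IH i by auto
    have ne: "y i \<noteq> y 0" "y i \<noteq> y (Suc i)" "y (Suc i) \<noteq> y 0"
      using chain_y_eq[OF ch i1(2), of 0] chain_y_eq[OF ch i1(2), of "Suc i"]
        chain_y_eq[OF ch, of "Suc i" 0] i i1 by auto
    \<comment> \<open>The given \<open>col\<close> is arbitrary at the vertex to be absorbed. It is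
      overwritten by the value chosen in \<open>reach\<close>, which the generalisation over
      \<open>col\<close> permits, and restored afterwards by \<open>feasible_cong\<close>.\<close>
    define col' where "col' = col(y i := c)"
    have c': "col' (y 0) = cu" "col' (y i) = c" "col' (y (Suc i)) = c'"
      unfolding col'_def using ne col by auto
    have 1: "feasible (GF F {..<2*i-1}) (GC y C {..<2*i-1} {1..<i}) col' (contr (y 0) \<alpha> (y i) s)"
      using step.IH c' i1 by blast
    have 2: "feasible (GF F {2*i-1}) (GC y C {2*i-1} {}) col' (contr (y i) q (y i) 0)"
      by (rule feasible_chain_single) (use V step.hyps c' i1 in \<open>unfold vert_fits_def, blast\<close>)
    have t: "(1 - t) + t = 1" using step.hyps by simp
    have 3: "feasible (GF F {2*i}) (GC y C {2*i} {}) col' (contr (y i) ((1 - t) + a) (y (Suc i)) (t + b))"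
      by (rule feasible_chain_single) (use E step.hyps c' i1 t in \<open>unfold edge_fits_def, blast\<close>)
    have "feasible (GF F ({..<2*i-1} \<union> {2*i-1})) (GC y C ({..<2*i-1} \<union> {2*i-1}) ({1..<i} \<union> {})) col'
       (\<lambda>x. contr (y 0) \<alpha> (y i) s x + contr (y i) q (y i) 0 x)"
      by (rule feasible_chain_Un[OF ch 1 2]) (use i1 in auto)
    then have "feasible (GF F ({..<2*i-1} \<union> {2*i-1} \<union> {2*i}))
       (GC y C ({..<2*i-1} \<union> {2*i-1} \<union> {2*i}) (({1..<i} \<union> {}) \<union> {})) col'
       (\<lambda>x. contr (y 0) \<alpha> (y i) s x + contr (y i) q (y i) 0 x
          + contr (y i) ((1 - t) + a) (y (Suc i)) (t + b) x)"
      by (rule feasible_chain_Un[OF ch _ 3]) (use i1 in auto)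
    moreover have "{..<2*i-1} \<union> {2*i-1} \<union> {2*i} = {..<2 * Suc i - 1}" using i1 by auto
    ultimately have 4: "feasible (GF F {..<2 * Suc i - 1}) (GC y C {..<2 * Suc i - 1} {1..<i}) col'
       (\<lambda>x. contr (y 0) \<alpha> (y i) s x + contr (y i) q (y i) 0 x
          + contr (y i) ((1 - t) + a) (y (Suc i)) (t + b) x)" (is "feasible _ _ _ ?d") by simp
    have d: "?d (y i) = c" using ne step.hyps unfolding contr_def by simp
    have "feasible (GF F {..<2 * Suc i - 1}) (GC y C {..<2 * Suc i - 1} (insert i {1..<i})) col' ?d"
    proof (rule feasible_chain_absorb[OF ch 4])
      show "col' (y i) = ?d (y i)" "?d (y i) \<le> 4" unfolding d using step.hyps c' by auto
    qed (use i i1 in auto)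
    then have 5: "feasible (GF F {..<2 * Suc i - 1}) (GC y C {..<2 * Suc i - 1} {1..<Suc i}) col' ?d"
      using i1 by (simp add: atLeastLessThanSuc)
    have yi: "y i \<in> GC y C {..<2 * Suc i - 1} {1..<Suc i}" unfolding GC_def using i1 by auto
    show "feasible (GF F {..<2 * Suc i - 1}) (GC y C {..<2 * Suc i - 1} {1..<Suc i}) col
        (contr (y 0) \<alpha> (y (Suc i)) (t + b))"
    proof (rule feasible_cong[OF 5])
      fix x assume "x \<notin> GC y C {..<2 * Suc i - 1} {1..<Suc i}"
      then have "x \<noteq> y i" using yi by blast
      then show "?d x = contr (y 0) \<alpha> (y (Suc i)) (t + b) x" "col' x = col x"
        unfolding contr_def col'_def by auto
    qed
  qed simp
qed

lemma chain_rev: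
  assumes ch: "chain k y F C"
  shows "chain k (\<lambda>l. y (Suc k - l)) (\<lambda>n. F (2*k - n)) (\<lambda>n. C (2*k - n))"
proof -
  have im: "(\<lambda>l. y (Suc k - l)) ` {1..k} = y ` {1..k}"
  proof -
    have "x \<in> (\<lambda>l. Suc k - l) ` {1..k}" if "x \<in> {1..k}" for x
      by (rule image_eqI[of _ _ "Suc k - x"]) (use that in auto)
    then have "(\<lambda>l. Suc k - l) ` {1..k} = {1..k}" by auto
    then show ?thesis by (metis image_image)
  qed
  have inj: "inj_on y {1..k}" and y0: "y 0 \<notin> y ` {1..k}" "y (Suc k) \<notin> y ` {1..k}"
    using ch unfolding chain_def by argo+
  have "inj_on (\<lambda>l. y (Suc k - l)) {1..k}"
  proof (rule inj_onI)
    fix l m assume "l \<in> {1..k}" "m \<in> {1..k}" "y (Suc k - l) = y (Suc k - m)"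
    then have "Suc k - l = Suc k - m" by (intro inj_onD[OF inj]) auto
    then show "l = m" using \<open>l \<in> {1..k}\<close> \<open>m \<in> {1..k}\<close> by auto
  qed
  moreover have "Field (F (2*k - n)) \<subseteq> C (2*k - n) \<union>
      {y (Suc k - (n + 1) div 2), y (Suc k - (n + 2) div 2)}" if "n \<le> 2*k" for n
  proof -
    have "(2*k - n + 1) div 2 = Suc k - (n + 2) div 2" "(2*k - n + 2) div 2 = Suc k - (n + 1) div 2"
      using that by presburger+
    then show ?thesis using chain_Field[OF ch, of "2*k - n"] by auto
  qed
  moreover have "F (2*k - n) \<inter> F (2*k - m) = {} \<and> C (2*k - n) \<inter> C (2*k - m) = {}"
    if "n \<le> 2*k" "m \<le> 2*k" "n \<noteq> m" for n m
    using chain_F[OF ch, of "2*k - n" "2*k - m"] chain_C[OF ch, of "2*k - n" "2*k - m"] that by auto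
  moreover have "y (Suc k - i) \<notin> C (2*k - n)" for i n
    by (rule chain_y[OF ch]) auto
  moreover have "finite (F (2*k - n)) \<and> sym (F (2*k - n))" for n
    by (rule chain_fin[OF ch]) auto
  ultimately show ?thesis using y0 unfolding chain_def im by simp
qed

lemma contr_commute: "contr u s v t = contr v t u s"
  unfolding contr_def by auto

lemma edge_fits_rev:
  assumes E: "edge_fits k y F C P" and m: "mirror k P Q P' Q'"
  shows "edge_fits k (\<lambda>l. y (Suc k - l)) (\<lambda>n. F (2*k - n)) (\<lambda>n. C (2*k - n)) P'"
  unfolding edge_fits_def
proof (intro allI impI)
  fix i c c' a b s t col
  assume i: "i \<le> k" and *: "P' i c c' a b" "c \<noteq> c'" "s + t = (1::nat)" "col (y (Suc k - i)) = c"
    "col (y (Suc k - Suc i)) = c'"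
  have "P (k - i) c' c b a" using m i *(1) unfolding mirror_def by blast
  moreover have "k - i \<le> k" "t + s = 1" "c' \<noteq> c" "col (y (k - i)) = c'" "col (y (Suc (k - i))) = c"
    using * i by (auto simp: Suc_diff_le)
  ultimately have "feasible (F (2*(k-i))) (C (2*(k-i))) col
      (contr (y (k-i)) (t + b) (y (Suc (k-i))) (s + a))"
    using E unfolding edge_fits_def by blast
  moreover have "2*(k-i) = 2*k - 2*i" "Suc (k - i) = Suc k - i" using i by auto
  ultimately show "feasible (F (2*k - 2*i)) (C (2*k - 2*i)) col
      (contr (y (Suc k - i)) (s + a) (y (Suc k - Suc i)) (t + b))"
    by (subst contr_commute) simp
qed

lemma vert_fits_rev:
  assumes V: "vert_fits k y F C Q" and m: "mirror k P Q P' Q'"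
  shows "vert_fits k (\<lambda>l. y (Suc k - l)) (\<lambda>n. F (2*k - n)) (\<lambda>n. C (2*k - n)) Q'"
  unfolding vert_fits_def
proof (intro allI impI ballI)
  fix i c q col
  assume i: "i \<in> {1..k}" and *: "Q' i c q" "col (y (Suc k - i)) = c"
  have "Q (Suc k - i) c q" using m i *(1) unfolding mirror_def by auto
  moreover have "Suc k - i \<in> {1..k}" using i by auto
  ultimately have "feasible (F (2*(Suc k-i) - 1)) (C (2*(Suc k-i) - 1)) col
      (contr (y (Suc k-i)) q (y (Suc k-i)) 0)"
    using V *(2) unfolding vert_fits_def by blast
  moreover have "2*(Suc k-i) - 1 = 2*k - (2*i - 1)" using i by auto
  ultimately show "feasible (F (2*k - (2*i - 1))) (C (2*k - (2*i - 1))) col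
      (contr (y (Suc k-i)) q (y (Suc k-i)) 0)" by simp
qed

text \<open>One reading assembles the gadgets below \<open>2*i - 1\<close>, the other those from
  \<open>2*i\<close> on; the vertex gadget between them and the vertex \<open>y i\<close> itself
  come last.\<close>

theorem sol_feas:
  assumes ch: "chain k y F C" and E: "edge_fits k y F C P" and V: "vert_fits k y F C Q"
    and m: "mirror k P Q P' Q'" and sol: "sol k P Q P' Q' cu cv \<alpha> \<beta>"
    and col: "col (y 0) = cu" "col (y (Suc k)) = cv"
  shows "feasible (\<Union>n\<le>2*k. F n) ((\<Union>n\<le>2*k. C n) \<union> y ` {1..k}) col (contr (y 0) \<alpha> (y (Suc k)) \<beta>)"
proof -
  obtain i j c s q s' where *: "i + j = Suc k" "1 \<le> i" "1 \<le> j" "reach P Q cu \<alpha> i c s"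
    "reach P' Q' cv \<beta> j c s'" "Q i c q" "c = s + q + s'" "c \<le> 4"
    using sol unfolding sol_def by blast
  have i: "i \<in> {1..k}" "i \<le> k" "j \<le> k" "Suc k - j = i" using * by auto
  have ne: "y i \<noteq> y 0" "y i \<noteq> y (Suc k)"
    using chain_y_eq[OF ch i(1), of 0] chain_y_eq[OF ch i(1), of "Suc k"] i by auto
  define col' where "col' = col(y i := c)"
  have c': "col' (y 0) = cu" "col' (y i) = c" "col' (y (Suc k)) = cv"
    unfolding col'_def using ne col by auto
  have 1: "feasible (GF F {..<2*i-1}) (GC y C {..<2*i-1} {1..<i}) col' (contr (y 0) \<alpha> (y i) s)"
    using reach_feas[OF ch E V *(4)] c' i by blast
  have 2: "feasible (GF F {2*i-1}) (GC y C {2*i-1} {}) col' (contr (y i) q (y i) 0)"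
    by (rule feasible_chain_single) (use V *(6) c' i in \<open>unfold vert_fits_def, blast\<close>)
  have "n \<in> (\<lambda>n. 2*k - n) ` {..<2*j-1}" if "n \<in> {2*i..2*k}" for n
    by (rule image_eqI[of _ _ "2*k - n"]) (use that * in auto)
  then have im1: "(\<lambda>n. 2*k - n) ` {..<2*j-1} = {2*i..2*k}" using * by auto
  have "n \<in> (\<lambda>n. Suc k - n) ` {1..<j}" if "n \<in> {Suc i..k}" for n
    by (rule image_eqI[of _ _ "Suc k - n"]) (use that * in auto)
  then have im2: "(\<lambda>n. Suc k - n) ` {1..<j} = {Suc i..k}" using * by auto
  have r1: "GF (\<lambda>n. F (2*k - n)) {..<2*j-1} = GF F {2*i..2*k}"
    unfolding GF_def im1[symmetric] by (simp only: image_image)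
  have r2: "GC (\<lambda>l. y (Suc k - l)) (\<lambda>n. C (2*k - n)) {..<2*j-1} {1..<j} =
      GC y C {2*i..2*k} {Suc i..k}"
    unfolding GC_def im1[symmetric] im2[symmetric] by (simp only: image_image)
  have "feasible (GF (\<lambda>n. F (2*k - n)) {..<2*j-1})
      (GC (\<lambda>l. y (Suc k - l)) (\<lambda>n. C (2*k - n)) {..<2*j-1} {1..<j})
      col' (contr (y (Suc k - 0)) \<beta> (y (Suc k - j)) s')"
    using reach_feas[OF chain_rev[OF ch] edge_fits_rev[OF E m] vert_fits_rev[OF V m] *(5)] c' i
    by auto
  then have 3: "feasible (GF F {2*i..2*k}) (GC y C {2*i..2*k} {Suc i..k}) col' (contr (y (Suc k)) \<beta> (y i) s')"
    unfolding r1 r2 using i by simp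
  have "feasible (GF F ({..<2*i-1} \<union> {2*i-1})) (GC y C ({..<2*i-1} \<union> {2*i-1}) ({1..<i} \<union> {})) col'
     (\<lambda>x. contr (y 0) \<alpha> (y i) s x + contr (y i) q (y i) 0 x)"
    by (rule feasible_chain_Un[OF ch 1 2]) (use i in auto)
  then have "feasible (GF F ({..<2*i-1} \<union> {2*i-1} \<union> {2*i..2*k}))
     (GC y C ({..<2*i-1} \<union> {2*i-1} \<union> {2*i..2*k}) (({1..<i} \<union> {}) \<union> {Suc i..k})) col'
     (\<lambda>x. contr (y 0) \<alpha> (y i) s x + contr (y i) q (y i) 0 x + contr (y (Suc k)) \<beta> (y i) s' x)"
    by (rule feasible_chain_Un[OF ch _ 3]) (use i in auto)
  moreover have "{..<2*i-1} \<union> {2*i-1} \<union> {2*i..2*k} = {..2*k}" using i by auto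
  ultimately have 4: "feasible (GF F {..2*k}) (GC y C {..2*k} ({1..<i} \<union> {Suc i..k})) col'
     (\<lambda>x. contr (y 0) \<alpha> (y i) s x + contr (y i) q (y i) 0 x + contr (y (Suc k)) \<beta> (y i) s' x)"
    (is "feasible _ _ _ ?d") by simp
  have d: "?d (y i) = c" using ne *(7) unfolding contr_def by simp
  have "feasible (GF F {..2*k}) (GC y C {..2*k} (insert i ({1..<i} \<union> {Suc i..k}))) col' ?d"
  proof (rule feasible_chain_absorb[OF ch 4])
    show "col' (y i) = ?d (y i)" "?d (y i) \<le> 4" unfolding d using *(8) c' by auto
  qed (use i in auto)
  moreover have "insert i ({1..<i} \<union> {Suc i..k}) = {1..k}" using i by auto
  ultimately have 5: "feasible (GF F {..2*k}) (GC y C {..2*k} {1..k}) col' ?d" by simp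
  have yi: "y i \<in> GC y C {..2*k} {1..k}" unfolding GC_def using i by auto
  have "feasible (GF F {..2*k}) (GC y C {..2*k} {1..k}) col (contr (y 0) \<alpha> (y (Suc k)) \<beta>)"
  proof (rule feasible_cong[OF 5])
    fix x assume "x \<notin> GC y C {..2*k} {1..k}"
    then have "x \<noteq> y i" using yi by blast
    then show "?d x = contr (y 0) \<alpha> (y (Suc k)) \<beta> x" "col' x = col x"
      unfolding contr_def col'_def by auto
  qed
  then show ?thesis unfolding GF_def GC_def .
qed

section \<open>Components and shortest ears\<close>

definition nbhd :: "('a \<times> 'a) set \<Rightarrow> 'a set \<Rightarrow> 'a set" where
  "nbhd E C = {y. y \<notin> C \<and> (\<exists>x\<in>C. (x, y) \<in> E)}"

definition conn :: "('a \<times> 'a) set \<Rightarrow> 'a set \<Rightarrow> bool" where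
  "conn E C \<longleftrightarrow> C \<noteq> {} \<and> (\<forall>x\<in>C. \<forall>y\<in>C. (x, y) \<in> (E \<inter> C \<times> C)\<^sup>*)"

definition comps :: "('a \<times> 'a) set \<Rightarrow> 'a set \<Rightarrow> 'a set set" where
  "comps E S = (\<lambda>x. {y. (x, y) \<in> (E \<inter> S \<times> S)\<^sup>*}) ` S"

lemma nbI: "y \<notin> C \<Longrightarrow> x \<in> C \<Longrightarrow> (x, y) \<in> E \<Longrightarrow> y \<in> nbhd E C"
  unfolding nbhd_def by blast

lemma conn_singleton: "conn E {x}"
  unfolding conn_def by auto

lemma rtrancl_restrict_mono: "A \<subseteq> B \<Longrightarrow> (x, y) \<in> (E \<inter> A \<times> A)\<^sup>* \<Longrightarrow> (x, y) \<in> (E \<inter> B \<times> B)\<^sup>*"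
  by (rule rtrancl_mono[THEN subsetD]) auto

lemma conn_Un:
  assumes "conn E A" "conn E B" "sym E" "x \<in> A" "y \<in> B" "(x, y) \<in> E \<or> x = y"
  shows "conn E (A \<union> B)"
proof -
  let ?R = "(E \<inter> (A \<union> B) \<times> (A \<union> B))\<^sup>*"
  have "sym ?R" using assms(3) by (intro sym_rtrancl) (auto simp: sym_def)
  have a: "(p, q) \<in> ?R" if "p \<in> A" "q \<in> A" for p q
    using that assms(1) rtrancl_restrict_mono[of A "A \<union> B" p q E] unfolding conn_def by blast
  have b: "(p, q) \<in> ?R" if "p \<in> B" "q \<in> B" for p q
    using that assms(2) rtrancl_restrict_mono[of B "A \<union> B" p q E] unfolding conn_def by blast
  have "(x, y) \<in> ?R" using assms(4-6) by auto
  then have ab: "(p, q) \<in> ?R" if "p \<in> A" "q \<in> B" for p q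
    using a[OF that(1) assms(4)] b[OF assms(5) that(2)] by (meson rtrancl_trans)
  then have "(q, p) \<in> ?R" if "p \<in> A" "q \<in> B" for p q
    using that \<open>sym ?R\<close> unfolding sym_def by blast
  then show ?thesis using a b ab assms(4) unfolding conn_def by blast
qed

lemma conn_image_interval:
  fixes z :: "nat \<Rightarrow> 'a"
  assumes "sym E" "a \<le> b" "\<And>l. a \<le> l \<Longrightarrow> l < b \<Longrightarrow> (z l, z (Suc l)) \<in> E"
  shows "conn E (z ` {a..b})"
  using assms(2,3)
proof (induction b rule: dec_induct)
  case base
  then show ?case by (simp add: conn_singleton)
next
  case (step b)
  have "conn E (z ` {a..b} \<union> {z (Suc b)})"
    by (rule conn_Un[OF step.IH conn_singleton assms(1), of "z b" "z (Suc b)"])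
      (use step in auto)
  moreover have "z ` {a..b} \<union> {z (Suc b)} = z ` {a..Suc b}" using step.hyps by (auto simp: atLeastAtMostSuc_conv)
  ultimately show ?case by simp
qed

lemma conn_closed:
  assumes "conn E C" "D \<subseteq> C" "D \<noteq> {}" "\<And>x y. x \<in> D \<Longrightarrow> y \<in> C \<Longrightarrow> (x, y) \<in> E \<Longrightarrow> y \<in> D"
  shows "D = C"
proof -
  obtain x where x: "x \<in> D" using assms(3) by blast
  have "y \<in> D" if "y \<in> C" for y
  proof -
    have "(x, y) \<in> (E \<inter> C \<times> C)\<^sup>*" using assms(1,2) x that unfolding conn_def by blast
    then show ?thesis by (induction) (use x assms(4) in auto)
  qed
  then show ?thesis using assms(2) by blast
qed

lemma
  assumes "K \<in> comps E S" "sym E"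
  shows comps_subset: "K \<subseteq> S" and comps_conn: "conn E K" and comps_nb: "nbhd E K \<inter> S = {}"
proof -
  obtain x where x: "x \<in> S" and K: "K = {y. (x, y) \<in> (E \<inter> S \<times> S)\<^sup>*}"
    using assms(1) unfolding comps_def by blast
  show sub: "K \<subseteq> S"
  proof
    fix y assume "y \<in> K"
    then have "(x, y) \<in> (E \<inter> S \<times> S)\<^sup>*" using K by blast
    then show "y \<in> S" by cases (use x in auto)
  qed
  have "sym ((E \<inter> K \<times> K)\<^sup>*)" using assms(2) by (intro sym_rtrancl) (auto simp: sym_def)
  have xK: "(x, y) \<in> (E \<inter> K \<times> K)\<^sup>*" if "y \<in> K" for y
  proof -
    have "(x, y) \<in> (E \<inter> S \<times> S)\<^sup>*" using K that by blast
    then show ?thesis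
    proof induction
      case (step y z)
      then have "y \<in> K" "z \<in> K" unfolding K by (auto intro: rtrancl_into_rtrancl)
      then have "(y, z) \<in> E \<inter> K \<times> K" using step by blast
      then show ?case using step.IH by (rule rtrancl_into_rtrancl[rotated])
    qed simp
  qed
  show "conn E K"
    unfolding conn_def
  proof (intro conjI ballI)
    show "K \<noteq> {}" using K by blast
    fix y z assume "y \<in> K" "z \<in> K"
    then have "(y, x) \<in> (E \<inter> K \<times> K)\<^sup>*" "(x, z) \<in> (E \<inter> K \<times> K)\<^sup>*"
      using xK \<open>sym ((E \<inter> K \<times> K)\<^sup>*)\<close> unfolding sym_def by blast+
    then show "(y, z) \<in> (E \<inter> K \<times> K)\<^sup>*" by (rule rtrancl_trans)
  qed
  show "nbhd E K \<inter> S = {}"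
  proof (rule ccontr)
    assume "nbhd E K \<inter> S \<noteq> {}"
    then obtain y z where "z \<in> S" "z \<notin> K" "y \<in> K" "(y, z) \<in> E" unfolding nbhd_def by blast
    moreover have "y \<in> S" using sub \<open>y \<in> K\<close> by blast
    ultimately have "(x, z) \<in> (E \<inter> S \<times> S)\<^sup>*" unfolding K
      by (auto intro: rtrancl_into_rtrancl)
    then show False using \<open>z \<notin> K\<close> K by blast
  qed
qed

lemma Union_comps: "\<Union> (comps E S) = S"
proof -
  have "K \<subseteq> S" if "K \<in> comps E S" for K
  proof
    fix y assume "y \<in> K"
    then obtain x where "x \<in> S" "(x, y) \<in> (E \<inter> S \<times> S)\<^sup>*" using \<open>K \<in> comps E S\<close> unfolding comps_def by blast
    then show "y \<in> S" by (metis IntD2 SigmaE2 rtranclE)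
  qed
  moreover have "x \<in> \<Union> (comps E S)" if "x \<in> S" for x using that unfolding comps_def by blast
  ultimately show ?thesis by blast
qed

lemma comps_disjoint:
  assumes "K \<in> comps E S" "L \<in> comps E S" "sym E" "K \<noteq> L"
  shows "K \<inter> L = {}"
proof (rule ccontr)
  assume "K \<inter> L \<noteq> {}"
  have "K \<inter> L = K"
    by (rule conn_closed[OF comps_conn[OF assms(1,3)]])
      (use \<open>K \<inter> L \<noteq> {}\<close> comps_nb[OF assms(2,3)] comps_subset[OF assms(1,3)] in \<open>auto simp: nbhd_def\<close>)
  moreover have "K \<inter> L = L"
    by (rule conn_closed[OF comps_conn[OF assms(2,3)]])
      (use \<open>K \<inter> L \<noteq> {}\<close> comps_nb[OF assms(1,3)] comps_subset[OF assms(2,3)] in \<open>auto simp: nbhd_def\<close>)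
  ultimately show False using assms(4) by blast
qed

lemma conn_walk:
  assumes "conn E C" "x \<in> C" "y \<in> C"
  obtains xs where "xs \<noteq> []" "hd xs = x" "last xs = y" "set xs \<subseteq> C" "successively (\<lambda>a b. (a, b) \<in> E) xs"
proof -
  have "(x, y) \<in> (E \<inter> C \<times> C)\<^sup>*" using assms unfolding conn_def by blast
  then have "\<exists>xs. xs \<noteq> [] \<and> hd xs = x \<and> last xs = y \<and> set xs \<subseteq> C \<and> successively (\<lambda>a b. (a, b) \<in> E) xs"
  proof induction
    case base
    then show ?case using assms(2) by (intro exI[of _ "[x]"]) auto
  next
    case (step y z)
    then obtain xs where "xs \<noteq> []" "hd xs = x" "last xs = y" "set xs \<subseteq> C"
      "successively (\<lambda>a b. (a, b) \<in> E) xs" by blast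
    then show ?case using step.hyps
      by (intro exI[of _ "xs @ [z]"]) (auto simp: successively_append_iff)
  qed
  then show ?thesis using that by blast
qed

text \<open>A walk suffices here, since minimality will make it a path. The last condition keeps a
  closed ear from leaving and returning along the same edge.\<close>

definition ear :: "('a \<times> 'a) set \<Rightarrow> 'a set \<Rightarrow> 'a \<Rightarrow> 'a \<Rightarrow> 'a list \<Rightarrow> bool" where
  "ear E C u v xs \<longleftrightarrow> xs \<noteq> [] \<and> set xs \<subseteq> C \<and> successively (\<lambda>a b. (a, b) \<in> E) xs \<and>
     (u, hd xs) \<in> E \<and> (last xs, v) \<in> E \<and> (u = v \<longrightarrow> hd xs \<noteq> last xs)"

definition min_ear where
  "min_ear E C u v xs \<longleftrightarrow> ear E C u v xs \<and> (\<forall>ys. ear E C u v ys \<longrightarrow> length xs \<le> length ys)"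

lemma ex_min_ear: "ear E C u v xs \<Longrightarrow> \<exists>ys. min_ear E C u v ys"
  unfolding min_ear_def using ex_has_least_nat[of "ear E C u v" xs length] by blast

lemma successively_take: "successively P xs \<Longrightarrow> successively P (take n xs)"
  by (metis append_take_drop_id successively_append_iff)

lemma successively_drop: "successively P xs \<Longrightarrow> successively P (drop n xs)"
  by (metis append_take_drop_id successively_append_iff)

lemma ear_splice:
  assumes e: "ear E C u v xs" and ij: "i < j" "j < length xs" "(xs ! i, xs ! j) \<in> E"
  shows "ear E C u v (take (Suc i) xs @ drop j xs)"
proof -
  let ?ys = "take (Suc i) xs @ drop j xs"
  have ne: "take (Suc i) xs \<noteq> []" "drop j xs \<noteq> []" using ij by auto
  have "hd ?ys = hd xs" "last ?ys = last xs" using ij ne by (auto simp: hd_take)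
  moreover have "set ?ys \<subseteq> set xs" by (auto dest: in_set_takeD in_set_dropD)
  moreover have "last (take (Suc i) xs) = xs ! i" "hd (drop j xs) = xs ! j"
    using ij by (auto simp: take_Suc_conv_app_nth hd_drop_conv_nth)
  moreover have "successively (\<lambda>a b. (a, b) \<in> E) ?ys"
    using e ij calculation(4,5) unfolding ear_def
    by (auto simp: successively_append_iff successively_take successively_drop)
  ultimately show ?thesis using e ne unfolding ear_def by auto
qed

lemma ear_splice_eq:
  assumes e: "ear E C u v xs" and ij: "i < j" "j < length xs" "xs ! i = xs ! j"
  shows "ear E C u v (take i xs @ drop j xs)"
proof -
  let ?ys = "take i xs @ drop j xs"
  have ne: "drop j xs \<noteq> []" using ij by auto
  have hdj: "hd (drop j xs) = xs ! j" using ij by (auto simp: hd_drop_conv_nth)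
  have "hd ?ys = hd xs"
  proof (cases i)
    case 0
    then show ?thesis using hdj ij by (metis append_Nil hd_conv_nth list.size(3) not_less_zero take0)
  next
    case (Suc m)
    then have "take i xs \<noteq> []" using ij by auto
    then show ?thesis using Suc by (simp add: hd_take)
  qed
  moreover have "last ?ys = last xs" using ij ne by auto
  moreover have "set ?ys \<subseteq> set xs" by (auto dest: in_set_takeD in_set_dropD)
  moreover have "successively (\<lambda>a b. (a, b) \<in> E) ?ys"
  proof (cases i)
    case 0
    then show ?thesis using e unfolding ear_def by (auto simp: successively_drop)
  next
    case (Suc m)
    have "\<forall>l. Suc l < length xs \<longrightarrow> (xs ! l, xs ! Suc l) \<in> E"
      using e unfolding ear_def by (simp add: successively_conv_nth)
    moreover have "Suc m < length xs" using Suc ij by simp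
    ultimately have "(xs ! m, xs ! i) \<in> E" unfolding Suc by blast
    moreover have "last (take i xs) = xs ! m" using ij Suc by (auto simp: take_Suc_conv_app_nth)
    ultimately show ?thesis
      using e ij hdj unfolding ear_def
      by (auto simp: successively_append_iff successively_take successively_drop)
  qed
  ultimately show ?thesis using e ne unfolding ear_def by auto
qed

lemma min_ear_distinct:
  assumes "min_ear E C u v xs"
  shows "distinct xs"
proof (rule ccontr)
  assume "\<not> distinct xs"
  then obtain i j where "i < j" "j < length xs" "xs ! i = xs ! j"
    by (metis distinct_conv_nth linorder_neqE_nat)
  then have "ear E C u v (take i xs @ drop j xs)" "length (take i xs @ drop j xs) < length xs"
    using assms ear_splice_eq unfolding min_ear_def by auto
  then show False using assms unfolding min_ear_def by (meson leD)
qed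

lemma min_earD: "min_ear E C u v xs \<Longrightarrow> ear E C u v xs"
  "min_ear E C u v xs \<Longrightarrow> ear E C u v ys \<Longrightarrow> length xs \<le> length ys"
  unfolding min_ear_def by blast+

lemma min_ear_chord:
  assumes "min_ear E C u v xs" "i < j" "j < length xs" "(xs ! i, xs ! j) \<in> E"
  shows "j = Suc i"
proof -
  have "length xs \<le> length (take (Suc i) xs @ drop j xs)"
    by (rule min_earD(2)[OF assms(1) ear_splice[OF min_earD(1)[OF assms(1)] assms(2-4)]])
  then show ?thesis using assms(2,3) by simp
qed

text \<open>A later neighbour of \<open>u\<close> would start a shorter ear. For
  \<open>u = v\<close> an intermediate neighbour would instead end a shorter one, whose ends differ
  because the list is distinct; the final vertex is a legitimate neighbour.\<close>

lemma min_ear_first: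
  assumes m: "min_ear E C u v xs" and i: "i < length xs" "(u, xs ! i) \<in> E" and "sym E"
  shows "i = 0 \<or> u = v \<and> Suc i = length xs"
proof (rule ccontr)
  assume not: "\<not> ?thesis"
  have e: "ear E C u v xs" and d: "distinct xs" using min_earD(1)[OF m] min_ear_distinct[OF m] .
  show False
  proof (cases "u = v")
    case False
    have "ear E C u v (drop i xs)"
      using e i False unfolding ear_def
      by (auto simp: successively_drop hd_drop_conv_nth dest: in_set_dropD)
    then have "length xs \<le> length (drop i xs)" by (rule min_earD(2)[OF m])
    then show False using not i by auto
  next
    case True
    have l: "last (take (Suc i) xs) = xs ! i" using i by (simp add: take_Suc_conv_app_nth)
    have h: "hd (take (Suc i) xs) = xs ! 0" using i by (cases xs) auto
    have "0 < length xs" using i(1) by linarith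
    then have "xs ! 0 \<noteq> xs ! i" using nth_eq_iff_index_eq[OF d _ i(1), of 0] not by blast
    moreover have "xs ! 0 = hd xs" using i by (cases xs) auto
    moreover have "(xs ! i, v) \<in> E" using i True assms(4) unfolding sym_def by blast
    ultimately have "ear E C u v (take (Suc i) xs)"
      using e i True l h unfolding ear_def
      by (auto simp: successively_take dest: in_set_takeD)
    then have "length xs \<le> length (take (Suc i) xs)" by (rule min_earD(2)[OF m])
    then show False using not i True by auto
  qed
qed

lemma min_ear_last:
  assumes m: "min_ear E C u v xs" and i: "i < length xs" "(xs ! i, v) \<in> E" and "sym E"
  shows "Suc i = length xs \<or> u = v \<and> i = 0"
proof (cases "u = v")
  case True
  then show ?thesis using min_ear_first[OF m i(1) _ assms(4)] i(2) assms(4) unfolding sym_def by blast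
next
  case False
  have e: "ear E C u v xs" using min_earD(1)[OF m] .
  have l: "last (take (Suc i) xs) = xs ! i" using i by (simp add: take_Suc_conv_app_nth)
  have h: "hd (take (Suc i) xs) = hd xs" using i by (cases xs) auto
  have "ear E C u v (take (Suc i) xs)"
    using e i False l h unfolding ear_def
    by (auto simp: successively_take dest: in_set_takeD)
  then have "length xs \<le> length (take (Suc i) xs)" by (rule min_earD(2)[OF m])
  then show ?thesis using i by auto
qed

text \<open>This excludes subdivisions of the complete bipartite graph K_{2,3}, with the three paths
  relaxed to connected sets; \<open>nbhd\<close> keeps \<open>p\<close> and \<open>q\<close> out of
  those sets.\<close>

definition no_theta :: "('a \<times> 'a) set \<Rightarrow> bool" where
  "no_theta E \<longleftrightarrow> \<not> (\<exists>p q S1 S2 S3. p \<noteq> q \<and> conn E S1 \<and> conn E S2 \<and> conn E S3 \<and>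
     S1 \<inter> S2 = {} \<and> S1 \<inter> S3 = {} \<and> S2 \<inter> S3 = {} \<and> {p, q} \<subseteq> nbhd E S1 \<and> {p, q} \<subseteq> nbhd E S2 \<and> {p, q} \<subseteq> nbhd E S3)"

text \<open>Two attachments that are not consecutive leave a nonempty arc of the cycle on either
  side, and these arcs together with \<open>D\<close> form a theta. Periodic indexing makes the arc
  through position 0 an interval as well.\<close>

lemma cycle_attachments:
  fixes z :: "nat \<Rightarrow> 'a"
  assumes nt: "no_theta E" and "sym E" and n: "0 < n"
    and inj: "\<And>a b. z a = z b \<Longrightarrow> a mod n = b mod n" and per: "\<And>a. z (a + n) = z a"
    and edge: "\<And>l. (z l, z (Suc l)) \<in> E"
    and D: "conn E D" "D \<inter> range z = {}" and ij: "i < j" "j < n" "z i \<in> nbhd E D" "z j \<in> nbhd E D"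
  shows "j = Suc i \<or> i = 0 \<and> Suc j = n"
proof (rule ccontr)
  assume not: "\<not> ?thesis"
  have neq: "z a \<noteq> z b" if "a < b" "b < a + n" for a b
  proof
    assume "z a = z b"
    then have "a mod n = b mod n" by (rule inj)
    then have "n dvd b - a" using that by (metis less_imp_le_nat mod_eq_dvd_iff_nat)
    then show False using that by (auto dest: dvd_imp_le)
  qed
  let ?S2 = "z ` {Suc i..j - 1}" and ?S3 = "z ` {Suc j..i + n - 1}"
  have c2: "conn E ?S2" by (rule conn_image_interval) (use assms(2) edge not ij in auto)
  have c3: "conn E ?S3" by (rule conn_image_interval) (use assms(2) edge not ij in auto)
  have sub: "?S2 \<subseteq> range z" "?S3 \<subseteq> range z" by auto
  have d23: "?S2 \<inter> ?S3 = {}"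
  proof -
    have "z a \<noteq> z b" if "a \<in> {Suc i..j - 1}" "b \<in> {Suc j..i + n - 1}" for a b
      by (rule neq) (use that ij in auto)
    then show ?thesis by blast
  qed
  have backwards: "(z (Suc l), z l) \<in> E" for l using edge assms(2) unfolding sym_def by blast
  have i2: "z i \<notin> ?S2" and j2: "z j \<notin> ?S2"
  proof -
    have "z i \<noteq> z a" "z a \<noteq> z j" if "a \<in> {Suc i..j - 1}" for a
    proof -
      have "i < a" "a \<le> j - 1" using that by auto
      then have "a < j" "a < i + n" "j < a + n" using ij by linarith+
      then show "z i \<noteq> z a" "z a \<noteq> z j" using neq \<open>i < a\<close> by blast+
    qed
    then show "z i \<notin> ?S2" "z j \<notin> ?S2" by (metis imageE)+
  qed
  have e2: "(z (Suc i), z i) \<in> E" "(z (j - 1), z j) \<in> E"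
    using backwards[of i] edge[of "j - 1"] ij(1) by simp_all
  have "Suc i \<in> {Suc i..j - 1}" "j - 1 \<in> {Suc i..j - 1}" using not ij by auto
  then have m2: "z (Suc i) \<in> ?S2" "z (j - 1) \<in> ?S2" by blast+
  have n2: "{z i, z j} \<subseteq> nbhd E ?S2"
    using nbI[OF i2 m2(1) e2(1)] nbI[OF j2 m2(2) e2(2)] by simp
  have i3: "z i \<notin> ?S3" and j3: "z j \<notin> ?S3"
  proof -
    have "z a \<noteq> z (i + n)" "z j \<noteq> z a" if "a \<in> {Suc j..i + n - 1}" for a
    proof -
      have "j < a" "a \<le> i + n - 1" using that by auto
      then have "a < i + n" "a < j + n" "i + n < a + n" using ij by linarith+
      then show "z a \<noteq> z (i + n)" "z j \<noteq> z a" using neq \<open>j < a\<close> by blast+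
    qed
    then show "z i \<notin> ?S3" "z j \<notin> ?S3" by (metis imageE per)+
  qed
  have e3: "(z (Suc j), z j) \<in> E" "(z (i + n - 1), z i) \<in> E"
    using backwards[of j] edge[of "i + n - 1"] n per[of i] by simp_all
  have "Suc j \<in> {Suc j..i + n - 1}" "i + n - 1 \<in> {Suc j..i + n - 1}" using not ij by auto
  then have m3: "z (Suc j) \<in> ?S3" "z (i + n - 1) \<in> ?S3" by blast+
  have n3: "{z i, z j} \<subseteq> nbhd E ?S3"
    using nbI[OF i3 m3(2) e3(2)] nbI[OF j3 m3(1) e3(1)] by simp
  have "z i \<noteq> z j" using neq[of i j] ij by linarith
  moreover have "D \<inter> ?S2 = {}" "D \<inter> ?S3 = {}" using D(2) sub by blast+
  moreover have "{z i, z j} \<subseteq> nbhd E D" using ij(3,4) by simp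
  ultimately have "\<exists>p q S1 S2 S3. p \<noteq> q \<and> conn E S1 \<and> conn E S2 \<and> conn E S3 \<and>
     S1 \<inter> S2 = {} \<and> S1 \<inter> S3 = {} \<and> S2 \<inter> S3 = {} \<and> {p, q} \<subseteq> nbhd E S1 \<and> {p, q} \<subseteq> nbhd E S2 \<and> {p, q} \<subseteq> nbhd E S3"
    using D(1) c2 c3 d23 n2 n3
    by (intro exI[where x="z i"] exI[where x="z j"] exI[where x=D] exI[where x="?S2"] exI[where x="?S3"]) simp
  then show False using nt unfolding no_theta_def by simp
qed

section \<open>Decomposing along an ear\<close>

definition edge_part :: "('a \<times> 'a) set \<Rightarrow> 'a \<Rightarrow> 'a \<Rightarrow> 'a set \<Rightarrow> nat \<Rightarrow> nat \<Rightarrow> nat \<Rightarrow> nat \<Rightarrow> bool" where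
  "edge_part E u v C c c' a b \<longleftrightarrow>
     (\<forall>col. col u = c \<longrightarrow> col v = c' \<longrightarrow> feasible (touch E C) C col (contr u a v b))"

definition vertex_part :: "('a \<times> 'a) set \<Rightarrow> 'a \<Rightarrow> 'a set \<Rightarrow> nat \<Rightarrow> nat \<Rightarrow> bool" where
  "vertex_part E v C c q \<longleftrightarrow> (\<forall>col. col v = c \<longrightarrow> feasible (touch E C) C col (contr v q v 0))"

lemma edge_ok_swap: "edge_ok P \<Longrightarrow> edge_ok (\<lambda>c c' a b. P c' c b a)"
  unfolding edge_ok_def by (auto simp: insert_commute)

text \<open>One objecting piece is enough: when it sends its arc, the pair contains a 3, so the
  other piece is content to send none. The same reasoning gives \<open>vert_ok_Un\<close>.\<close>

lemma edge_ok_Un: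
  assumes "edge_ok P1" "edge_ok P2"
    "\<And>c c' a b a' b'. P1 c c' a b \<Longrightarrow> P2 c c' a' b' \<Longrightarrow> P3 c c' (a + a') (b + b')"
  shows "edge_ok P3"
proof -
  have z: "P1 c c' 0 0" "P2 c c' 0 0" if "c \<noteq> c' \<and> {c, c'} \<noteq> {1, 2}" for c c'
    using assms(1,2) that unfolding edge_ok_def by blast+
  have z3: "P3 c c' 0 0" if "c \<noteq> c' \<and> {c, c'} \<noteq> {1, 2}" for c c'
    using assms(3)[OF z[OF that]] by simp
  have s: "P3 c c' a b" if "P1 c c' a b \<and> P2 c c' 0 0 \<or> P1 c c' 0 0 \<and> P2 c c' a b" for c c' a b
    using that assms(3)[of c c' a b 0 0] assms(3)[of c c' 0 0 a b] by auto
  have n: "P1 3 1 0 0" "P2 3 1 0 0" "P1 1 3 0 0" "P2 1 3 0 0"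
    "P1 3 2 0 0" "P2 3 2 0 0" "P1 2 3 0 0" "P2 2 3 0 0"
    using z[of 3 1] z[of 1 3] z[of 3 2] z[of 2 3] by (auto simp: doubleton_eq_iff)
  have A: "P3 1 2 0 0 \<and> P3 2 1 0 0 \<or> P3 3 1 1 0 \<and> P3 1 3 0 1"
    using assms(1,2) n s unfolding edge_ok_def by meson
  have B: "P3 1 2 0 0 \<or> P3 3 2 1 0"
    using assms(1,2) n s unfolding edge_ok_def by meson
  have C: "P3 2 1 0 0 \<or> P3 2 3 0 1"
    using assms(1,2) n s unfolding edge_ok_def by meson
  show ?thesis unfolding edge_ok_def using z3 A B C by blast
qed

lemma vert_ok_Un:
  assumes "vert_ok Q1" "vert_ok Q2" "\<And>c a a'. Q1 c a \<Longrightarrow> Q2 c a' \<Longrightarrow> Q3 c (a + a')"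
  shows "vert_ok Q3"
proof -
  have z: "Q1 c 0" "Q2 c 0" if "c \<noteq> 2" for c using assms(1,2) that unfolding vert_ok_def by blast+
  have s: "Q3 c a" if "Q1 c a \<and> Q2 c 0 \<or> Q1 c 0 \<and> Q2 c a" for c a
    using that assms(3)[of c a 0] assms(3)[of c 0 a] by auto
  have n: "Q1 3 0" "Q2 3 0" "Q1 4 0" "Q2 4 0" using z by auto
  have "Q3 2 0 \<or> Q3 3 1 \<and> Q3 4 2"
    using assms(1,2) n s unfolding vert_ok_def by meson
  then show ?thesis unfolding vert_ok_def using z s by blast
qed

lemma touch_Un: "touch E (A \<union> B) = touch E A \<union> touch E B"
  unfolding touch_def by auto

locale sgraph =
  fixes E :: "('a \<times> 'a) set"
  assumes sym: "sym E" and fin: "finite E" and irr: "(x, x) \<notin> E"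
begin

lemma edge_sym: "(x, y) \<in> E \<Longrightarrow> (y, x) \<in> E"
  using sym unfolding sym_def by blast

lemma Field_touch: "Field (touch E C) \<subseteq> C \<union> nbhd E C"
  unfolding Field_def touch_def nbhd_def using edge_sym by auto

lemma sym_touch: "sym (touch E C)"
  unfolding touch_def sym_def using edge_sym by auto

lemma finite_touch: "finite (touch E C)"
  by (rule finite_subset[OF _ fin]) (auto simp: touch_def)

lemma touch_disjoint:
  assumes "A \<inter> B = {}" "nbhd E A \<inter> B = {}"
  shows "touch E A \<inter> touch E B = {}"
  using assms edge_sym unfolding touch_def nbhd_def by blast

lemma nbhd_disjoint_sym: "nbhd E A \<inter> B = {} \<Longrightarrow> A \<inter> B = {} \<Longrightarrow> nbhd E B \<inter> A = {}"
  using edge_sym unfolding nbhd_def by blast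

lemma feasible_touch_Un:
  assumes "feasible (touch E A) A c d1" "feasible (touch E B) B c d2" "A \<inter> B = {}" "nbhd E A \<inter> B = {}"
  shows "feasible (touch E (A \<union> B)) (A \<union> B) c (\<lambda>x. d1 x + d2 x)"
  unfolding touch_Un
proof (rule feasible_Un[OF assms(1,2) finite_touch finite_touch sym_touch sym_touch])
  show "touch E A \<inter> touch E B = {}" by (rule touch_disjoint[OF assms(3,4)])
  show "Field (touch E A) \<inter> B = {}" using Field_touch[of A] assms(3,4) by blast
  show "Field (touch E B) \<inter> A = {}"
    using Field_touch[of B] assms(3) nbhd_disjoint_sym[OF assms(4,3)] by blast
qed fact

lemma edge_part_Un:
  assumes "edge_part E u v A c c' a b" "edge_part E u v B c c' a' b'" "A \<inter> B = {}" "nbhd E A \<inter> B = {}"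
  shows "edge_part E u v (A \<union> B) c c' (a + a') (b + b')"
  unfolding edge_part_def
proof (intro allI impI)
  fix col assume "col u = c" "col v = c'"
  then have "feasible (touch E (A \<union> B)) (A \<union> B) col (\<lambda>x. contr u a v b x + contr u a' v b' x)"
    using assms unfolding edge_part_def by (intro feasible_touch_Un) auto
  moreover have "(\<lambda>x. contr u a v b x + contr u a' v b' x) = contr u (a + a') v (b + b')"
    unfolding contr_def by auto
  ultimately show "feasible (touch E (A \<union> B)) (A \<union> B) col (contr u (a + a') v (b + b'))" by simp
qed

lemma vertex_part_Un:
  assumes "vertex_part E v A c a" "vertex_part E v B c a'" "A \<inter> B = {}" "nbhd E A \<inter> B = {}"
  shows "vertex_part E v (A \<union> B) c (a + a')"
proof -
  have "edge_part E v v (A \<union> B) c c (a + a') (0 + 0)"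
    by (rule edge_part_Un) (use assms in \<open>auto simp: vertex_part_def edge_part_def\<close>)
  then show ?thesis unfolding vertex_part_def edge_part_def by simp
qed

lemma contr_0: "contr u 0 v 0 = (\<lambda>_. 0)"
  unfolding contr_def by auto

lemma edge_part_empty: "edge_part E u v {} c c' 0 0"
  using feasible_empty unfolding edge_part_def contr_0 by (auto simp: touch_def)

lemma vertex_part_empty: "vertex_part E v {} c 0"
  using feasible_empty unfolding vertex_part_def contr_0 by (auto simp: touch_def)

lemma finite_comps: "finite S \<Longrightarrow> finite (comps E S)"
  unfolding comps_def by simp

lemma comps_sep:
  assumes "insert D \<D> \<subseteq> comps E S" "D \<notin> \<D>"
  shows "D \<inter> \<Union>\<D> = {}" "nbhd E D \<inter> \<Union>\<D> = {}"
proof -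
  have "D \<inter> D' = {}" if "D' \<in> \<D>" for D'
    using comps_disjoint[OF _ _ sym, of D S D'] assms that by auto
  then show "D \<inter> \<Union>\<D> = {}" by blast
  have "\<Union>\<D> \<subseteq> S" using comps_subset[OF _ sym] assms(1) by blast
  then show "nbhd E D \<inter> \<Union>\<D> = {}" using comps_nb[OF _ sym, of D S] assms(1) by blast
qed

lemma edge_ok_Union:
  assumes "finite \<D>" "\<D> \<subseteq> comps E S" "\<And>D. D \<in> \<D> \<Longrightarrow> edge_ok (edge_part E u v D)"
  shows "edge_ok (edge_part E u v (\<Union>\<D>))"
  using assms
proof (induction \<D>)
  case empty
  then show ?case unfolding edge_ok_def using edge_part_empty by simp
next
  case (insert D \<D>)
  have 1: "edge_ok (edge_part E u v D)" "edge_ok (edge_part E u v (\<Union>\<D>))" using insert by auto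
  have "edge_ok (edge_part E u v (D \<union> \<Union>\<D>))"
    by (rule edge_ok_Un[OF 1]) (rule edge_part_Un[OF _ _ comps_sep[OF insert.prems(1) insert.hyps(2)]])
  then show ?case by simp
qed

lemma vert_ok_Union:
  assumes "finite \<D>" "\<D> \<subseteq> comps E S" "\<And>D. D \<in> \<D> \<Longrightarrow> vert_ok (vertex_part E v D)"
  shows "vert_ok (vertex_part E v (\<Union>\<D>))"
  using assms
proof (induction \<D>)
  case empty
  then show ?case unfolding vert_ok_def using vertex_part_empty by simp
next
  case (insert D \<D>)
  have 1: "vert_ok (vertex_part E v D)" "vert_ok (vertex_part E v (\<Union>\<D>))" using insert by auto
  have "vert_ok (vertex_part E v (D \<union> \<Union>\<D>))"
    by (rule vert_ok_Un[OF 1]) (rule vertex_part_Un[OF _ _ comps_sep[OF insert.prems(1) insert.hyps(2)]])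
  then show ?case by simp
qed

end

section \<open>The cycle closed by a shortest ear, and the pieces attached to it\<close>

locale ear_graph = sgraph +
  fixes C :: "'a set" and u v :: 'a and xs :: "'a list"
  assumes nt: "no_theta E" and tri: "\<And>x y z. (x, y) \<in> E \<Longrightarrow> (y, z) \<in> E \<Longrightarrow> (z, x) \<notin> E"
    and C: "conn E C" "finite C" "nbhd E C = {u, v}"
    and base: "u \<noteq> v \<Longrightarrow> (u, v) \<in> E"
    and xs: "min_ear E C u v xs"
begin

abbreviation "k \<equiv> length xs"

definition y :: "nat \<Rightarrow> 'a" where
  "y i = (if i = 0 then u else if i \<le> k then xs ! (i - 1) else v)"

lemma y_0: "y 0 = u" and y_Suc_k: "y (Suc k) = v" by (auto simp: y_def)

lemma y_xs: "1 \<le> i \<Longrightarrow> i \<le> k \<Longrightarrow> y i = xs ! (i - 1)" by (auto simp: y_def)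

lemma y_Suc: "i < k \<Longrightarrow> y (Suc i) = xs ! i" by (auto simp: y_def)

lemma e: "xs \<noteq> []" "set xs \<subseteq> C" "successively (\<lambda>a b. (a, b) \<in> E) xs"
  "(u, hd xs) \<in> E" "(last xs, v) \<in> E" "u = v \<Longrightarrow> hd xs \<noteq> last xs"
  using min_earD(1)[OF xs] unfolding ear_def by blast+

lemma dist: "distinct xs" by (rule min_ear_distinct[OF xs])

lemma uv_notin: "u \<notin> C" "v \<notin> C"
  using C(3) unfolding nbhd_def by blast+

lemma y_image: "y ` {1..k} = set xs"
proof -
  have "y ` {1..k} = y ` Suc ` {..<k}" by (simp only: image_Suc_lessThan)
  also have "\<dots> = (\<lambda>i. xs ! i) ` {..<k}" unfolding image_image by (rule image_cong) (auto simp: y_Suc)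
  also have "\<dots> = set xs" by (auto simp: set_conv_nth)
  finally show ?thesis .
qed

lemma y_mem: "1 \<le> i \<Longrightarrow> i \<le> k \<Longrightarrow> y i \<in> set xs"
  using y_image by (metis atLeastAtMost_iff imageI)

lemma xs_y: "w \<in> set xs \<Longrightarrow> \<exists>i. 1 \<le> i \<and> i \<le> k \<and> w = y i"
  unfolding y_image[symmetric] by auto

text \<open>Triangle-freeness enters here: an open ear with one vertex, or a closed one with two,
  would complete a triangle. A closed ear with one vertex is ruled out by the definition of
  \<open>ear\<close>.\<close>

lemma k_ge: "2 \<le> k" "u = v \<Longrightarrow> 3 \<le> k"
proof -
  have "k \<noteq> 0" using e(1) by simp
  show 2: "2 \<le> k"
  proof (rule ccontr)
    assume "\<not> 2 \<le> k"
    then have "k = 1" using \<open>k \<noteq> 0\<close> by linarith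
    then obtain x where "xs = [x]" by (auto simp: length_Suc_conv)
    then show False using e base tri[of u x v] edge_sym by auto
  qed
  show "3 \<le> k" if "u = v"
  proof (rule ccontr)
    assume "\<not> 3 \<le> k"
    then have "k = 2" using 2 by simp
    then obtain x x' where "xs = [x, x']" by (auto simp: length_Suc_conv numeral_2_eq_2)
    then show False using e that tri[of u x x'] by auto
  qed
qed

lemma y_edge: "i \<le> k \<Longrightarrow> (y i, y (Suc i)) \<in> E"
proof -
  assume i: "i \<le> k"
  consider "i = 0" | "i = k" | "0 < i" "i < k" using i by linarith
  then show ?thesis
  proof cases
    case 1
    have "0 < k" using e(1) by simp
    then have "y (Suc 0) = hd xs" using y_Suc[of 0] e(1) by (simp add: hd_conv_nth)
    then show ?thesis using 1 e(4) y_0 by simp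
  next
    case 2
    have "y k = last xs" using y_xs[of k] e(1) by (simp add: last_conv_nth Suc_le_eq)
    then show ?thesis using 2 e(5) y_Suc_k by simp
  next
    case 3
    then obtain j where "i = Suc j" by (cases i) auto
    then show ?thesis using 3 e(3) y_Suc[of j] y_Suc[of i] by (auto simp: successively_conv_nth)
  qed
qed

lemma y_eq:
  assumes "i \<le> Suc k" "j \<le> Suc k" "y i = y j"
  shows "i = j \<or> u = v \<and> (i = 0 \<and> j = Suc k \<or> j = 0 \<and> i = Suc k)"
proof -
  have in_C: "y i \<in> C \<longleftrightarrow> 1 \<le> i \<and> i \<le> k" if "i \<le> Suc k" for i
  proof (cases "1 \<le> i \<and> i \<le> k")
    case True
    then show ?thesis using y_mem e(2) by auto
  next
    case False
    then have "i = 0 \<or> i = Suc k" using that by auto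
    then show ?thesis using uv_notin y_0 y_Suc_k by auto
  qed
  show ?thesis
  proof (cases "1 \<le> i \<and> i \<le> k")
    case True
    then have "1 \<le> j \<and> j \<le> k" using in_C assms by metis
    then have "i - 1 = j - 1" using True assms(3) dist
      by (auto simp: y_xs nth_eq_iff_index_eq)
    then show ?thesis using True \<open>1 \<le> j \<and> j \<le> k\<close> by linarith
  next
    case False
    then have "\<not> (1 \<le> j \<and> j \<le> k)" using in_C assms by metis
    then have "(i = 0 \<or> i = Suc k) \<and> (j = 0 \<or> j = Suc k)" using False assms(1,2) by linarith
    then show ?thesis using assms(3) y_0 y_Suc_k by auto
  qed
qed

text \<open>For \<open>u = v\<close> the indices 0 and \<open>k + 1\<close> denote the same vertex of the cycle.\<close>

definition n where "n = (if u = v then Suc k else Suc (Suc k))"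

definition z where "z l = y (l mod n)"

lemma n_ge: "4 \<le> n" using k_ge unfolding n_def by auto

lemma n_le: "n \<le> Suc (Suc k)" "u = v \<Longrightarrow> n = Suc k"
  unfolding n_def by auto

lemma z_eq: "l < n \<Longrightarrow> z l = y l" unfolding z_def by simp

lemma z_inj: "z a = z b \<Longrightarrow> a mod n = b mod n"
proof -
  assume "z a = z b"
  moreover have "a mod n < n" "b mod n < n" using n_ge by auto
  then have "a mod n \<le> Suc k \<and> b mod n \<le> Suc k \<and> (u = v \<longrightarrow> a mod n \<noteq> Suc k \<and> b mod n \<noteq> Suc k)"
    using n_le by (metis less_Suc_eq_le less_irrefl less_le_trans)
  ultimately show ?thesis using y_eq[of "a mod n" "b mod n"] unfolding z_def by blast
qed

lemma z_edge: "(z l, z (Suc l)) \<in> E"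
proof (cases "Suc (l mod n) = n")
  case True
  then have s: "Suc l mod n = 0" by (simp add: mod_Suc)
  show ?thesis
  proof (cases "u = v")
    case True
    then have "l mod n = k" using \<open>Suc (l mod n) = n\<close> unfolding n_def by simp
    then show ?thesis using y_edge[of k] s True y_0 y_Suc_k unfolding z_def by simp
  next
    case False
    then have "l mod n = Suc k" using \<open>Suc (l mod n) = n\<close> unfolding n_def by simp
    then show ?thesis using s base[OF False] edge_sym y_0 y_Suc_k unfolding z_def by simp
  qed
next
  case False
  then have s: "Suc l mod n = Suc (l mod n)" by (simp add: mod_Suc)
  have "l mod n < n" using n_ge by auto
  then have "l mod n \<le> k" using False n_le(1) by linarith
  then show ?thesis using y_edge s unfolding z_def by simp
qed

definition parts where "parts = comps E (C - set xs)"

lemma parts_props: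
  assumes "D \<in> parts"
  shows "D \<subseteq> C - set xs" "conn E D" "nbhd E D \<inter> (C - set xs) = {}" "card D < card C"
    "D \<inter> y ` {0..Suc k} = {}"
proof -
  show s: "D \<subseteq> C - set xs" and "conn E D" "nbhd E D \<inter> (C - set xs) = {}"
    using assms comps_subset comps_conn comps_nb sym unfolding parts_def by blast+
  have "D \<subset> C" using s e(1,2) by (cases xs) auto
  then show "card D < card C" using C(2) by (rule psubset_card_mono[rotated])
  have "y i \<notin> D" if il: "i \<le> Suc k" for i
  proof -
    consider "i = 0" | "i = Suc k" | "1 \<le> i" "i \<le> k" using il by linarith
    then show ?thesis
      by cases (use s uv_notin y_0 y_Suc_k y_mem in auto)
  qed
  then show "D \<inter> y ` {0..Suc k} = {}" by auto
qed

text \<open>A part attached to \<open>u\<close> and \<open>v\<close> alone would be all of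
  \<open>C\<close> by connectedness, so every part touches an inner vertex of the ear. Any two of
  its attachments are consecutive on the cycle, and the base edge \<open>uv\<close> carries no
  part.\<close>

lemma attachments:
  assumes D: "D \<in> parts"
  shows "\<exists>m\<le>2*k. nbhd E D = {y ((m + 1) div 2), y ((m + 2) div 2)}"
proof -
  note p = parts_props[OF D]
  have sub: "\<exists>l<n. w = z l" if "w \<in> nbhd E D" for w
  proof (cases "w \<in> C")
    case True
    then have "w \<in> set xs" using p(3) that by blast
    then obtain i where "1 \<le> i" "i \<le> k" "w = y i" using xs_y by blast
    have "i < n" using \<open>i \<le> k\<close> unfolding n_def by auto
    moreover have "w = z i" using z_eq[OF \<open>i < n\<close>] \<open>w = y i\<close> by simp
    ultimately show ?thesis by blast
  next
    case False
    then have "w \<in> nbhd E C" using that p(1) unfolding nbhd_def by blast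
    then have "w = u \<or> w = v \<and> u \<noteq> v" using C(3) by auto
    then show ?thesis
    proof (elim disjE conjE)
      assume "w = u"
      then show ?thesis using z_eq[of 0] n_ge y_0 by (intro exI[of _ 0]) simp
    next
      assume "w = v" "u \<noteq> v"
      moreover from this have "Suc k < n" unfolding n_def by simp
      ultimately show ?thesis using z_eq[of "Suc k"] y_Suc_k by (intro exI[of _ "Suc k"]) simp
    qed
  qed
  have Dz: "D \<inter> range z = {}"
  proof -
    have "l mod n \<le> Suc k" for l
      using mod_less_divisor[of n l] n_ge n_le(1) by linarith
    then have "range z \<subseteq> y ` {0..Suc k}" unfolding z_def by auto
    then show ?thesis using p(5) by blast
  qed
  define I where "I = {l. l < n \<and> z l \<in> nbhd E D}"
  have nbI: "nbhd E D = z ` I" unfolding I_def using sub by auto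
  have pair: "j = Suc i \<or> i = 0 \<and> Suc j = n" if "i \<in> I" "j \<in> I" "i < j" for i j
  proof (rule cycle_attachments[OF nt sym _ z_inj _ z_edge p(2) Dz that(3)])
    show "0 < n" using n_ge by simp
    show "z (a + n) = z a" for a unfolding z_def by simp
  qed (use that in \<open>auto simp: I_def\<close>)
  have "\<exists>i\<in>I. 1 \<le> i \<and> i \<le> k"
  proof (rule ccontr)
    assume no: "\<not> ?thesis"
    have "D = C"
    proof (rule conn_closed[OF C(1)])
      show "D \<subseteq> C" "D \<noteq> {}" using p(1,2) unfolding conn_def by auto
      fix a b assume "a \<in> D" "b \<in> C" "(a, b) \<in> E"
      show "b \<in> D"
      proof (rule ccontr)
        assume "b \<notin> D"
        then have bn: "b \<in> nbhd E D" using \<open>a \<in> D\<close> \<open>(a, b) \<in> E\<close> unfolding nbhd_def by blast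
        then have "b \<in> set xs" using p(3) \<open>b \<in> C\<close> by blast
        then obtain i where i: "1 \<le> i" "i \<le> k" "b = y i" using xs_y by blast
        have "i < n" using \<open>i \<le> k\<close> unfolding n_def by auto
        then have "i \<in> I" unfolding I_def using bn z_eq[of i] i(3) by simp
        then show False using no i by blast
      qed
    qed
    then show False using p(1) e(1,2) by (cases xs) auto
  qed
  then obtain i where i: "i \<in> I" "1 \<le> i" "i \<le> k" by blast
  then have zi: "z i = y i" unfolding I_def using z_eq by auto
  show ?thesis
  proof (cases "I = {i}")
    case True
    have "(2 * i - 1 + 1) div 2 = i" "(2 * i - 1 + 2) div 2 = i" using i by presburger+
    then show ?thesis using nbI True zi i by (intro exI[of _ "2 * i - 1"]) simp
  next
    case False
    then obtain j where j: "j \<in> I" "j \<noteq> i" using i by blast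
    have lt: "i < n" "j < n" using i j unfolding I_def by auto
    \<comment> \<open>On a cycle of length at least 4 no three positions are pairwise
      consecutive.\<close>
    have "l = i \<or> l = j" if "l \<in> I" for l
    proof (rule ccontr)
      assume not: "\<not> ?thesis"
      have "l < n" using that unfolding I_def by auto
      have "a = Suc b \<or> b = Suc a \<or> a = 0 \<and> Suc b = n \<or> b = 0 \<and> Suc a = n"
        if "a \<in> I" "b \<in> I" "a \<noteq> b" for a b
        using pair[of a b] pair[of b a] that by linarith
      from this[of l i] this[of l j] this[of i j] show False
        using that i j not lt n_ge by auto
    qed
    then have I: "I = {i, j}" using i j by auto
    then have nbD: "nbhd E D = {y i, y j}" using nbI z_eq lt by auto
    consider "j = Suc i" | "i = Suc j" | "j = 0" "Suc i = n"
      using pair[of i j] pair[of j i] i j by linarith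
    then show ?thesis
    proof cases
      case 1
      then show ?thesis using nbD i by (intro exI[of _ "2 * i"]) simp
    next
      case 2
      then show ?thesis using nbD i by (intro exI[of _ "2 * j"]) (auto simp: insert_commute)
    next
      \<comment> \<open>An inner vertex precedes position 0 only in a closed ear; there 0 also
        stands for \<open>k + 1\<close>, so this is the last ear edge.\<close>
      case 3
      then have "u = v" "i = k" using i unfolding n_def by (auto split: if_splits)
      then show ?thesis using nbD 3 y_0 y_Suc_k by (intro exI[of _ "2 * k"]) simp
    qed
  qed
qed

text \<open>The two indices of gadget \<open>m\<close> sum to \<open>m + 1\<close>, so comparing
  sums suffices. The bounds on \<open>k\<close> exclude accidental equalities caused by
  \<open>y 0 = y (k + 1)\<close> in a closed ear.\<close>

lemma attachments_unique:
  assumes "m \<le> 2*k" "m' \<le> 2*k"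
    "{y ((m + 1) div 2), y ((m + 2) div 2)} = {y ((m' + 1) div 2), y ((m' + 2) div 2)}"
  shows "m = m'"
proof -
  define a b a' b' where ab: "a = (m + 1) div 2" "b = (m + 2) div 2" "a' = (m' + 1) div 2" "b' = (m' + 2) div 2"
  have le: "a \<le> b" "b \<le> Suc a" "b \<le> Suc k" "a' \<le> b'" "b' \<le> Suc a'" "b' \<le> Suc k"
    and sum: "a + b = m + 1" "a' + b' = m' + 1"
    unfolding ab using assms(1,2) by presburger+
  have "y a = y a' \<and> y b = y b' \<or> y a = y b' \<and> y b = y a'"
    using assms(3) unfolding ab[symmetric] by (auto simp: doubleton_eq_iff)
  moreover have bd: "a \<le> Suc k" "a' \<le> Suc k" using le by linarith+
  moreover have "a = c \<or> a = 0 \<and> c = Suc k \<and> 3 \<le> k \<or> c = 0 \<and> a = Suc k \<and> 3 \<le> k"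
    if "y a = y c" "a \<le> Suc k" "c \<le> Suc k" for a c
    using y_eq[OF that(2,3,1)] k_ge(2) by blast
  ultimately consider
    "(a = a' \<or> a = 0 \<and> a' = Suc k \<and> 3 \<le> k \<or> a' = 0 \<and> a = Suc k \<and> 3 \<le> k)"
    "(b = b' \<or> b = 0 \<and> b' = Suc k \<and> 3 \<le> k \<or> b' = 0 \<and> b = Suc k \<and> 3 \<le> k)"
  | "(a = b' \<or> a = 0 \<and> b' = Suc k \<and> 3 \<le> k \<or> b' = 0 \<and> a = Suc k \<and> 3 \<le> k)"
    "(b = a' \<or> b = 0 \<and> a' = Suc k \<and> 3 \<le> k \<or> a' = 0 \<and> b = Suc k \<and> 3 \<le> k)"
    using le by metis
  then have "a + b = a' + b'"
  proof cases
    case 1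
    then show ?thesis by (elim disjE conjE) (use le sum assms(1,2) k_ge(1) in linarith)+
  next
    case 2
    then show ?thesis by (elim disjE conjE) (use le sum assms(1,2) k_ge(1) in linarith)+
  qed
  then show ?thesis using sum by simp
qed

end

context ear_graph
begin

text \<open>All components with the same attachments are merged, so that each index carries exactly
  one piece, possibly empty.\<close>

definition Cp where "Cp m = \<Union>{D \<in> parts. nbhd E D = {y ((m + 1) div 2), y ((m + 2) div 2)}}"

definition Fp where
  "Fp m = touch E (Cp m) \<union>
     (if even m then {(y (m div 2), y (Suc (m div 2))), (y (Suc (m div 2)), y (m div 2))} else {})"

lemma Union_parts: "\<Union> parts = C - set xs"
  unfolding parts_def by (rule Union_comps)

lemma finite_parts: "finite parts"
  unfolding parts_def using C(2) by (intro finite_comps) simp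

lemma Cp_sub: "Cp m \<subseteq> C - set xs"
  unfolding Cp_def using Union_parts by blast

lemma UN_Cp: "(\<Union>m\<le>2*k. Cp m) = C - set xs"
proof
  show "(\<Union>m\<le>2*k. Cp m) \<subseteq> C - set xs" using Cp_sub by blast
  show "C - set xs \<subseteq> (\<Union>m\<le>2*k. Cp m)"
  proof
    fix x assume "x \<in> C - set xs"
    then obtain D where D: "D \<in> parts" "x \<in> D" using Union_parts by blast
    obtain m where m: "m \<le> 2*k" "nbhd E D = {y ((m + 1) div 2), y ((m + 2) div 2)}"
      using attachments[OF D(1)] by blast
    then have "x \<in> Cp m" unfolding Cp_def using D by blast
    then show "x \<in> (\<Union>m\<le>2*k. Cp m)" using m(1) by blast
  qed
qed

lemma nbhd_CpE:
  assumes "w \<in> nbhd E (Cp m)"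
  obtains D where "D \<in> parts" "nbhd E D = {y ((m + 1) div 2), y ((m + 2) div 2)}" "w \<in> nbhd E D"
proof -
  obtain x where x: "x \<in> Cp m" "(x, w) \<in> E" "w \<notin> Cp m" using assms unfolding nbhd_def by blast
  then obtain D where D: "D \<in> parts" "nbhd E D = {y ((m + 1) div 2), y ((m + 2) div 2)}" "x \<in> D" "w \<notin> D"
    unfolding Cp_def by blast
  show ?thesis using that[OF D(1,2) nbI[OF D(4,3) x(2)]] .
qed

lemma Cp_disjoint:
  assumes "m \<le> 2*k" "m' \<le> 2*k" "m \<noteq> m'"
  shows "Cp m \<inter> Cp m' = {}" "nbhd E (Cp m) \<inter> Cp m' = {}"
proof -
  have D: "D \<inter> D' = {} \<and> nbhd E D \<inter> D' = {}"
    if "D \<in> parts" "D' \<in> parts" "nbhd E D = {y ((m + 1) div 2), y ((m + 2) div 2)}"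
      "nbhd E D' = {y ((m' + 1) div 2), y ((m' + 2) div 2)}" for D D'
  proof -
    have "D \<noteq> D'" using attachments_unique[OF assms(1,2)] assms(3) that(3,4) by auto
    then show ?thesis
      using comps_disjoint[OF _ _ sym, of D _ D'] parts_props(1)[OF that(2)] parts_props(3)[OF that(1)] that(1,2)
      unfolding parts_def by blast
  qed
  then show "Cp m \<inter> Cp m' = {}" unfolding Cp_def by blast
  show "nbhd E (Cp m) \<inter> Cp m' = {}"
  proof (rule ccontr)
    assume "\<not> ?thesis"
    then obtain w where "w \<in> nbhd E (Cp m)" "w \<in> Cp m'" by blast
    then obtain D' where D': "D' \<in> parts" "nbhd E D' = {y ((m' + 1) div 2), y ((m' + 2) div 2)}" "w \<in> D'"
      unfolding Cp_def by blast
    obtain A where A: "A \<in> parts" "nbhd E A = {y ((m + 1) div 2), y ((m + 2) div 2)}" "w \<in> nbhd E A"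
      using nbhd_CpE[OF \<open>w \<in> nbhd E (Cp m)\<close>] by blast
    show False using D[OF A(1) D'(1) A(2) D'(2)] A(3) D'(3) by blast
  qed
qed

lemma nbhd_Cp: "nbhd E (Cp m) \<subseteq> {y ((m + 1) div 2), y ((m + 2) div 2)}"
proof
  fix w assume "w \<in> nbhd E (Cp m)"
  then obtain D where "D \<in> parts" "nbhd E D = {y ((m + 1) div 2), y ((m + 2) div 2)}" "w \<in> nbhd E D"
    by (rule nbhd_CpE)
  then show "w \<in> {y ((m + 1) div 2), y ((m + 2) div 2)}" by blast
qed

lemma y_notin_Cp: "i \<le> Suc k \<Longrightarrow> y i \<notin> Cp m"
  using parts_props(5) unfolding Cp_def by fastforce

lemma edge_not_touch: "i \<le> k \<Longrightarrow> {(y i, y (Suc i)), (y (Suc i), y i)} \<inter> touch E (Cp m) = {}"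
  using y_notin_Cp[of i m] y_notin_Cp[of "Suc i" m] unfolding touch_def by auto

lemma chain_parts: "chain k y Fp Cp"
  unfolding chain_def
proof (intro conjI allI impI)
  show "inj_on y {1..k}"
  proof (rule inj_onI)
    fix i j assume "i \<in> {1..k}" "j \<in> {1..k}" "y i = y j"
    then show "i = j" using y_eq[of i j] by auto
  qed
  show "y 0 \<notin> y ` {1..k}" "y (Suc k) \<notin> y ` {1..k}"
    unfolding y_image y_0 y_Suc_k using uv_notin e(2) by auto
  fix m assume m: "m \<le> 2*k"
  have h: "m div 2 \<le> k" using m by simp
  show "Field (Fp m) \<subseteq> Cp m \<union> {y ((m + 1) div 2), y ((m + 2) div 2)}"
  proof (cases "even m")
    case True
    then have "(m + 1) div 2 = m div 2" "(m + 2) div 2 = Suc (m div 2)" by presburger+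
    then show ?thesis unfolding Fp_def using True Field_touch[of "Cp m"] nbhd_Cp[of m]
      by (auto simp: Field_Un Field_insert)
  next
    case False
    then show ?thesis unfolding Fp_def using Field_touch[of "Cp m"] nbhd_Cp[of m] by auto
  qed
  show "finite (Fp m)" unfolding Fp_def using finite_touch by simp
  show "sym (Fp m)" unfolding Fp_def using sym_touch[of "Cp m"] by (auto simp: sym_def)
  show "y i \<notin> Cp m" if "i \<le> Suc k" for i using y_notin_Cp that by blast
  fix m' assume m': "m' \<le> 2*k" "m \<noteq> m'"
  show "Cp m \<inter> Cp m' = {}" using Cp_disjoint m m' by blast
  have h': "m' div 2 \<le> k" using m' by simp
  have t: "touch E (Cp m) \<inter> touch E (Cp m') = {}"
    using touch_disjoint Cp_disjoint[OF m m'] by blast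
  have "{(y (m div 2), y (Suc (m div 2))), (y (Suc (m div 2)), y (m div 2))} \<inter>
    {(y (m' div 2), y (Suc (m' div 2))), (y (Suc (m' div 2)), y (m' div 2))} = {}" if "even m" "even m'"
  proof (rule ccontr)
    assume "\<not> ?thesis"
    then have "{y (m div 2), y (Suc (m div 2))} = {y (m' div 2), y (Suc (m' div 2))}" by auto
    moreover have "(m + 1) div 2 = m div 2" "(m + 2) div 2 = Suc (m div 2)"
      "(m' + 1) div 2 = m' div 2" "(m' + 2) div 2 = Suc (m' div 2)" using that by presburger+
    ultimately show False using attachments_unique[OF m m'(1)] m'(2) by simp
  qed
  then show "Fp m \<inter> Fp m' = {}"
    unfolding Fp_def using t edge_not_touch[OF h, of m'] edge_not_touch[OF h', of m] by auto
qed

text \<open>Here it matters that the ear is shortest, hence induced: every edge between two of its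
  vertices that touches \<open>C\<close> is an ear edge and belongs to some gadget.\<close>

lemma UN_Fp: "(\<Union>m\<le>2*k. Fp m) = touch E C"
proof
  have e: "(y i, y (Suc i)) \<in> touch E C" "(y (Suc i), y i) \<in> touch E C" if "i \<le> k" for i
  proof -
    have "y i \<in> set xs \<or> y (Suc i) \<in> set xs"
      using y_mem[of i] y_mem[of "Suc i"] that k_ge(1) by linarith
    then have "y i \<in> C \<or> y (Suc i) \<in> C" using e(2) by blast
    then show "(y i, y (Suc i)) \<in> touch E C" "(y (Suc i), y i) \<in> touch E C"
      using y_edge[OF that] edge_sym[OF y_edge[OF that]] unfolding touch_def by auto
  qed
  show "(\<Union>m\<le>2*k. Fp m) \<subseteq> touch E C"
  proof
    fix p assume "p \<in> (\<Union>m\<le>2*k. Fp m)"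
    then obtain m where m: "m \<le> 2*k" "p \<in> Fp m" by blast
    moreover have "touch E (Cp m) \<subseteq> touch E C" unfolding touch_def using Cp_sub by blast
    moreover have "m div 2 \<le> k" using m by simp
    ultimately show "p \<in> touch E C" unfolding Fp_def using e by (auto split: if_splits)
  qed
  \<comment> \<open>The exceptions for \<open>u = v\<close> are the first and last ear edges, seen
    under the other index of \<open>u\<close>.\<close>
  have ix: "i \<le> Suc k \<Longrightarrow> j \<le> Suc k \<Longrightarrow> i < j \<Longrightarrow> (y i, y j) \<in> E \<Longrightarrow> 1 \<le> i \<and> i \<le> k \<or> 1 \<le> j \<and> j \<le> k \<Longrightarrow>
     j = Suc i \<or> u = v \<and> (i = 0 \<and> j = k \<or> i = 1 \<and> j = Suc k)" for i j
  proof -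
    assume ij: "i \<le> Suc k" "j \<le> Suc k" "i < j" "(y i, y j) \<in> E" "1 \<le> i \<and> i \<le> k \<or> 1 \<le> j \<and> j \<le> k"
    consider "i = 0" "1 \<le> j" "j \<le> k" | "j = Suc k" "1 \<le> i" "i \<le> k" | "1 \<le> i" "j \<le> k" using ij by linarith
    then show ?thesis
    proof cases
      case 1
      then have "j - 1 = 0 \<or> u = v \<and> Suc (j - 1) = k"
        using ij(4) y_0 y_xs[of j] by (intro min_ear_first[OF xs _ _ sym]) auto
      then show ?thesis using 1 by auto
    next
      case 2
      then have "Suc (i - 1) = k \<or> u = v \<and> i - 1 = 0"
        using ij(4) y_Suc_k y_xs[of i] by (intro min_ear_last[OF xs _ _ sym]) auto
      then show ?thesis using 2 by auto
    next
      case 3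
      then have "j - 1 = Suc (i - 1)"
        using ij y_xs[of i] y_xs[of j] by (intro min_ear_chord[OF xs]) auto
      then show ?thesis using 3 ij by auto
    qed
  qed
  have sub: "(a, b) \<in> (\<Union>m\<le>2*k. Fp m) \<and> (b, a) \<in> (\<Union>m\<le>2*k. Fp m)"
    if "(a, b) \<in> E" "a \<in> C" for a b
  proof -
    have ba: "(b, a) \<in> E" by (rule edge_sym[OF that(1)])
    have edge: ?thesis if "i \<le> k" "a = y i \<and> b = y (Suc i) \<or> b = y i \<and> a = y (Suc i)" for i
    proof -
      have "(a, b) \<in> Fp (2 * i)" "(b, a) \<in> Fp (2 * i)" "2 * i \<le> 2 * k" unfolding Fp_def using that by auto
      then show ?thesis by blast
    qed
    have part: ?thesis if "a \<in> Cp m \<or> b \<in> Cp m" "m \<le> 2*k" for m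
    proof -
      have "(a, b) \<in> Fp m" "(b, a) \<in> Fp m" unfolding Fp_def touch_def using that \<open>(a, b) \<in> E\<close> ba by auto
      then show ?thesis using that(2) by blast
    qed
    show ?thesis
    proof (cases "a \<in> C - set xs \<or> b \<in> C - set xs")
      case True
      then have "\<exists>m\<le>2*k. a \<in> Cp m \<or> b \<in> Cp m" using UN_Cp by auto
      then show ?thesis using part by blast
    next
      case False
      then have "a \<in> set xs" using that by blast
      then obtain i where i: "1 \<le> i" "i \<le> k" "a = y i" using xs_y by blast
      have "\<exists>j\<le>Suc k. b = y j"
      proof (cases "b \<in> C")
        case True
        then show ?thesis using False xs_y[of b] le_Suc_eq by blast
      next
        case False
        then have "b \<in> nbhd E C" using that unfolding nbhd_def by blast
        then have "b = y 0 \<or> b = y (Suc k)" using C(3) y_0 y_Suc_k by auto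
        then show ?thesis by blast
      qed
      then obtain j where j: "j \<le> Suc k" "b = y j" by blast
      have "i \<noteq> j" using \<open>(a, b) \<in> E\<close> irr i(3) j(2) by auto
      then consider "i < j" | "j < i" by linarith
      then show ?thesis
      proof cases
        case 1
        then have "j = Suc i \<or> u = v \<and> i = 1 \<and> j = Suc k"
          using ix[of i j] i j \<open>(a, b) \<in> E\<close> by auto
        then show ?thesis
        proof
          assume "j = Suc i" then show ?thesis using edge[of i] i j by blast
        next
          assume "u = v \<and> i = 1 \<and> j = Suc k"
          then have "b = y 0" "a = y (Suc 0)" using j i y_0 y_Suc_k by auto
          then show ?thesis using edge[of 0] by blast
        qed
      next
        case 2
        then have "i = Suc j \<or> u = v \<and> j = 0 \<and> i = k"
          using ix[of j i] i j ba by auto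
        then show ?thesis
        proof
          assume "i = Suc j" then show ?thesis using edge[of j] i j by auto
        next
          assume "u = v \<and> j = 0 \<and> i = k"
          then have "a = y k" "b = y (Suc k)" using j i y_0 y_Suc_k by auto
          then show ?thesis using edge[of k] by blast
        qed
      qed
    qed
  qed
  show "touch E C \<subseteq> (\<Union>m\<le>2*k. Fp m)"
  proof (rule subrelI)
    fix a b assume "(a, b) \<in> touch E C"
    then have "(a, b) \<in> E" "a \<in> C \<or> b \<in> C" unfolding touch_def by auto
    then show "(a, b) \<in> (\<Union>m\<le>2*k. Fp m)" using sub[of a b] sub[of b a] edge_sym by blast
  qed
qed

text \<open>Constantly true beyond the ear, because \<open>admissible\<close> speaks about all
  indices. The same holds for \<open>Qp\<close>.\<close>

definition Pp where "Pp i = (if i \<le> k then edge_part E (y i) (y (Suc i)) (Cp (2 * i)) else (\<lambda>_ _ _ _. True))"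

definition Qp where "Qp i = (if 1 \<le> i \<and> i \<le> k then vertex_part E (y i) (Cp (2 * i - 1)) else (\<lambda>_ _. True))"

lemma fits: "edge_fits k y Fp Cp Pp" "vert_fits k y Fp Cp Qp"
proof -
  show "edge_fits k y Fp Cp Pp"
    unfolding edge_fits_def
  proof (intro allI impI)
    fix i c c' a b s t col
    assume i: "i \<le> k" and *: "Pp i c c' a b" "c \<noteq> c'" "s + t = (1::nat)" "col (y i) = c" "col (y (Suc i)) = c'"
    let ?e = "{(y i, y (Suc i)), (y (Suc i), y i)}"
    have 1: "feasible (touch E (Cp (2*i))) (Cp (2*i)) col (contr (y i) a (y (Suc i)) b)"
      using * i unfolding Pp_def edge_part_def by simp
    have ne: "y i \<noteq> y (Suc i)" using y_edge[OF i] irr by metis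
    have 2: "feasible ?e {} col (contr (y i) s (y (Suc i)) t)"
      using feasible_edge[OF ne, of col s t] * unfolding contr_def[abs_def] by simp
    have "feasible (touch E (Cp (2*i)) \<union> ?e) (Cp (2*i) \<union> {}) col
      (\<lambda>x. contr (y i) a (y (Suc i)) b x + contr (y i) s (y (Suc i)) t x)"
    proof (rule feasible_Un[OF 1 2 finite_touch _ sym_touch])
      show "touch E (Cp (2*i)) \<inter> ?e = {}" using edge_not_touch[OF i] by blast
      have "Field ?e = {y i, y (Suc i)}" by auto
      then show "Field ?e \<inter> Cp (2*i) = {}" using y_notin_Cp[of i] y_notin_Cp[of "Suc i"] i by simp
    qed (auto simp: sym_def)
    moreover have "(\<lambda>x. contr (y i) a (y (Suc i)) b x + contr (y i) s (y (Suc i)) t x) =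
      contr (y i) (s + a) (y (Suc i)) (t + b)" unfolding contr_def by auto
    ultimately show "feasible (Fp (2*i)) (Cp (2*i)) col (contr (y i) (s + a) (y (Suc i)) (t + b))"
      unfolding Fp_def by simp
  qed
  show "vert_fits k y Fp Cp Qp"
    unfolding vert_fits_def
  proof (intro ballI allI impI)
    fix i c q col assume "i \<in> {1..k}" "Qp i c q" "col (y i) = c"
    moreover then have "odd (2 * i - 1)" by simp
    ultimately show "feasible (Fp (2*i-1)) (Cp (2*i-1)) col (contr (y i) q (y i) 0)"
      unfolding Fp_def Qp_def vertex_part_def by simp
  qed
qed

definition Pr where "Pr i c c' a b = Pp (k - i) c' c b a"
definition Qr where "Qr i = Qp (Suc k - i)"

lemma mirror_parts: "mirror k Pp Qp Pr Qr"
  unfolding mirror_def Pr_def Qr_def by simp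

lemma parts_ok:
  assumes IH_E: "\<And>D p q. conn E D \<Longrightarrow> finite D \<Longrightarrow> card D < card C \<Longrightarrow> nbhd E D = {p, q} \<Longrightarrow> (p, q) \<in> E \<Longrightarrow>
      edge_ok (edge_part E p q D)"
    and IH_V: "\<And>D p. conn E D \<Longrightarrow> finite D \<Longrightarrow> card D < card C \<Longrightarrow> nbhd E D = {p} \<Longrightarrow> vert_ok (vertex_part E p D)"
  shows "mirrored Pp Qp k Pr Qr"
proof -
  have fD: "finite D" if "D \<in> parts" for D
    using parts_props(1)[OF that] C(2) by (meson Diff_subset finite_subset)
  have ok: "edge_ok (Pp i)" for i
  proof (cases "i \<le> k")
    case True
    have "edge_ok (edge_part E (y i) (y (Suc i)) (Cp (2*i)))"
      unfolding Cp_def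
    proof (rule edge_ok_Union[of _ "C - set xs"])
      fix D assume D: "D \<in> {D \<in> parts. nbhd E D = {y ((2*i + 1) div 2), y ((2*i + 2) div 2)}}"
      then show "edge_ok (edge_part E (y i) (y (Suc i)) D)"
        using parts_props[of D] fD[of D] y_edge[OF True] by (intro IH_E) auto
    qed (use finite_parts in \<open>auto simp: parts_def\<close>)
    then show ?thesis using True unfolding Pp_def by simp
  next
    case False
    then show ?thesis unfolding Pp_def edge_ok_def by simp
  qed
  have okV: "vert_ok (Qp i)" for i
  proof (cases "1 \<le> i \<and> i \<le> k")
    case True
    have d: "(2*i - 1 + 1) div 2 = i" "(2*i - 1 + 2) div 2 = i" using True by presburger+
    have "vert_ok (vertex_part E (y i) (Cp (2*i - 1)))"
      unfolding Cp_def d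
    proof (rule vert_ok_Union[of _ "C - set xs"])
      fix D assume D: "D \<in> {D \<in> parts. nbhd E D = {y i, y i}}"
      then show "vert_ok (vertex_part E (y i) D)"
        using parts_props[of D] fD[of D] by (intro IH_V) auto
    qed (use finite_parts in \<open>auto simp: parts_def\<close>)
    then show ?thesis using True unfolding Qp_def by simp
  next
    case False
    then show ?thesis unfolding Qp_def vert_ok_def by auto
  qed
  have "admissible Pp Qp" unfolding admissible_def using ok okV by blast
  moreover have "admissible Pr Qr"
    unfolding admissible_def
  proof (intro conjI allI)
    show "edge_ok (Pr i)" for i
      using edge_ok_swap[OF ok[of "k - i"]] unfolding Pr_def[abs_def] .
    show "vert_ok (Qr i)" for i using okV unfolding Qr_def by simp
  qed
  ultimately show ?thesis
    unfolding mirrored_def mirrored_axioms_def using mirror_parts by blast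
qed

lemma sol_EP:
  assumes "sol k Pp Qp Pr Qr c c' a b"
  shows "edge_part E u v C c c' a b"
  unfolding edge_part_def
proof (intro allI impI)
  fix col assume "col u = c" "col v = c'"
  then have "feasible (\<Union>n\<le>2*k. Fp n) ((\<Union>n\<le>2*k. Cp n) \<union> y ` {1..k}) col (contr (y 0) a (y (Suc k)) b)"
    using y_0 y_Suc_k by (intro sol_feas[OF chain_parts fits mirror_parts assms]) auto
  moreover have "(\<Union>n\<le>2*k. Cp n) \<union> y ` {1..k} = C" using UN_Cp y_image e(2) by auto
  ultimately show "feasible (touch E C) C col (contr u a v b)" using UN_Fp y_0 y_Suc_k by simp
qed

end

section \<open>The induction\<close>

lemma edge_ok_mono: "edge_ok P \<Longrightarrow> (\<And>c c' a b. P c c' a b \<Longrightarrow> P' c c' a b) \<Longrightarrow> edge_ok P'"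
  unfolding edge_ok_def by blast

text \<open>\<open>cyclic\<close> is what tree-freeness contributes: each non-isolated vertex lies
  on a cycle, expressed by an incident edge whose ends stay connected without it.\<close>

locale class_graph = sgraph +
  assumes no_theta: "no_theta E"
    and triangle: "(x, y) \<in> E \<Longrightarrow> (y, z) \<in> E \<Longrightarrow> (z, x) \<notin> E"
    and cyclic: "w \<in> Field E \<Longrightarrow> \<exists>y. (w, y) \<in> E \<and> (y, w) \<in> (E - {(w, y), (y, w)})\<^sup>*"
begin

text \<open>The third clause goes beyond \<open>vert_ok\<close>: a piece joined to \<open>v\<close>
  by a cycle can supply two arcs already at in-degree 3. The vertex below a bridge needs
  this.\<close>

definition good where
  "good C \<longleftrightarrow> (\<forall>p q. nbhd E C = {p, q} \<and> (p, q) \<in> E \<longrightarrow> edge_ok (edge_part E p q C)) \<and>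
     (\<forall>v. nbhd E C = {v} \<longrightarrow> vert_ok (vertex_part E v C)) \<and>
     (\<forall>v x y. nbhd E C = {v} \<and> x \<in> C \<and> y \<in> C \<and> x \<noteq> y \<and> (v, x) \<in> E \<and> (v, y) \<in> E \<longrightarrow> vertex_part E v C 3 2)"

lemma ear_graphI:
  assumes "conn E C" "finite C" "nbhd E C = {u, v}" "u \<noteq> v \<Longrightarrow> (u, v) \<in> E" "ear E C u v xs"
  obtains ys where "ear_graph E C u v ys"
proof -
  obtain ys where "min_ear E C u v ys" using ex_min_ear[OF assms(5)] by blast
  then have "ear_graph E C u v ys"
    by (intro ear_graph.intro sgraph_axioms ear_graph_axioms.intro no_theta assms(1-4)) (erule (1) triangle)
  then show ?thesis using that by blast
qed

lemma mirroredI: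
  assumes g: "\<And>D. conn E D \<Longrightarrow> finite D \<Longrightarrow> card D < card C \<Longrightarrow> good D" and e: "ear_graph E C u v xs"
  shows "mirrored (ear_graph.Pp E C u v xs) (ear_graph.Qp E C u v xs) (length xs)
    (ear_graph.Pr E C u v xs) (ear_graph.Qr E C u v xs)"
  by (rule ear_graph.parts_ok[OF e]) (use g in \<open>auto simp: good_def\<close>)

lemma good_open:
  assumes g: "\<And>D. conn E D \<Longrightarrow> finite D \<Longrightarrow> card D < card C \<Longrightarrow> good D"
    and C: "conn E C" "finite C" "nbhd E C = {u, v}" "(u, v) \<in> E"
  shows "edge_ok (edge_part E u v C)"
proof -
  have ne: "u \<noteq> v" using C(4) irr by blast
  obtain x y where x: "x \<in> C" "(x, u) \<in> E" and y: "y \<in> C" "(y, v) \<in> E"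
    using C(3) unfolding nbhd_def by blast
  obtain xs where "xs \<noteq> []" "hd xs = x" "last xs = y" "set xs \<subseteq> C" "successively (\<lambda>a b. (a, b) \<in> E) xs"
    using conn_walk[OF C(1) x(1) y(1)] by blast
  then have "ear E C u v xs" unfolding ear_def using x y ne edge_sym by auto
  then obtain ys where e: "ear_graph E C u v ys" using ear_graphI[OF C(1-3)] C(4) by blast
  show ?thesis
    by (rule edge_ok_mono[OF edge_ok_sol[OF mirroredI[OF g e] ear_graph.k_ge(1)[OF e]]
          ear_graph.sol_EP[OF e]])
qed

text \<open>Both ends of the ear are \<open>v\<close>, so the numbers at the two ends are added: 1 +
  0 gives the single arc at in-degree 3, and 1 + 1 the two arcs at 3 and 4.\<close>

lemma good_closed:
  assumes g: "\<And>D. conn E D \<Longrightarrow> finite D \<Longrightarrow> card D < card C \<Longrightarrow> good D"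
    and C: "conn E C" "finite C" "nbhd E C = {v}"
    and xy: "x \<in> C" "y \<in> C" "x \<noteq> y" "(v, x) \<in> E" "(v, y) \<in> E"
  shows "vert_ok (vertex_part E v C)" "vertex_part E v C 3 2"
proof -
  obtain xs where "xs \<noteq> []" "hd xs = x" "last xs = y" "set xs \<subseteq> C" "successively (\<lambda>a b. (a, b) \<in> E) xs"
    using conn_walk[OF C(1) xy(1,2)] by blast
  then have "ear E C v v xs" unfolding ear_def using xy edge_sym by auto
  moreover have nbhd: "nbhd E C = {v, v}" using C(3) by simp
  ultimately obtain ys where e: "ear_graph E C v v ys" using ear_graphI[OF C(1,2)] by blast
  interpret M: mirrored "ear_graph.Pp E C v v ys" "ear_graph.Qp E C v v ys" "length ys"
    "ear_graph.Pr E C v v ys" "ear_graph.Qr E C v v ys"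
    by (rule mirroredI[OF g e])
  have k: "3 \<le> length ys" "2 \<le> length ys" using ear_graph.k_ge[OF e] by auto
  have "contr v a v b = contr v (a + b) v 0" for a b unfolding contr_def by auto
  then have *: "vertex_part E v C c (a + b)"
    if "sol (length ys) (ear_graph.Pp E C v v ys) (ear_graph.Qp E C v v ys)
      (ear_graph.Pr E C v v ys) (ear_graph.Qr E C v v ys) c c a b" for c a b
    using ear_graph.sol_EP[OF e that] unfolding vertex_part_def edge_part_def by metis
  have 1: "vertex_part E v C c 0" if "c \<noteq> 2" for c using *[OF M.sol_closed[OF k(1) that]] by simp
  have 2: "vertex_part E v C 3 1" using *[OF M.sol_31[OF k(2), of 3]] by simp
  have 3: "vertex_part E v C c 2" if "3 \<le> c" for c using *[OF M.sol_11[OF k(2) that]] by (simp add: numeral_2_eq_2)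
  show "vert_ok (vertex_part E v C)" unfolding vert_ok_def using 1 2 3[of 4] by simp
  show "vertex_part E v C 3 2" using 3 by simp
qed

text \<open>Connectedness of \<open>C\<close> makes every component of the rest adjacent to
  \<open>w\<close>, and \<open>cl\<close> leaves it no other neighbour. Applied with
  \<open>w\<close> as the lower end of a bridge and as a root.\<close>

lemma cut_comps:
  assumes C: "conn E C" "finite C" and w: "w \<in> C"
    and cl: "\<forall>x\<in>C - {w}. \<forall>z. (x, z) \<in> E \<longrightarrow> z \<in> C"
    and D: "D \<in> comps E (C - {w})"
  shows "nbhd E D = {w}" "conn E D" "finite D" "card D < card C"
proof -
  have s: "D \<subseteq> C - {w}" by (rule comps_subset[OF D sym])
  show cD: "conn E D" by (rule comps_conn[OF D sym])
  have sub: "nbhd E D \<subseteq> {w}"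
  proof
    fix z assume z: "z \<in> nbhd E D"
    then obtain x where "x \<in> D" "(x, z) \<in> E" unfolding nbhd_def by blast
    then have "z \<in> C" using s cl by blast
    then show "z \<in> {w}" using comps_nb[OF D sym] z by blast
  qed
  have "w \<in> nbhd E D"
  proof (rule ccontr)
    assume no: "w \<notin> nbhd E D"
    have "D = C"
    proof (rule conn_closed[OF C(1)])
      show "D \<subseteq> C" "D \<noteq> {}" using s cD unfolding conn_def by auto
      fix x y assume "x \<in> D" "(x, y) \<in> E"
      then show "y \<in> D" using no sub nbI[of y D x E] by blast
    qed
    then show False using s w by blast
  qed
  then show "nbhd E D = {w}" using sub by blast
  show "finite D" using s C(2) finite_subset by blast
  have "D \<subset> C" using s w by blast
  then show "card D < card C" by (rule psubset_card_mono[OF C(2)])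
qed

text \<open>
  The bridge is directed from \<open>v\<close> to \<open>w\<close>. This works with in-degree 1 at \<open>w\<close> unless \<open>v\<close> has in-degree 1;
  then a component that is joined to \<open>w\<close> by a cycle sends two further arcs into \<open>w\<close>.
\<close>

lemma good_bridge:
  assumes g: "\<And>D. conn E D \<Longrightarrow> finite D \<Longrightarrow> card D < card C \<Longrightarrow> good D"
    and C: "conn E C" "finite C" "nbhd E C = {v}"
    and uniq: "\<And>x y. x \<in> C \<Longrightarrow> y \<in> C \<Longrightarrow> (v, x) \<in> E \<Longrightarrow> (v, y) \<in> E \<Longrightarrow> x = y"
  shows "vertex_part E v C c 0"
proof -
  obtain w where w: "w \<in> C" "(w, v) \<in> E" using C(3) unfolding nbhd_def by blast
  have vw: "(v, w) \<in> E" by (rule edge_sym[OF w(2)])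
  have vC: "v \<notin> C" using C(3) unfolding nbhd_def by blast
  have wu: "x = w" if "x \<in> C" "(v, x) \<in> E" for x using uniq[OF that(1) w(1) that(2) vw] .
  have out: "z = v" if "x \<in> C" "(x, z) \<in> E" "z \<notin> C" for x z
    using nbI[OF that(3,1,2)] C(3) by blast
  have "z \<in> C" if "x \<in> C" "x \<noteq> w" "(x, z) \<in> E" for x z
    using out[OF that(1,3)] wu[OF that(1)] edge_sym[OF that(3)] that(2) by blast
  then have cl: "\<forall>x\<in>C - {w}. \<forall>z. (x, z) \<in> E \<longrightarrow> z \<in> C" by blast
  note D = cut_comps[OF C(1,2) w(1) cl]
  define \<D> where "\<D> = comps E (C - {w})"
  have U: "\<Union>\<D> = C - {w}" unfolding \<D>_def by (rule Union_comps)
  have fD: "finite \<D>" unfolding \<D>_def using C(2) by (intro finite_comps) simp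
  have gD: "good A" if "A \<in> \<D>" for A using g D(2-4)[where D=A] that unfolding \<D>_def by blast
  have vD: "vert_ok (vertex_part E w A)" if "A \<in> \<D>" for A
    using gD[OF that] D(1)[where D=A] that unfolding \<D>_def good_def by blast
  have vU: "vert_ok (vertex_part E w (\<Union>\<A>))" if "\<A> \<subseteq> \<D>" for \<A>
    using that finite_subset[OF that fD] vD unfolding \<D>_def by (intro vert_ok_Union) auto
  obtain y where y: "(w, y) \<in> E" "(y, w) \<in> (E - {(w, y), (y, w)})\<^sup>*"
    using cyclic[of w] FieldI1[OF w(2)] by blast
  let ?R = "E - {(w, y), (y, w)}"
  \<comment> \<open>If \<open>y\<close> were \<open>v\<close>, the deleted edge would be the only
    one between \<open>v\<close> and \<open>C\<close>, and no walk from \<open>v\<close> could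
    return to \<open>w\<close>.\<close>
  have yC: "y \<in> C"
  proof (rule ccontr)
    assume "y \<notin> C"
    then have "y = v" using out[OF w(1) y(1)] by blast
    have "z \<notin> C" if "(v, z) \<in> ?R\<^sup>*" for z
      using that
    proof induction
      case base
      then show ?case by (rule vC)
    next
      case (step a b)
      show ?case
      proof
        assume "b \<in> C"
        have ab: "(a, b) \<in> E" using step by blast
        then have "a = v" using out[OF \<open>b \<in> C\<close> edge_sym[OF ab] step.IH] by blast
        moreover then have "b = w" using wu \<open>b \<in> C\<close> ab by blast
        ultimately show False using step.hyps \<open>y = v\<close> by blast
      qed
    qed
    then show False using y(2) w(1) \<open>y = v\<close> by blast
  qed
  moreover have "y \<noteq> w" using y(1) irr by blast
  ultimately obtain A where A: "A \<in> \<D>" "y \<in> A" using U by blast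
  have nbA: "nbhd E A = {w}" using D(1)[where D=A] A(1) unfolding \<D>_def by blast
  have wA: "w \<notin> A" using nbA unfolding nbhd_def by blast
  \<comment> \<open>A cycle through \<open>wy\<close> enters and leaves \<open>A\<close> only via
    \<open>w\<close>, so it returns through a second neighbour of \<open>w\<close> in
    \<open>A\<close>.\<close>
  have "\<exists>x\<in>A. x \<noteq> y \<and> (w, x) \<in> E"
  proof (rule ccontr)
    assume no: "\<not> ?thesis"
    have "z \<in> A" if "(y, z) \<in> ?R\<^sup>*" for z
      using that
    proof induction
      case base
      then show ?case by (rule A(2))
    next
      case (step a b)
      show ?case
      proof (rule ccontr)
        assume "b \<notin> A"
        have ab: "(a, b) \<in> E" using step by blast
        then have "b = w" using nbI[OF \<open>b \<notin> A\<close> step.IH] nbA by blast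
        moreover then have "a = y" using no step.IH edge_sym[OF ab] by blast
        ultimately show False using step.hyps by blast
      qed
    qed
    then show False using y(2) wA by blast
  qed
  then have A32: "vertex_part E w A 3 2"
    using gD[OF A(1)] nbA A(2) y(1) unfolding good_def by blast
  have "vert_ok (vertex_part E w (\<Union>(\<D> - {A})))" by (rule vU) blast
  then have "vertex_part E w (\<Union>(\<D> - {A})) 3 0" unfolding vert_ok_def by simp
  moreover have "A \<inter> \<Union>(\<D> - {A}) = {}" "nbhd E A \<inter> \<Union>(\<D> - {A}) = {}"
    by (rule comps_sep[of A _ "C - {w}"]; use A(1) in \<open>auto simp: \<D>_def\<close>)+
  ultimately have "vertex_part E w (A \<union> \<Union>(\<D> - {A})) 3 (2 + 0)" by (intro vertex_part_Un[OF A32])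
  moreover have "A \<union> \<Union>(\<D> - {A}) = C - {w}" using U A(1) by blast
  ultimately have U32: "vertex_part E w (C - {w}) 3 2" by simp
  have U10: "vertex_part E w (C - {w}) 1 0" using vU[of \<D>] U unfolding vert_ok_def by simp
  define cw q where "cw = (if c = 1 then 3 else 1::nat)" and "q = (if c = 1 then 2 else 0::nat)"
  have Uq: "vertex_part E w (C - {w}) cw q" and cw: "cw \<noteq> c" "cw = q + 1" "q + 1 \<le> 4"
    unfolding cw_def q_def using U32 U10 by auto
  have vwne: "v \<noteq> w" using vC w(1) by blast
  show ?thesis
    unfolding vertex_part_def
  proof (intro allI impI)
    fix col assume col: "col v = c"
    let ?col = "col(w := cw)" and ?e = "{(v, w), (w, v)}"
    have 1: "feasible (touch E (C - {w})) (C - {w}) ?col (contr w q w 0)"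
      using Uq unfolding vertex_part_def by simp
    have 2: "feasible ?e {} ?col (contr v 0 w 1)"
      using feasible_edge[OF vwne, of ?col 0 1] col cw vwne unfolding contr_def[abs_def] by auto
    have "feasible (touch E (C - {w}) \<union> ?e) ((C - {w}) \<union> {}) ?col (\<lambda>x. contr w q w 0 x + contr v 0 w 1 x)"
    proof (rule feasible_Un[OF 1 2 finite_touch _ sym_touch])
      show "touch E (C - {w}) \<inter> ?e = {}" unfolding touch_def using vC by auto
      have "Field ?e = {v, w}" by auto
      then show "Field ?e \<inter> (C - {w}) = {}" using vC by auto
    qed (auto simp: sym_def)
    then have "feasible (touch E (C - {w}) \<union> ?e) (insert w (C - {w})) ?col
        (\<lambda>x. contr w q w 0 x + contr v 0 w 1 x)"
      using cw vwne by (intro feasible_absorb) (auto simp: contr_def)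
    moreover have "insert w (C - {w}) = C" using w(1) by blast
    moreover have "touch E (C - {w}) \<union> ?e = touch E C"
    proof
      show "touch E (C - {w}) \<union> ?e \<subseteq> touch E C" unfolding touch_def using w vw by auto
      show "touch E C \<subseteq> touch E (C - {w}) \<union> ?e"
      proof (rule subrelI)
        fix a b assume "(a, b) \<in> touch E C"
        then have ab: "(a, b) \<in> E" "a \<in> C \<or> b \<in> C" unfolding touch_def by auto
        have "a \<noteq> b" using ab(1) irr by blast
        show "(a, b) \<in> touch E (C - {w}) \<union> ?e"
        proof (cases "a \<in> C - {w} \<or> b \<in> C - {w}")
          case True
          then show ?thesis using ab unfolding touch_def by auto
        next
          case False
          then have "a = w \<and> b \<notin> C \<or> b = w \<and> a \<notin> C" using ab(2) \<open>a \<noteq> b\<close> w(1) by blast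
          then show ?thesis using out[OF w(1), of a] out[OF w(1), of b] ab(1) edge_sym by blast
        qed
      qed
    qed
    ultimately have 3: "feasible (touch E C) C ?col (\<lambda>x. contr w q w 0 x + contr v 0 w 1 x)" by simp
    show "feasible (touch E C) C col (contr v 0 v 0)"
    proof (rule feasible_cong[OF 3])
      fix x assume "x \<notin> C"
      then have "x \<noteq> w" using w(1) by blast
      then show "contr w q w 0 x + contr v 0 w 1 x = contr v 0 v 0 x" "?col x = col x"
        unfolding contr_def by auto
    qed
  qed
qed

theorem all_good: "conn E C \<Longrightarrow> finite C \<Longrightarrow> good C"
proof (induction "card C" arbitrary: C rule: less_induct)
  case less
  have g: "good D" if "conn E D" "finite D" "card D < card C" for D using less.hyps that by blast
  have v: "vert_ok (vertex_part E v C)" if nbhd: "nbhd E C = {v}" for v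
  proof (cases "\<exists>x y. x \<in> C \<and> y \<in> C \<and> x \<noteq> y \<and> (v, x) \<in> E \<and> (v, y) \<in> E")
    case True
    then show ?thesis using good_closed(1)[OF g less.prems nbhd] by blast
  next
    case False
    have "vertex_part E v C c 0" for c by (rule good_bridge[OF g less.prems nbhd]) (use False in blast)+
    then show ?thesis unfolding vert_ok_def by blast
  qed
  show ?case
    unfolding good_def
    using good_open[OF g less.prems] good_closed(2)[OF g less.prems] v by blast
qed

text \<open>The root gets in-degree 0, at which every piece that satisfies \<open>vert_ok\<close>
  can refrain from sending arcs; the prescribed value is thus met at once.\<close>

lemma component_feas:
  assumes C: "conn E C" "finite C" "nbhd E C = {}"
  shows "feasible (touch E C) C col (\<lambda>_. 0)"
proof -
  obtain r where r: "r \<in> C" using C(1) unfolding conn_def by blast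
  have cl: "\<forall>x\<in>C - {r}. \<forall>z. (x, z) \<in> E \<longrightarrow> z \<in> C"
    using nbI[of _ C _ E] C(3) by blast
  note D = cut_comps[OF C(1,2) r cl]
  have "vert_ok (vertex_part E r (\<Union>(comps E (C - {r}))))"
  proof (rule vert_ok_Union[OF _ order_refl])
    show "finite (comps E (C - {r}))" using C(2) by (intro finite_comps) simp
    fix A assume "A \<in> comps E (C - {r})"
    then show "vert_ok (vertex_part E r A)" using all_good[of A] D[where D=A] unfolding good_def by blast
  qed
  then have "vertex_part E r (C - {r}) 0 0" unfolding Union_comps vert_ok_def by simp
  then have "feasible (touch E (C - {r})) (C - {r}) (col(r := 0)) (\<lambda>_. 0)"
    unfolding vertex_part_def contr_0 by simp
  then have "feasible (touch E (C - {r})) (insert r (C - {r})) (col(r := 0)) (\<lambda>_. 0)"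
    by (rule feasible_absorb) auto
  moreover have "insert r (C - {r}) = C" using r by blast
  moreover have "touch E (C - {r}) = touch E C"
  proof
    show "touch E (C - {r}) \<subseteq> touch E C" unfolding touch_def by auto
    show "touch E C \<subseteq> touch E (C - {r})"
    proof (rule subrelI)
      fix a b assume "(a, b) \<in> touch E C"
      then have ab: "(a, b) \<in> E" "a \<in> C \<or> b \<in> C" unfolding touch_def by auto
      then have "a \<in> C" "b \<in> C" using nbI[of a C b E] nbI[of b C a E] C(3) edge_sym[OF ab(1)] by blast+
      moreover have "a \<noteq> b" using ab(1) irr by blast
      ultimately show "(a, b) \<in> touch E (C - {r})" using ab(1) unfolding touch_def by auto
    qed
  qed
  ultimately have "feasible (touch E C) C (col(r := 0)) (\<lambda>_. 0)" by simp
  then show ?thesis by (rule feasible_cong) (use r in auto)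
qed

lemma components_feas:
  assumes "finite \<D>" "\<D> \<subseteq> comps E V" "finite V" "E \<subseteq> V \<times> V"
  shows "feasible (touch E (\<Union>\<D>)) (\<Union>\<D>) col (\<lambda>_. 0)"
  using assms(1,2)
proof (induction \<D>)
  case empty
  then show ?case using feasible_empty by (simp add: touch_def)
next
  case (insert D \<D>)
  have "nbhd E D \<subseteq> V" using assms(4) unfolding nbhd_def by blast
  then have nbD: "nbhd E D = {}" using comps_nb[OF _ sym, of D V] insert.prems by blast
  have "conn E D" "finite D"
    using comps_conn[OF _ sym, of D V] comps_subset[OF _ sym, of D V] insert.prems assms(3) finite_subset
    by blast+
  then have "feasible (touch E D) D col (\<lambda>_. 0)" using component_feas nbD by blast
  moreover have "feasible (touch E (\<Union>\<D>)) (\<Union>\<D>) col (\<lambda>_. 0)" using insert by blast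
  ultimately have "feasible (touch E (D \<union> \<Union>\<D>)) (D \<union> \<Union>\<D>) col (\<lambda>x. 0 + 0)"
    by (rule feasible_touch_Un[OF _ _ comps_sep[OF insert.prems insert.hyps(2)]])
  then show ?case by simp
qed

theorem orientation_exists:
  assumes "finite V" "E \<subseteq> V \<times> V"
  shows "\<exists>A. orients A E \<and> (\<forall>x\<in>V. indeg A x \<le> 4) \<and> (\<forall>(x, y)\<in>E. indeg A x \<noteq> indeg A y)"
proof -
  have "feasible (touch E V) V (\<lambda>_. 0) (\<lambda>_. 0)"
    using components_feas[OF finite_comps[OF assms(1)] order_refl assms] unfolding Union_comps .
  moreover have "touch E V = E" using assms(2) unfolding touch_def by auto
  ultimately obtain A f where "orients A E" "\<forall>x\<in>V. indeg A x \<le> 4 \<and> f x = indeg A x" "\<forall>(x, y)\<in>E. f x \<noteq> f y"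
    unfolding feasible_def by auto
  then show ?thesis using assms(2) by (intro exI[of _ A]) fastforce
qed

end

section \<open>Theta curves\<close>

lemma closure_inside:
  fixes S :: "complex set"
  assumes "closed S" "F \<subseteq> inside S" "w \<in> closure F" "w \<notin> S"
  shows "w \<in> inside S"
proof -
  have "F \<inter> outside S = {}" using assms(2) inside_Int_outside by blast
  then have "closure F \<inter> outside S = {}"
    using open_Int_closure_eq_empty[OF open_outside[OF assms(1)], of F] by (simp add: Int_commute)
  then show ?thesis using assms(3,4) inside_Un_outside[of S] by blast
qed

lemma closure_outside:
  fixes S :: "complex set"
  assumes "closed S" "F \<subseteq> outside S" "w \<in> closure F" "w \<notin> S"
  shows "w \<in> outside S"
proof -
  have "F \<inter> inside S = {}" using assms(2) inside_Int_outside by blast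
  then have "closure F \<inter> inside S = {}"
    using open_Int_closure_eq_empty[OF open_inside[OF assms(1)], of F] by (simp add: Int_commute)
  then show ?thesis using assms(3,4) inside_Un_outside[of S] by blast
qed

lemma connected_inside_or_outside:
  fixes S :: "complex set"
  assumes "closed S" "topological_space_class.connected F" "F \<inter> S = {}"
  shows "F \<subseteq> inside S \<or> F \<subseteq> outside S"
proof -
  have "inside S \<inter> F = {} \<or> outside S \<inter> F = {}"
  proof (rule connectedD[OF assms(2) open_inside[OF assms(1)] open_outside[OF assms(1)]])
    show "inside S \<inter> outside S \<inter> F = {}" by simp
    show "F \<subseteq> inside S \<union> outside S" using assms(3) inside_Un_outside[of S] by blast
  qed
  then show ?thesis using assms(3) inside_Un_outside[of S] by blast
qed

definition theta where
  "theta a b c1 c2 c3 \<longleftrightarrow> (\<forall>c\<in>{c1, c2, c3}. arc c \<and> pathstart c = a \<and> pathfinish c = b) \<and>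
     path_image c1 \<inter> path_image c2 = {a, b} \<and> path_image c1 \<inter> path_image c3 = {a, b} \<and>
     path_image c2 \<inter> path_image c3 = {a, b}"

text \<open>Since \<open>w3\<close> is in the closure of \<open>F\<close>, the third arc runs inside
  the curve of the other two and splits its inside. \<open>F\<close> lies in one half, and the
  closure of that half misses the interior of \<open>c1\<close> or of \<open>c2\<close>.\<close>

lemma theta_inside:
  fixes c1 c2 c3 :: "real \<Rightarrow> complex"
  assumes t: "theta a b c1 c2 c3" and F: "topological_space_class.connected F" "F \<noteq> {}"
    and dis: "F \<inter> (path_image c1 \<union> path_image c2 \<union> path_image c3) = {}"
    and w: "w1 \<in> path_image c1 - {a, b}" "w2 \<in> path_image c2 - {a, b}" "w3 \<in> path_image c3 - {a, b}"
    and cl: "w1 \<in> closure F" "w2 \<in> closure F" "w3 \<in> closure F"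
  shows "\<not> F \<subseteq> inside (path_image c1 \<union> path_image c2)"
proof
  assume ins: "F \<subseteq> inside (path_image c1 \<union> path_image c2)"
  have arcs: "arc c1" "arc c2" "arc c3" and ends: "pathstart c1 = a" "pathstart c2 = a" "pathstart c3 = a"
    "pathfinish c1 = b" "pathfinish c2 = b" "pathfinish c3 = b"
    and int: "path_image c1 \<inter> path_image c2 = {a, b}" "path_image c1 \<inter> path_image c3 = {a, b}"
    "path_image c2 \<inter> path_image c3 = {a, b}"
    using t unfolding theta_def by auto
  have ab: "a \<noteq> b" using arcs(1) ends arc_distinct_ends by blast
  have closed: "closed (path_image c1)" "closed (path_image c2)" "closed (path_image c3)"
    using arcs by (simp_all add: closed_arc_image)
  have "w3 \<in> inside (path_image c1 \<union> path_image c2)"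
    by (rule closure_inside[OF _ ins cl(3)]) (use closed int w(3) in auto)
  then have ne: "path_image c3 \<inter> inside (path_image c1 \<union> path_image c2) \<noteq> {}" using w(3) by blast
  obtain sp: "inside (path_image c1 \<union> path_image c3) \<inter> inside (path_image c2 \<union> path_image c3) = {}"
    "inside (path_image c1 \<union> path_image c3) \<union> inside (path_image c2 \<union> path_image c3) \<union>
      (path_image c3 - {a, b}) = inside (path_image c1 \<union> path_image c2)"
    by (rule split_inside_simple_closed_curve[OF arc_imp_simple_path[OF arcs(1)] ends(1,4)
          arc_imp_simple_path[OF arcs(2)] ends(2,5) arc_imp_simple_path[OF arcs(3)] ends(3,6) ab int ne])
  have "F \<subseteq> inside (path_image c1 \<union> path_image c3) \<union> inside (path_image c2 \<union> path_image c3)"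
    using ins sp(2) dis by blast
  moreover have "open (inside (path_image c1 \<union> path_image c3))" "open (inside (path_image c2 \<union> path_image c3))"
    using closed by (auto intro!: open_inside)
  ultimately have "inside (path_image c1 \<union> path_image c3) \<inter> F = {} \<or> inside (path_image c2 \<union> path_image c3) \<inter> F = {}"
    using sp(1) by (intro connectedD[OF F(1)]) auto
  then consider "F \<subseteq> inside (path_image c1 \<union> path_image c3)" | "F \<subseteq> inside (path_image c2 \<union> path_image c3)"
    using \<open>F \<subseteq> _ \<union> _\<close> by blast
  then show False
  proof cases
    case 1
    have "w2 \<in> inside (path_image c1 \<union> path_image c3)"
      by (rule closure_inside[OF _ 1 cl(2)]) (use closed int w(2) in auto)
    then have "w2 \<in> inside (path_image c1 \<union> path_image c2)" using sp(2) by blast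
    then show False using w(2) inside_no_overlap[of "path_image c1 \<union> path_image c2"] by blast
  next
    case 2
    have "w1 \<in> inside (path_image c2 \<union> path_image c3)"
      by (rule closure_inside[OF _ 2 cl(1)]) (use closed int w(1) in auto)
    then have "w1 \<in> inside (path_image c1 \<union> path_image c2)" using sp(2) by blast
    then show False using w(1) inside_no_overlap[of "path_image c1 \<union> path_image c2"] by blast
  qed
qed

text \<open>An inversion centred inside the curve formed by two of the arcs exchanges the two sides of it.\<close>

theorem theta_face:
  fixes c1 c2 c3 :: "real \<Rightarrow> complex"
  assumes t: "theta a b c1 c2 c3" and F: "topological_space_class.connected F" "F \<noteq> {}"
    and dis: "F \<inter> (path_image c1 \<union> path_image c2 \<union> path_image c3) = {}"
    and w: "w1 \<in> path_image c1 - {a, b}" "w2 \<in> path_image c2 - {a, b}" "w3 \<in> path_image c3 - {a, b}"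
    and cl: "w1 \<in> closure F" "w2 \<in> closure F" "w3 \<in> closure F"
  shows False
proof -
  define J where "J = path_image c1 \<union> path_image c2"
  have arcs: "arc c1" "arc c2" "arc c3" and ends: "pathstart c1 = a" "pathstart c2 = a" "pathstart c3 = a"
    "pathfinish c1 = b" "pathfinish c2 = b" "pathfinish c3 = b"
    and int: "path_image c1 \<inter> path_image c2 = {a, b}" "path_image c1 \<inter> path_image c3 = {a, b}"
    "path_image c2 \<inter> path_image c3 = {a, b}"
    using t unfolding theta_def by auto
  have Jordan: "inside (path_image d1 \<union> path_image d2) \<noteq> {} \<and> topological_space_class.connected (outside (path_image d1 \<union> path_image d2)) \<and>
      \<not> bounded (outside (path_image d1 \<union> path_image d2))"
    if "arc d1" "arc d2" "pathstart d1 = pathstart d2" "pathfinish d1 = pathfinish d2"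
      "path_image d1 \<inter> path_image d2 = {pathstart d1, pathfinish d1}" for d1 d2 :: "real \<Rightarrow> complex"
  proof -
    have "simple_path (d1 +++ reversepath d2)"
      by (rule simple_path_join_loop) (use that in \<open>auto simp: arc_reversepath\<close>)
    from Jordan_inside_outside[OF this] show ?thesis using that by (simp add: path_image_join)
  qed
  have closed: "closed J" unfolding J_def using arcs by (auto simp: closed_arc_image)
  have "\<not> F \<subseteq> inside J" unfolding J_def by (rule theta_inside[OF assms])
  then have Fout: "F \<subseteq> outside J"
    using connected_inside_or_outside[OF closed F(1)] dis unfolding J_def by blast
  have "inside J \<noteq> {}" using Jordan[OF arcs(1,2)] ends int unfolding J_def by auto
  then obtain z0 where z0: "z0 \<in> inside J" by blast
  \<comment> \<open>This keeps the centre of the inversion off the third arc.\<close>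
  have c3out: "path_image c3 - {a, b} \<subseteq> outside J"
  proof -
    have "topological_space_class.connected (path_image c3 - {a, b})"
      using connected_simple_path_endless[OF arc_imp_simple_path[OF arcs(3)]] ends by simp
    moreover have "(path_image c3 - {a, b}) \<inter> J = {}" unfolding J_def using int by blast
    moreover have "w3 \<in> outside J"
      by (rule closure_outside[OF closed Fout cl(3)]) (use calculation(2) w(3) in auto)
    moreover have "w3 \<notin> inside J" using calculation(3) inside_Int_outside[of J] by blast
    ultimately show ?thesis
      using connected_inside_or_outside[OF closed, of "path_image c3 - {a, b}"] w(3) by blast
  qed
  have z0J: "z0 \<notin> J" using z0 inside_no_overlap[of J] by blast
  have z0o: "z0 \<notin> outside J" using z0 inside_Int_outside[of J] by blast
  have "a \<in> J" "b \<in> J" unfolding J_def using int by auto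
  then have z03: "z0 \<notin> path_image c3" using c3out z0J z0o by blast
  have z012: "z0 \<notin> path_image c1" "z0 \<notin> path_image c2" using z0J unfolding J_def by auto
  have z0F: "z0 \<notin> F" using Fout z0o by blast
  define h where "h z = inverse (z - z0)" for z
  define g where "g w = z0 + inverse w" for w
  have gh: "g (h z) = z" for z unfolding g_def h_def by simp
  have hg: "h (g w) = w" for w unfolding g_def h_def by simp
  have inj: "inj h" using gh by (metis injI)
  have conth: "continuous_on S h" if "z0 \<notin> S" for S
    unfolding h_def using that by (intro continuous_intros) auto
  have contg: "continuous_on S g" if "0 \<notin> S" for S
    unfolding g_def using that by (intro continuous_intros) auto
  have arch: "arc (h \<circ> c)" if "arc c" "z0 \<notin> path_image c" for c
    unfolding arc_def
  proof
    show "path (h \<circ> c)" using arc_imp_path[OF that(1)] conth[OF that(2)] by (rule path_continuous_image)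
    have "inj_on c {0..1}" using that(1) unfolding arc_def by simp
    then show "inj_on (h \<circ> c) {0..1}" by (rule comp_inj_on) (rule inj_on_subset[OF inj subset_UNIV])
  qed
  have im: "path_image (h \<circ> c) = h ` path_image c" for c by (rule path_image_compose)
  have imI: "h ` A \<inter> h ` B = h ` (A \<inter> B)" for A B using image_Int[OF inj] by blast
  have t': "theta (h a) (h b) (h \<circ> c1) (h \<circ> c2) (h \<circ> c3)"
    unfolding theta_def using arch arcs z03 z012 ends int
    by (auto simp: im imI pathstart_compose pathfinish_compose)
  have clh: "h x \<in> closure (h ` F)" if xF: "x \<in> closure F" "x \<noteq> z0" for x
  proof -
    have "isCont h x" unfolding h_def using xF(2) by (intro continuous_intros) auto
    obtain s where s: "\<forall>n. s n \<in> F" "s \<longlonglongrightarrow> x"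
      using xF(1) unfolding closure_sequential by blast
    have "(\<lambda>n. h (s n)) \<longlonglongrightarrow> h x" by (rule isCont_tendsto_compose[OF \<open>isCont h x\<close> s(2)])
    moreover have "\<forall>n. h (s n) \<in> h ` F" using s(1) by simp
    ultimately show ?thesis unfolding closure_sequential by (intro exI[of _ "\<lambda>n. h (s n)"] conjI)
  qed
  define J' where "J' = path_image (h \<circ> c1) \<union> path_image (h \<circ> c2)"
  have J': "J' = h ` J" unfolding J'_def J_def im by blast
  have arcs': "arc (h \<circ> c1)" "arc (h \<circ> c2)" using arch arcs z012 by auto
  have closed': "closed J'" unfolding J'_def using arcs' by (auto simp: closed_arc_image)
  have conF: "topological_space_class.connected (h ` F)" by (rule connected_continuous_image[OF conth[OF z0F] F(1)])
  have FJ: "F \<inter> J = {}" using dis unfolding J_def by blast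
  have disF: "h ` F \<inter> J' = {}" unfolding J' imI FJ by simp
  have "h ` F \<subseteq> inside J'"
  proof (rule ccontr)
    assume "\<not> h ` F \<subseteq> inside J'"
    then have out: "h ` F \<subseteq> outside J'"
      using connected_inside_or_outside[OF closed' conF disF] by blast
    have J: "topological_space_class.connected (outside J')" "\<not> bounded (outside J')"
      using Jordan[OF arcs'] ends int unfolding J'_def
      by (auto simp: im imI pathstart_compose pathfinish_compose)
    \<comment> \<open>0 corresponds to infinity under the inversion and must be removed before
      mapping back; an open connected subset of the plane stays connected without one point.\<close>
    let ?O = "outside J' - {0}"
    have "topological_space_class.connected ?O" by (rule connected_open_delete[OF open_outside[OF closed'] J(1)]) simp
    then have con: "topological_space_class.connected (g ` ?O)" by (rule connected_continuous_image[rotated]) (rule contg, simp)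
    have "g ` ?O \<inter> J = {}"
    proof (rule ccontr)
      assume "\<not> ?thesis"
      then obtain x where "x \<in> ?O" "g x \<in> J" by blast
      then have "x \<in> J'" unfolding J' using hg by (metis imageI)
      then show False using \<open>x \<in> ?O\<close> outside_no_overlap[of J'] by blast
    qed
    then have "g ` ?O \<subseteq> inside J \<or> g ` ?O \<subseteq> outside J"
      by (rule connected_inside_or_outside[OF closed con])
    moreover obtain f where f: "f \<in> F" using F(2) by blast
    moreover have "h f \<in> ?O" using out f z0F unfolding h_def by auto
    then have "f \<in> g ` ?O" using gh by (metis imageI)
    moreover have "f \<notin> inside J" using f Fout inside_Int_outside[of J] by blast
    ultimately have sub: "g ` ?O \<subseteq> outside J" by blast
    obtain r where r: "r > 0" "ball z0 r \<subseteq> inside J"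
      using open_inside[OF closed] z0 open_contains_ball by blast
    \<comment> \<open>Mapped back, the outside avoids a disc around \<open>z0\<close>, so it would
      itself be bounded.\<close>
    have "norm x \<le> inverse r" if x: "x \<in> ?O" for x
    proof -
      have "g x \<notin> ball z0 r" using sub x r(2) inside_Int_outside[of J] by blast
      then have "r \<le> norm (inverse x)" unfolding g_def by (simp add: dist_norm)
      then have "r \<le> inverse (norm x)" by (simp add: norm_inverse)
      then show ?thesis using r(1) x by (metis inverse_inverse_eq le_imp_inverse_le)
    qed
    then have "bounded ?O" unfolding bounded_iff by blast
    then have "bounded (insert 0 ?O)" by (simp only: bounded_insert)
    then have "bounded (outside J')" by (rule bounded_subset) blast
    then show False using J(2) by blast
  qed
  moreover have "\<not> h ` F \<subseteq> inside J'"
    unfolding J'_def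
  proof (rule theta_inside[OF t' conF])
    show "h ` F \<noteq> {}" using F(2) by simp
    have "F \<inter> (path_image c1 \<union> path_image c2 \<union> path_image c3) = {}" by (rule dis)
    then show "h ` F \<inter> (path_image (h \<circ> c1) \<union> path_image (h \<circ> c2) \<union> path_image (h \<circ> c3)) = {}"
      unfolding im using inj by (auto simp: inj_eq)
    show "h w1 \<in> path_image (h \<circ> c1) - {h a, h b}" "h w2 \<in> path_image (h \<circ> c2) - {h a, h b}"
      "h w3 \<in> path_image (h \<circ> c3) - {h a, h b}"
      unfolding im using w inj by (auto simp: inj_eq)
    show "h w1 \<in> closure (h ` F)" "h w2 \<in> closure (h ` F)" "h w3 \<in> closure (h ` F)"
      using clh cl w z03 z012 by auto
  qed
  ultimately show False by blast
qed

section \<open>Outerplanar graphs\<close>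

lemma pair_graphD:
  assumes "pair_graph G"
  shows "finite (pverts G)" "finite (parcs G)" "sym (parcs G)" "(x, x) \<notin> parcs G"
    "parcs G \<subseteq> pverts G \<times> pverts G"
proof -
  interpret pair_graph G by fact
  show "finite (pverts G)" "finite (parcs G)" by (rule pair_finite_verts, rule pair_finite_arcs)
  show "sym (parcs G)" using pair_sym_arcs unfolding symmetric_def by simp
  show "(x, x) \<notin> parcs G" using pair_no_loops[of "(x, x)"] by auto
  show "parcs G \<subseteq> pverts G \<times> pverts G" using in_arcsD1 in_arcsD2 by auto
qed

fun walk_image :: "('a \<times> 'a \<Rightarrow> real \<Rightarrow> complex) \<Rightarrow> 'a list \<Rightarrow> complex set" where
  "walk_image \<gamma> (x # y # zs) = path_image (\<gamma> (x, y)) \<union> walk_image \<gamma> (y # zs)"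
| "walk_image \<gamma> _ = {}"

lemma walk_imageE:
  assumes "z \<in> walk_image \<gamma> vs" "successively (\<lambda>a b. (a, b) \<in> E) vs"
  obtains x y where "(x, y) \<in> E" "x \<in> set vs" "y \<in> set vs" "z \<in> path_image (\<gamma> (x, y))"
    "\<exists>i. Suc i < length vs \<and> x = vs ! i \<and> y = vs ! Suc i"
  using assms
proof (induction \<gamma> vs arbitrary: thesis rule: walk_image.induct)
  case (1 \<gamma> x y zs)
  then consider "z \<in> path_image (\<gamma> (x, y))" | "z \<in> walk_image \<gamma> (y # zs)" by auto
  then show ?case
  proof cases
    case a: 1
    show ?thesis by (rule "1.prems"(1)[of x y]) (use a "1.prems" in auto)
  next
    case 2
    show ?thesis
    proof (rule "1.IH"[OF _ 2])
      show "successively (\<lambda>a b. (a, b) \<in> E) (y # zs)" using "1.prems" by simp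
      fix s t assume st: "(s, t) \<in> E" "s \<in> set (y # zs)" "t \<in> set (y # zs)" "z \<in> path_image (\<gamma> (s, t))"
        "\<exists>i. Suc i < length (y # zs) \<and> s = (y # zs) ! i \<and> t = (y # zs) ! Suc i"
      then obtain i where "Suc i < length (y # zs)" "s = (y # zs) ! i" "t = (y # zs) ! Suc i" by blast
      then have "\<exists>i. Suc i < length (x # y # zs) \<and> s = (x # y # zs) ! i \<and> t = (x # y # zs) ! Suc i"
        by (intro exI[of _ "Suc i"]) simp
      then show thesis using st by (intro "1.prems"(1)) auto
    qed
  qed
qed auto

locale drawing =
  fixes G :: "'a pair_pre_digraph" and p :: "'a \<Rightarrow> complex" and \<gamma> :: "'a \<times> 'a \<Rightarrow> real \<Rightarrow> complex"
  assumes pg: "pair_graph G" and pe: "planar_embedding G p \<gamma>"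
begin

abbreviation "E \<equiv> parcs G"
abbreviation "V \<equiv> pverts G"

lemma EV: "(x, y) \<in> E \<Longrightarrow> x \<in> V" "(x, y) \<in> E \<Longrightarrow> y \<in> V"
  using pair_graphD(5)[OF pg] by blast+

lemma embedding:
  "inj_on p V"
  "\<forall>(u, v) \<in> E. arc (\<gamma> (u, v)) \<and> pathstart (\<gamma> (u, v)) = p u \<and> pathfinish (\<gamma> (u, v)) = p v \<and>
     \<gamma> (v, u) = reversepath (\<gamma> (u, v)) \<and> path_image (\<gamma> (u, v)) \<inter> p ` V = {p u, p v}"
  "\<forall>e \<in> E. \<forall>f \<in> E. f \<noteq> e \<and> f \<noteq> prod.swap e \<longrightarrow> path_image (\<gamma> e) \<inter> path_image (\<gamma> f) \<subseteq> p ` V"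
  using pe unfolding planar_embedding_def by argo+

lemma p_eq: "x \<in> V \<Longrightarrow> y \<in> V \<Longrightarrow> p x = p y \<Longrightarrow> x = y"
  using inj_onD[OF embedding(1)] by simp

lemma edge_arc:
  assumes "(x, y) \<in> E"
  shows "arc (\<gamma> (x, y))" "pathstart (\<gamma> (x, y)) = p x" "pathfinish (\<gamma> (x, y)) = p y"
    "path_image (\<gamma> (x, y)) \<inter> p ` V = {p x, p y}"
  using bspec[OF embedding(2) assms] by simp_all

lemma edge_cross:
  assumes "(x, y) \<in> E" "(s, t) \<in> E" "{x, y} \<noteq> {s, t}"
  shows "path_image (\<gamma> (x, y)) \<inter> path_image (\<gamma> (s, t)) \<subseteq> p ` ({x, y} \<inter> {s, t})"
proof
  fix z assume z: "z \<in> path_image (\<gamma> (x, y)) \<inter> path_image (\<gamma> (s, t))"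
  have "(s, t) \<noteq> (x, y)" "(s, t) \<noteq> prod.swap (x, y)" using assms(3) by auto
  then have "z \<in> p ` V" using embedding(3) assms(1,2) z by blast
  then have "z \<in> {p x, p y}" "z \<in> {p s, p t}"
    using z edge_arc(4)[OF assms(1)] edge_arc(4)[OF assms(2)] by blast+
  then obtain a b where "z = p a" "a \<in> {x, y}" "z = p b" "b \<in> {s, t}" by blast
  moreover from this have "a \<in> V" "b \<in> V" using EV assms(1,2) by blast+
  ultimately have "a = b" using p_eq by metis
  then show "z \<in> p ` ({x, y} \<inter> {s, t})" using \<open>z = p a\<close> \<open>a \<in> {x, y}\<close> \<open>b \<in> {s, t}\<close> by blast
qed

lemma walk_arc:
  assumes "successively (\<lambda>a b. (a, b) \<in> E) vs" "distinct vs" "2 \<le> length vs"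
  shows "\<exists>c. arc c \<and> pathstart c = p (hd vs) \<and> pathfinish c = p (last vs) \<and> path_image c = walk_image \<gamma> vs"
  using assms
proof (induction vs rule: induct_list012)
  case (3 x y zs)
  then have xy: "(x, y) \<in> E" by simp
  show ?case
  proof (cases "zs = []")
    case True
    then show ?thesis using edge_arc[OF xy] by (intro exI[of _ "\<gamma> (x, y)"]) simp
  next
    case False
    then obtain c where c: "arc c" "pathstart c = p y" "pathfinish c = p (last zs)"
      "path_image c = walk_image \<gamma> (y # zs)"
      using "3.IH"(2) "3.prems" by (cases zs) auto
    have "path_image (\<gamma> (x, y)) \<inter> path_image c \<subseteq> {p y}"
    proof
      fix z assume z: "z \<in> path_image (\<gamma> (x, y)) \<inter> path_image c"
      then have "z \<in> walk_image \<gamma> (y # zs)" using c by simp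
      then obtain s t where st: "(s, t) \<in> E" "s \<in> set (y # zs)" "t \<in> set (y # zs)" "z \<in> path_image (\<gamma> (s, t))"
        by (rule walk_imageE[where E=E]) (use "3.prems" in auto)
      have x: "x \<notin> set (y # zs)" using "3.prems" by simp
      then have "{x, y} \<noteq> {s, t}" using st by (metis insertI1 insertE singletonD)
      then have "z \<in> p ` ({x, y} \<inter> {s, t})" using edge_cross[OF xy st(1)] z st(4) by blast
      moreover have "{x, y} \<inter> {s, t} \<subseteq> {y}" using x st by auto
      ultimately show "z \<in> {p y}" by blast
    qed
    then have "arc (\<gamma> (x, y) +++ c)" using edge_arc[OF xy] c by (intro arc_join) auto
    then show ?thesis using edge_arc[OF xy] c False
      by (intro exI[of _ "\<gamma> (x, y) +++ c"]) (auto simp: path_image_join)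
  qed
qed auto

text \<open>Requiring an end in \<open>S\<close> for each step keeps the walk off the edge
  \<open>ab\<close> and its edges apart from those of other branches. The vertex \<open>x\<close>
  marks a point in the interior of the arc that the outer face has to reach.\<close>

lemma branch_arc:
  assumes S: "conn E S" "{a, b} \<subseteq> nbhd E S" "a \<noteq> b"
  shows "\<exists>vs c x. successively (\<lambda>a b. (a, b) \<in> E) vs \<and> set vs \<subseteq> insert a (insert b S) \<and>
    (\<forall>i. Suc i < length vs \<longrightarrow> vs ! i \<in> S \<or> vs ! Suc i \<in> S) \<and>
    arc c \<and> pathstart c = p a \<and> pathfinish c = p b \<and> path_image c = walk_image \<gamma> vs \<and>
    x \<in> S \<and> x \<in> V \<and> p x \<in> path_image c"
proof -
  have sym: "(y, x) \<in> E" if "(x, y) \<in> E" for x y using pair_graphD(3)[OF pg] that unfolding sym_def by blast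
  obtain s t where s: "s \<in> S" "(s, a) \<in> E" and t: "t \<in> S" "(t, b) \<in> E"
    using S(2) unfolding nbhd_def by blast
  have ab: "a \<notin> S" "b \<notin> S" using S(2) unfolding nbhd_def by blast+
  obtain xs0 where "xs0 \<noteq> []" "hd xs0 = s" "last xs0 = t" "set xs0 \<subseteq> S" "successively (\<lambda>a b. (a, b) \<in> E) xs0"
    using conn_walk[OF S(1) s(1) t(1)] by blast
  then have "ear E S a b xs0" unfolding ear_def using s t S(3) sym by auto
  then have "\<exists>xs. min_ear E S a b xs" by (rule ex_min_ear)
  then obtain xs where m: "min_ear E S a b xs" ..
  then have d: "distinct xs" by (rule min_ear_distinct)
  have e: "xs \<noteq> []" "set xs \<subseteq> S" "successively (\<lambda>a b. (a, b) \<in> E) xs" "(a, hd xs) \<in> E" "(last xs, b) \<in> E"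
    using min_earD(1)[OF m] unfolding ear_def by blast+
  let ?vs = "a # xs @ [b]"
  have suc: "successively (\<lambda>a b. (a, b) \<in> E) ?vs"
    using e by (auto simp: successively_append_iff successively_Cons)
  moreover have "distinct ?vs" using d e(2) ab S(3) by auto
  ultimately obtain c where c: "arc c" "pathstart c = p a" "pathfinish c = p b" "path_image c = walk_image \<gamma> ?vs"
    using walk_arc[of ?vs] by auto
  have "?vs ! i \<in> S \<or> ?vs ! Suc i \<in> S" if i: "Suc i < length ?vs" for i
  proof (cases "i < length xs")
    case True
    then have "?vs ! Suc i = xs ! i" by (simp add: nth_append)
    then show ?thesis using e(2) nth_mem[OF True] by auto
  next
    case False
    then have "i = length xs" using i by simp
    then have "?vs ! i = last xs" using e(1) by (cases i) (auto simp: nth_append last_conv_nth)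
    then show ?thesis using e(1,2) by (metis last_in_set subsetD)
  qed
  moreover have "hd xs \<in> S" using e(1,2) by auto
  moreover have "hd xs \<in> V" using e(4) EV by blast
  moreover have "p (hd xs) \<in> path_image c"
  proof -
    have "p (hd xs) \<in> path_image (\<gamma> (a, hd xs))"
      using edge_arc(3)[OF e(4)] pathfinish_in_path_image[of "\<gamma> (a, hd xs)"] by simp
    then show ?thesis unfolding c(4) using e(1) by (cases xs) auto
  qed
  moreover have "set ?vs \<subseteq> insert a (insert b S)" using e(2) by auto
  ultimately show ?thesis using suc c by blast
qed

text \<open>Each edge of the first walk has an end in \<open>S\<close> and no edge of the second
  does. They are different edges, so they meet at most in common end-vertices.\<close>

lemma branches_meet:
  assumes v: "successively (\<lambda>a b. (a, b) \<in> E) vs" "set vs \<subseteq> insert a (insert b S)"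
      "\<forall>i. Suc i < length vs \<longrightarrow> vs ! i \<in> S \<or> vs ! Suc i \<in> S"
    and w: "successively (\<lambda>a b. (a, b) \<in> E) ws" "set ws \<subseteq> insert a (insert b T)"
    and ST: "S \<inter> T = {}" "a \<notin> S" "b \<notin> S"
  shows "walk_image \<gamma> vs \<inter> walk_image \<gamma> ws \<subseteq> {p a, p b}"
proof
  fix z assume z: "z \<in> walk_image \<gamma> vs \<inter> walk_image \<gamma> ws"
  then have "z \<in> walk_image \<gamma> vs" "z \<in> walk_image \<gamma> ws" by auto
  from this(1) obtain x y where xy: "(x, y) \<in> E" "x \<in> set vs" "y \<in> set vs" "z \<in> path_image (\<gamma> (x, y))"
    "\<exists>i. Suc i < length vs \<and> x = vs ! i \<and> y = vs ! Suc i"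
    by (rule walk_imageE[OF _ v(1)])
  from \<open>z \<in> walk_image \<gamma> ws\<close> obtain s t where st: "(s, t) \<in> E" "s \<in> set ws" "t \<in> set ws" "z \<in> path_image (\<gamma> (s, t))"
    by (rule walk_imageE[OF _ w(1)])
  have "x \<in> S \<or> y \<in> S" using xy(5) v(3) by blast
  moreover have "s \<notin> S" "t \<notin> S" using st w(2) ST by blast+
  ultimately have "{x, y} \<noteq> {s, t}" by (auto simp: doubleton_eq_iff)
  then have "z \<in> p ` ({x, y} \<inter> {s, t})" using edge_cross[OF xy(1) st(1)] xy(4) st(4) by blast
  moreover have "{x, y} \<inter> {s, t} \<subseteq> {a, b}" using xy(2,3) v(2) \<open>s \<notin> S\<close> \<open>t \<notin> S\<close> by auto
  ultimately show "z \<in> {p a, p b}" by blast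
qed

lemma walk_image_subset:
  assumes "successively (\<lambda>a b. (a, b) \<in> E) vs"
  shows "walk_image \<gamma> vs \<subseteq> (\<Union>e\<in>E. path_image (\<gamma> e))"
proof
  fix z assume "z \<in> walk_image \<gamma> vs"
  then obtain x y where "(x, y) \<in> E" "z \<in> path_image (\<gamma> (x, y))"
    using assms by (rule walk_imageE)
  then show "z \<in> (\<Union>e\<in>E. path_image (\<gamma> e))" by (rule UN_I)
qed

text \<open>All vertices lie on the frontier of \<open>F\<close>, so its closure contains a vertex
  in the interior of each of the three arcs, against \<open>theta_face\<close>.\<close>

theorem outer_no_theta:
  assumes F: "F \<in> faces G p \<gamma>" "p ` V \<subseteq> frontier F"
  shows "no_theta E"
  unfolding no_theta_def
proof (intro notI, elim exE conjE)
  fix a b S1 S2 S3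
  assume ab: "a \<noteq> b" and c: "conn E S1" "conn E S2" "conn E S3"
    and d: "S1 \<inter> S2 = {}" "S1 \<inter> S3 = {}" "S2 \<inter> S3 = {}"
    and n: "{a, b} \<subseteq> nbhd E S1" "{a, b} \<subseteq> nbhd E S2" "{a, b} \<subseteq> nbhd E S3"
  obtain vs1 c1 x1 where 1: "successively (\<lambda>a b. (a, b) \<in> E) vs1" "set vs1 \<subseteq> insert a (insert b S1)"
    "\<forall>i. Suc i < length vs1 \<longrightarrow> vs1 ! i \<in> S1 \<or> vs1 ! Suc i \<in> S1"
    "arc c1" "pathstart c1 = p a" "pathfinish c1 = p b" "path_image c1 = walk_image \<gamma> vs1"
    "x1 \<in> S1" "x1 \<in> V" "p x1 \<in> path_image c1"
    using branch_arc[OF c(1) n(1) ab] by blast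
  obtain vs2 c2 x2 where 2: "successively (\<lambda>a b. (a, b) \<in> E) vs2" "set vs2 \<subseteq> insert a (insert b S2)"
    "\<forall>i. Suc i < length vs2 \<longrightarrow> vs2 ! i \<in> S2 \<or> vs2 ! Suc i \<in> S2"
    "arc c2" "pathstart c2 = p a" "pathfinish c2 = p b" "path_image c2 = walk_image \<gamma> vs2"
    "x2 \<in> S2" "x2 \<in> V" "p x2 \<in> path_image c2"
    using branch_arc[OF c(2) n(2) ab] by blast
  obtain vs3 c3 x3 where 3: "successively (\<lambda>a b. (a, b) \<in> E) vs3" "set vs3 \<subseteq> insert a (insert b S3)"
    "\<forall>i. Suc i < length vs3 \<longrightarrow> vs3 ! i \<in> S3 \<or> vs3 ! Suc i \<in> S3"
    "arc c3" "pathstart c3 = p a" "pathfinish c3 = p b" "path_image c3 = walk_image \<gamma> vs3"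
    "x3 \<in> S3" "x3 \<in> V" "p x3 \<in> path_image c3"
    using branch_arc[OF c(3) n(3) ab] by blast
  have out: "a \<notin> S1" "b \<notin> S1" "a \<notin> S2" "b \<notin> S2" "a \<notin> S3" "b \<notin> S3"
    using n unfolding nbhd_def by blast+
  have abV: "a \<in> V" "b \<in> V" using n(1) EV unfolding nbhd_def by blast+
  have ends: "{p a, p b} \<subseteq> path_image c1" "{p a, p b} \<subseteq> path_image c2" "{p a, p b} \<subseteq> path_image c3"
    using pathstart_in_path_image[of c1] pathfinish_in_path_image[of c1]
      pathstart_in_path_image[of c2] pathfinish_in_path_image[of c2]
      pathstart_in_path_image[of c3] pathfinish_in_path_image[of c3]
    unfolding 1(5,6) 2(5,6) 3(5,6) by simp_all
  have "path_image c1 \<inter> path_image c2 \<subseteq> {p a, p b}" "path_image c1 \<inter> path_image c3 \<subseteq> {p a, p b}"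
    "path_image c2 \<inter> path_image c3 \<subseteq> {p a, p b}"
    unfolding 1(7) 2(7) 3(7)
    by (rule branches_meet[OF 1(1-3) 2(1,2) d(1) out(1,2)], rule branches_meet[OF 1(1-3) 3(1,2) d(2) out(1,2)],
        rule branches_meet[OF 2(1-3) 3(1,2) d(3) out(3,4)])
  then have "path_image c1 \<inter> path_image c2 = {p a, p b}" "path_image c1 \<inter> path_image c3 = {p a, p b}"
    "path_image c2 \<inter> path_image c3 = {p a, p b}"
    using ends by (simp_all add: subset_antisym)
  then have t: "theta (p a) (p b) c1 c2 c3"
    unfolding theta_def using 1(4-6) 2(4-6) 3(4-6) by simp
  have F': "topological_space_class.connected F" "F \<noteq> {}" "F \<subseteq> - (p ` V \<union> (\<Union>e\<in>E. path_image (\<gamma> e)))"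
    using F(1) unfolding faces_def
    by (auto dest: in_components_connected in_components_nonempty in_components_subset)
  have dis: "F \<inter> (path_image c1 \<union> path_image c2 \<union> path_image c3) = {}"
    using F'(3) walk_image_subset[OF 1(1)] walk_image_subset[OF 2(1)] walk_image_subset[OF 3(1)]
    unfolding 1(7) 2(7) 3(7) by blast
  have cl: "p x \<in> closure F" if "x \<in> V" for x
    using F(2) that unfolding frontier_def by blast
  have w: "p x \<noteq> p a \<and> p x \<noteq> p b" if "x \<in> V" "x \<noteq> a" "x \<noteq> b" for x
    using p_eq abV that by blast
  show False
    by (rule theta_face[OF t F'(1,2) dis, of "p x1" "p x2" "p x3"])
      (use 1(8-10) 2(8-10) 3(8-10) out w[of x1] w[of x2] w[of x3] cl in auto)
qed

end

lemma outerplanar_no_theta: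
  assumes "pair_graph G" "outerplanar G"
  shows "no_theta (parcs G)"
  using assms drawing.outer_no_theta unfolding outerplanar_def drawing_def by blast

section \<open>Connected components, bridges and tree-freeness\<close>

lemma sccs_verts_eq_comps:
  assumes wf: "pair_wf_digraph H" and sym: "sym (parcs H)"
  shows "pre_digraph.sccs_verts (with_proj H) = comps (parcs H) (pverts H)"
proof -
  interpret pair_wf_digraph H by fact
  let ?R = "(parcs H \<inter> pverts H \<times> pverts H)\<^sup>*"
  have reach: "u \<rightarrow>\<^sup>*\<^bsub>with_proj H\<^esub> v \<longleftrightarrow> u \<in> pverts H \<and> (u, v) \<in> ?R" for u v
  proof
    assume "u \<rightarrow>\<^sup>*\<^bsub>with_proj H\<^esub> v"
    then have r: "(u, v) \<in> rtrancl_on (pverts H) (parcs H)" unfolding reachable_def by simp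
    then have "(u, v) \<in> ?R"
    proof induction
      case (step y z)
      then show ?case by (auto intro: converse_rtrancl_into_rtrancl)
    qed simp
    then show "u \<in> pverts H \<and> (u, v) \<in> ?R" using in_rtrancl_on_in_F[OF r] by blast
  next
    assume "u \<in> pverts H \<and> (u, v) \<in> ?R"
    then have u: "u \<in> pverts H" and "(u, v) \<in> ?R" by auto
    from this(2) have "(u, v) \<in> rtrancl_on (pverts H) (parcs H)"
      by induction (use u in \<open>auto intro: rtrancl_on_into_rtrancl_on\<close>)
    then show "u \<rightarrow>\<^sup>*\<^bsub>with_proj H\<^esub> v" unfolding reachable_def by simp
  qed
  have "sym ?R" using sym by (intro sym_rtrancl) (auto simp: sym_def)
  then have backwards: "(v, u) \<in> ?R" if "(u, v) \<in> ?R" for u v using that unfolding sym_def by blast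
  show ?thesis
  proof (intro set_eqI iffI)
    fix S assume "S \<in> pre_digraph.sccs_verts (with_proj H)"
    then have S: "S \<noteq> {}" "\<forall>u\<in>S. \<forall>v\<in>S. u \<in> pverts H \<and> (u, v) \<in> ?R"
      "\<forall>u\<in>S. \<forall>v. v \<notin> S \<longrightarrow> \<not> (u \<in> pverts H \<and> (u, v) \<in> ?R) \<or> \<not> (v \<in> pverts H \<and> (v, u) \<in> ?R)"
      unfolding pre_digraph.sccs_verts_def reach by auto
    then obtain u where u: "u \<in> S" "u \<in> pverts H" by blast
    have inV: "v \<in> pverts H" if "(u, v) \<in> ?R" for v using that by cases (use u in auto)
    have "S = {v. (u, v) \<in> ?R}"
    proof
      show "S \<subseteq> {v. (u, v) \<in> ?R}" using S(2) u(1) by blast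
      show "{v. (u, v) \<in> ?R} \<subseteq> S" using S(3) u backwards inV by blast
    qed
    then show "S \<in> comps (parcs H) (pverts H)" unfolding comps_def using u(2) by blast
  next
    fix S assume "S \<in> comps (parcs H) (pverts H)"
    then obtain x where x: "x \<in> pverts H" "S = {v. (x, v) \<in> ?R}" unfolding comps_def by blast
    have inV: "v \<in> pverts H" if "(x, v) \<in> ?R" for v using that by cases (use x in auto)
    have "(u, v) \<in> ?R" if "u \<in> S" "v \<in> S" for u v
      using that backwards[of x u] unfolding x(2) by (auto intro: rtrancl_trans)
    moreover have "v \<in> S" if "u \<in> S" "(u, v) \<in> ?R" for u v
      using that unfolding x(2) by (auto intro: rtrancl_trans)
    moreover have "x \<in> S" using x by simp
    ultimately show "S \<in> pre_digraph.sccs_verts (with_proj H)"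
      unfolding pre_digraph.sccs_verts_def reach using inV x(2) by blast
  qed
qed

lemma del_edges_wf:
  assumes "pair_graph G" "sym F"
  shows "pair_wf_digraph (del_edges G F)" "sym (parcs (del_edges G F))"
    "pverts (del_edges G F) = pverts G" "parcs (del_edges G F) = parcs G - F"
  using pair_graphD(5)[OF assms(1)] pair_graphD(3)[OF assms(1)] assms(2)
  unfolding del_edges_def pair_wf_digraph_def sym_def by auto

lemma verts_graph_components:
  assumes "pair_wf_digraph H" "sym (parcs H)"
  shows "verts ` graph_components H = comps (parcs H) (pverts H)"
    "card (graph_components H) = card (comps (parcs H) (pverts H))"
proof -
  interpret pair_wf_digraph H by fact
  show "verts ` graph_components H = comps (parcs H) (pverts H)"
    unfolding graph_components_def sccs_verts_eq_comps[OF assms, symmetric] sccs_verts_conv ..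
  show "card (graph_components H) = card (comps (parcs H) (pverts H))"
    unfolding graph_components_def sccs_verts_eq_comps[OF assms, symmetric] card_sccs_verts ..
qed

text \<open>Enlarging each component of \<open>E'\<close> to the component of \<open>E\<close>
  around it is surjective, but it identifies the classes of \<open>u\<close> and
  \<open>v\<close>.\<close>

lemma card_comps_less:
  assumes V: "finite V" and sym: "sym E" and EV: "E \<subseteq> V \<times> V" and uv: "(u, v) \<in> E"
    and sub: "E' \<subseteq> E" and nr: "(u, v) \<notin> E'\<^sup>*" and sym': "sym E'"
  shows "card (comps E V) < card (comps E' V)"
proof -
  have r: "E \<inter> V \<times> V = E" "E' \<inter> V \<times> V = E'" using EV sub by auto
  define f where "f K = {y. \<exists>x\<in>K. (x, y) \<in> E\<^sup>*}" for K
  have fx: "f {y. (x, y) \<in> E'\<^sup>*} = {y. (x, y) \<in> E\<^sup>*}" for x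
  proof
    have "(x, y) \<in> E\<^sup>*" if "(x, z) \<in> E'\<^sup>*" "(z, y) \<in> E\<^sup>*" for y z
      using rtrancl_mono[OF sub] that by (auto intro: rtrancl_trans)
    then show "f {y. (x, y) \<in> E'\<^sup>*} \<subseteq> {y. (x, y) \<in> E\<^sup>*}" unfolding f_def by blast
    show "{y. (x, y) \<in> E\<^sup>*} \<subseteq> f {y. (x, y) \<in> E'\<^sup>*}" unfolding f_def by blast
  qed
  have im: "comps E V = f ` comps E' V" unfolding comps_def r image_image fx ..
  have fin: "finite (comps E' V)" unfolding comps_def using V by simp
  have "card (comps E V) \<noteq> card (comps E' V)"
  proof
    assume "card (comps E V) = card (comps E' V)"
    then have inj: "inj_on f (comps E' V)" using fin im by (intro eq_card_imp_inj_on) simp_all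
    have "{y. (u, y) \<in> E\<^sup>*} = {y. (v, y) \<in> E\<^sup>*}"
      using uv sym unfolding sym_def by (auto intro: converse_rtrancl_into_rtrancl)
    moreover have "u \<in> V" "v \<in> V" using uv EV by auto
    then have "{y. (u, y) \<in> E'\<^sup>*} \<in> comps E' V" "{y. (v, y) \<in> E'\<^sup>*} \<in> comps E' V"
      unfolding comps_def r by auto
    ultimately have "{y. (u, y) \<in> E'\<^sup>*} = {y. (v, y) \<in> E'\<^sup>*}"
      using inj_onD[OF inj] fx by metis
    then show False using nr by blast
  qed
  moreover have "card (comps E V) \<le> card (comps E' V)" unfolding im by (rule card_image_le[OF fin])
  ultimately show ?thesis by simp
qed

text \<open>The component of \<open>w\<close> without bridges has a further vertex, so
  \<open>w\<close> has an edge that is not a bridge. Deleting that edge creates no component, so by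
  \<open>card_comps_less\<close> its ends remain connected.\<close>

lemma tree_free_cyclic:
  assumes G: "pair_graph G" and tf: "tree_free G" and w: "w \<in> pverts G"
  shows "\<exists>y. (w, y) \<in> parcs G \<and> (y, w) \<in> (parcs G - {(w, y), (y, w)})\<^sup>*"
proof -
  have symE: "sym (parcs G)" and EV: "parcs G \<subseteq> pverts G \<times> pverts G" and fV: "finite (pverts G)"
    using pair_graphD[OF G] by auto
  have symB: "sym (bridges G)"
    using symE unfolding bridges_def sym_def by (auto simp: insert_commute)
  note H = del_edges_wf[OF G symB]
  let ?R = "((parcs G - bridges G) \<inter> pverts G \<times> pverts G)\<^sup>*"
  have "{y. (w, y) \<in> ?R} \<in> comps (parcs G - bridges G) (pverts G)"
    unfolding comps_def using w by blast
  then have "{y. (w, y) \<in> ?R} \<in> verts ` graph_components (del_edges G (bridges G))"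
    using verts_graph_components(1)[OF H(1,2)] H(3,4) by simp
  then have card: "3 \<le> card {y. (w, y) \<in> ?R}" using tf unfolding tree_free_def by auto
  have "\<not> {y. (w, y) \<in> ?R} \<subseteq> {w}"
  proof
    assume "{y. (w, y) \<in> ?R} \<subseteq> {w}"
    then have "card {y. (w, y) \<in> ?R} \<le> card {w}" by (intro card_mono) auto
    then show False using card by simp
  qed
  then obtain x where "(w, x) \<in> ?R" "x \<noteq> w" by blast
  then obtain y where y: "(w, y) \<in> parcs G" "(w, y) \<notin> bridges G"
    by (metis DiffD1 DiffD2 IntD1 converse_rtranclE)
  let ?F = "{(w, y), (y, w)}"
  have symF: "sym ?F" unfolding sym_def by auto
  note D = del_edges_wf[OF G symF]
  have wfG: "pair_wf_digraph G" using G unfolding pair_graph_def pair_digraph_def pair_fin_digraph_def by blast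
  have "card (comps (parcs G - ?F) (pverts G)) \<le> card (comps (parcs G) (pverts G))"
    using y verts_graph_components(2)[OF D(1,2)] verts_graph_components(2)[OF wfG symE] D(3,4)
    unfolding bridges_def by simp
  then have "(w, y) \<in> (parcs G - ?F)\<^sup>*"
    using card_comps_less[OF fV symE EV y(1), of "parcs G - ?F"] D(2,4) by fastforce
  moreover have "sym ((parcs G - ?F)\<^sup>*)" using D(2,4) by (intro sym_rtrancl) simp
  ultimately have "(y, w) \<in> (parcs G - ?F)\<^sup>*" unfolding sym_def by blast
  then show ?thesis using y(1) by blast
qed

theorem theorem3:
  fixes G :: "'a pair_pre_digraph"
  assumes "pair_graph G"
    and "triangle_free G"
    and "tree_free G"
    and "outerplanar G"
  shows "proper_orientation_number G \<le> 4"
proof -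
  note G = pair_graphD[OF assms(1)]
  interpret class_graph "parcs G"
  proof
    show "no_theta (parcs G)" by (rule outerplanar_no_theta[OF assms(1,4)])
    show "(z, x) \<notin> parcs G" if "(x, y) \<in> parcs G" "(y, z) \<in> parcs G" for x y z
      using assms(2) that unfolding triangle_free_def by blast
    show "\<exists>y. (w, y) \<in> parcs G \<and> (y, w) \<in> (parcs G - {(w, y), (y, w)})\<^sup>*"
      if "w \<in> Field (parcs G)" for w
      using tree_free_cyclic[OF assms(1,3)] that G(5) unfolding Field_def by blast
  qed (use G in auto)
  obtain A where A: "orients A (parcs G)" "\<forall>x\<in>pverts G. indeg A x \<le> 4"
    "\<forall>(x, y)\<in>parcs G. indeg A x \<noteq> indeg A y"
    using orientation_exists[OF G(1,5)] by blast
  define D where "D = \<lparr>pverts = pverts G, parcs = A\<rparr>"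
  have deg: "in_degree (with_proj D) v = indeg A v" for v
  proof -
    have "in_arcs (with_proj D) v = (\<lambda>y. (y, v)) ` {y. (y, v) \<in> A}"
      unfolding in_arcs_def D_def by auto
    then show ?thesis unfolding in_degree_def indeg_def by (simp add: card_image inj_on_def)
  qed
  have "proper_orientation G D"
    using A(1,3) unfolding proper_orientation_def orientation_def deg orients_def by (simp add: D_def)
  then show ?thesis
    unfolding proper_orientation_number_def using A(2) deg by (intro Least_le) auto
qed

end
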